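(* Let $\mu>0$, $1<p\le 1+2/\mu$, $\theta\in(0,1)$ and $k>\max\{1,\mu\}$. Let $\delta_0>0$ (depending on $\theta,\mu,k$) be such that for every $\delta\in(0,\delta_0)$ and every $b\in C^2([0,\infty)\times\mathbf{R})$ satisfying $$|\partial_t^{\alpha}\partial_x^{\beta}b(t,x)|\le \frac{\delta}{(1+t)^{k+\alpha}}\quad(\alpha,\beta\in\{0,1\},\ (t,x)\in[0,\infty)\times\mathbf{R})\qquad(\mathrm{A})$$ there is a solution $h\in C^2([0,\infty)\times\mathbf{R})$ of $$h_{tt}-h_{xx}+\Big(\frac{\mu}{1+t}-b\Big)h_t-\Big(\frac{\mu}{1+t}b+b_t\Big)(1+h)=0\quad\text{on }[0,\infty)\times\mathbf{R}\qquad(\mathrm{H})$$ satisfying, for some constant $C>0$ and all $(t,x)\in[0,\infty)\times\mathbf{R}$, $$|h(t,x)|\le \frac{\theta}{(1+t)^{k-1}},\qquad |h_t(t,x)|+|h_x(t,x)|\le\frac{C}{(1+t)^{k}}\qquad(\mathrm{B})$$ (such a $\delta_0$ exists). Let $\delta\in(0,\delta_0)$, let $b\in C^2([0,\infty)\times\mathbf{R})$ satisfy (A), let $a(t,x)=\frac{\mu}{1+t}+b(t,x)$, let $h$ be such a solution of (H) satisfying (B), and put $g(t,x)=(1+t)^{\mu}(1+h(t,x))$. Let $(u_0,u_1)\in H^1(\mathbf{R})\times L^2(\mathbf{R})$ satisfy $$\liminf_{R\to\infty}\int_{-R}^{R}\Big(\big(-g_t(0,x)+g(0,x)a(0,x)\big)u_0(x)+g(0,x)u_1(x)\Big)\,dx>0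 .$$ Then the local solution $u$ of $$u_{tt}-u_{xx}+a(t,x)u_t=|u|^p,\quad (t,x)\in(0,\infty)\times\mathbf{R},\qquad (u,u_t)(0,x)=(u_0,u_1)(x),$$ blows up in finite time, that is, its maximal existence time $T^*$ is finite and $\lim_{t\to T^*-0}\|(u,u_t)(t)\|_{H^1\times L^2}=+\infty$.
   Context: For $T\in(0,\infty]$ let $X(T)=C([0,T);H^1(\mathbf{R}))\cap C^1([0,T);L^2(\mathbf{R}))$. A real-valued $u\in X(T)$ is a solution of the initial value problem on $[0,T)$ if for every $\psi\in C_0^2([0,T)\times\mathbf{R})$ (compact support in $[0,T)\times\mathbf{R}$, not necessarily vanishing at $t=0$) $$\int_{[0,T)\times\mathbf{R}}u\,(\partial_t^2\psi-\partial_x^2\psi-\partial_t(a\psi))\,dx\,dt=\int_{\mathbf{R}}\{(a(0,x)u_0(x)+u_1(x))\psi(0,x)-u_0(x)\partial_t\psi(0,x)\}\,dx+\int_{[0,T)\times\mathbf{R}}|u|^p\psi\,dx\,dt .$$ If $T=\infty$, $u$ is a global solution. Known local existence (may be assumed): for $1<p<\infty$ and $(u_0,u_1)\in H^1(\mathbf{R})\times L^2(\mathbf{R})$ there exist a (maximal) $T^*\in(0,+\infty]$ and a unique solution $u\in X(T^* )$, called the local solution; moreover if $T^*<+\infty$ then $\lim_{t\to T^*-0}\|(u,u_t)(t)\|_{H^1\times L^2}=+\infty$. *)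

theory Defs
  imports "HOL-Analysis.Analysis"
begin

section \<open>Classical derivatives on space-time slabs\<close>

text \<open>Functions of space-time are curried, time first. For \<open>T \<in> (0,\<infinity>]\<close> the slab is
  \<open>[0,T) \<times> \<real>\<close>.\<close>

definition slab :: "ereal \<Rightarrow> (real \<times> real) set" where
  "slab T = {(t, x). 0 \<le> t \<and> ereal t < T}"

text \<open>Time derivatives are taken within \<open>{0..}\<close>, hence one-sided at \<open>t = 0\<close>. For \<open>0 \<le> t < T\<close> this
  agrees with the derivative within \<open>[0,T)\<close>, so values of a function at times \<open>\<ge> T\<close> play no role.\<close>

definition Dt :: "(real \<Rightarrow> real \<Rightarrow> real) \<Rightarrow> real \<Rightarrow> real \<Rightarrow> real" where
  "Dt f t x = vector_derivative (\<lambda>s. f s x) (at t within {0..})"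

definition Dx :: "(real \<Rightarrow> real \<Rightarrow> real) \<Rightarrow> real \<Rightarrow> real \<Rightarrow> real" where
  "Dx f t x = deriv (f t) x"

definition C1_on :: "(real \<times> real) set \<Rightarrow> (real \<Rightarrow> real \<Rightarrow> real) \<Rightarrow> bool" where
  "C1_on S f \<longleftrightarrow>
     (\<forall>(t, x)\<in>S. (\<lambda>s. f s x) differentiable (at t within {0..}) \<and> f t differentiable (at x)) \<and>
     continuous_on S (\<lambda>(t, x). f t x) \<and>
     continuous_on S (\<lambda>(t, x). Dt f t x) \<and>
     continuous_on S (\<lambda>(t, x). Dx f t x)"

definition C2_on :: "(real \<times> real) set \<Rightarrow> (real \<Rightarrow> real \<Rightarrow> real) \<Rightarrow> bool" where
  "C2_on S f \<longleftrightarrow> C1_on S f \<and> C1_on S (Dt f) \<and> C1_on S (Dx f)"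

text \<open>The class \<open>C\<^sub>0\<^sup>2([0,T) \<times> \<real>)\<close>; its members need not vanish at \<open>t = 0\<close>.\<close>

definition C2_compact_support :: "ereal \<Rightarrow> (real \<Rightarrow> real \<Rightarrow> real) \<Rightarrow> bool" where
  "C2_compact_support T \<psi> \<longleftrightarrow>
     C2_on (slab T) \<psi> \<and>
     (\<exists>K. compact K \<and> K \<subseteq> slab T \<and> (\<forall>(t, x)\<in>slab T - K. \<psi> t x = 0))"

section \<open>\<open>L\<^sup>2(\<real>)\<close> and \<open>H\<^sup>1(\<real>)\<close>\<close>

text \<open>Elements of \<open>L\<^sup>2\<close> and \<open>H\<^sup>1\<close> are represented by functions, determined up to null sets. The norms
  below are meaningful only for members of the respective space, and are only used there.\<close>

definition L2 :: "(real \<Rightarrow> real) set" where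
  "L2 = {f \<in> borel_measurable lebesgue. integrable lebesgue (\<lambda>x. (f x)\<^sup>2)}"

definition L2_norm :: "(real \<Rightarrow> real) \<Rightarrow> real" where
  "L2_norm f = sqrt (LINT x|lebesgue. (f x)\<^sup>2)"

definition smooth_test :: "(real \<Rightarrow> real) \<Rightarrow> bool" where
  "smooth_test \<phi> \<longleftrightarrow>
     (\<forall>n x. (deriv ^^ n) \<phi> differentiable (at x)) \<and> compact (closure {x. \<phi> x \<noteq> 0})"

definition weak_deriv :: "(real \<Rightarrow> real) \<Rightarrow> (real \<Rightarrow> real) \<Rightarrow> bool" where
  "weak_deriv f v \<longleftrightarrow>
     (\<forall>\<phi>. smooth_test \<phi> \<longrightarrow>
        (LINT x|lebesgue. f x * deriv \<phi> x) = - (LINT x|lebesgue. v x * \<phi> x))"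

definition H1 :: "(real \<Rightarrow> real) set" where
  "H1 = {f \<in> L2. \<exists>v\<in>L2. weak_deriv f v}"

text \<open>The choice of the weak derivative is immaterial since any two agree almost everywhere.\<close>

definition H1_norm :: "(real \<Rightarrow> real) \<Rightarrow> real" where
  "H1_norm f = sqrt ((L2_norm f)\<^sup>2 + (L2_norm (SOME v. v \<in> L2 \<and> weak_deriv f v))\<^sup>2)"

definition H1_L2_norm :: "(real \<Rightarrow> real) \<Rightarrow> (real \<Rightarrow> real) \<Rightarrow> real" where
  "H1_L2_norm f v = sqrt ((H1_norm f)\<^sup>2 + (L2_norm v)\<^sup>2)"

section \<open>The space \<open>X(T) = C([0,T); H\<^sup>1) \<inter> C\<^sup>1([0,T); L\<^sup>2)\<close>\<close>

definition has_L2_deriv :: "(real \<Rightarrow> real \<Rightarrow> real) \<Rightarrow> (real \<Rightarrow> real) \<Rightarrow> real \<Rightarrow> bool" where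
  "has_L2_deriv u v t \<longleftrightarrow>
     v \<in> L2 \<and>
     ((\<lambda>s. L2_norm (\<lambda>x. (u s x - u t x) / (s - t) - v x)) \<longlongrightarrow> 0) (at t within {0..})"

text \<open>\<open>L2_dt u t\<close> is \<open>u\<^sub>t(t)\<close> as an element of \<open>L\<^sup>2\<close>, unique up to null sets.\<close>

definition L2_dt :: "(real \<Rightarrow> real \<Rightarrow> real) \<Rightarrow> real \<Rightarrow> real \<Rightarrow> real" where
  "L2_dt u t = (SOME v. has_L2_deriv u v t)"

text \<open>A curve of almost-everywhere classes need not be given by a jointly measurable function of
  \<open>(t,x)\<close>; the measurability clause fixes a representative for which space-time integrals make sense.
  It does not shrink the space: taking for each \<open>t\<close> the continuous representative of \<open>u(t) \<in> H\<^sup>1\<close>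
  even yields a jointly continuous function.\<close>

definition X :: "ereal \<Rightarrow> (real \<Rightarrow> real \<Rightarrow> real) set" where
  "X T = {u.
     set_borel_measurable lebesgue (slab T) (\<lambda>(t, x). u t x) \<and>
     (\<forall>t. 0 \<le> t \<and> ereal t < T \<longrightarrow>
        u t \<in> H1 \<and>
        ((\<lambda>s. H1_norm (\<lambda>x. u s x - u t x)) \<longlongrightarrow> 0) (at t within {0..}) \<and>
        (\<exists>v. has_L2_deriv u v t) \<and>
        ((\<lambda>s. L2_norm (\<lambda>x. L2_dt u s x - L2_dt u t x)) \<longlongrightarrow> 0) (at t within {0..}))}"

section \<open>Solutions of \<open>u\<^sub>t\<^sub>t - u\<^sub>x\<^sub>x + a u\<^sub>t = |u|\<^sup>p\<close>\<close>

definition solution ::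
  "(real \<Rightarrow> real \<Rightarrow> real) \<Rightarrow> real \<Rightarrow> (real \<Rightarrow> real) \<Rightarrow> (real \<Rightarrow> real) \<Rightarrow> ereal
     \<Rightarrow> (real \<Rightarrow> real \<Rightarrow> real) \<Rightarrow> bool" where
  "solution a p u0 u1 T u \<longleftrightarrow>
     u \<in> X T \<and>
     (\<forall>\<psi>. C2_compact_support T \<psi> \<longrightarrow>
        (LINT (t, x):slab T|lebesgue.
           u t x * (Dt (Dt \<psi>) t x - Dx (Dx \<psi>) t x - Dt (\<lambda>s y. a s y * \<psi> s y) t x))
        = (LINT x|lebesgue. (a 0 x * u0 x + u1 x) * \<psi> 0 x - u0 x * Dt \<psi> 0 x)
          + (LINT (t, x):slab T|lebesgue. \<bar>u t x\<bar> powr p * \<psi> t x))"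

text \<open>\<open>T\<close> is the maximal existence time and \<open>u\<close> a solution on all of \<open>[0,T)\<close>.\<close>

definition local_solution ::
  "(real \<Rightarrow> real \<Rightarrow> real) \<Rightarrow> real \<Rightarrow> (real \<Rightarrow> real) \<Rightarrow> (real \<Rightarrow> real) \<Rightarrow> ereal
     \<Rightarrow> (real \<Rightarrow> real \<Rightarrow> real) \<Rightarrow> bool" where
  "local_solution a p u0 u1 T u \<longleftrightarrow>
     0 < T \<and> solution a p u0 u1 T u \<and> (\<forall>T'>T. \<not> (\<exists>v. solution a p u0 u1 T' v))"

definition norm_blowup_at :: "real \<Rightarrow> (real \<Rightarrow> real \<Rightarrow> real) \<Rightarrow> bool" where
  "norm_blowup_at T u \<longleftrightarrow> filterlim (\<lambda>t. H1_L2_norm (u t) (L2_dt u t)) at_top (at_left T)"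

text \<open>The classical local existence result: a maximal solution exists, is unique, and its norm blows
  up if its existence time is finite.\<close>

definition local_existence :: "(real \<Rightarrow> real \<Rightarrow> real) \<Rightarrow> real \<Rightarrow> bool" where
  "local_existence a p \<longleftrightarrow>
     (\<forall>u0\<in>H1. \<forall>u1\<in>L2. \<exists>T u.
        local_solution a p u0 u1 T u \<and>
        (\<forall>v. solution a p u0 u1 T v \<longrightarrow>
           (\<forall>t. 0 \<le> t \<and> ereal t < T \<longrightarrow> (AE x in lebesgue. v t x = u t x))) \<and>
        (T < \<infinity> \<longrightarrow> norm_blowup_at (real_of_ereal T) u))"

section \<open>The perturbation \<open>b\<close> and the correction \<open>h\<close>\<close>

definition cond_A :: "real \<Rightarrow> real \<Rightarrow> (real \<Rightarrow> real \<Rightarrow> real) \<Rightarrow> bool" where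
  "cond_A k \<delta> b \<longleftrightarrow>
     (\<forall>\<alpha>\<in>{0, 1::nat}. \<forall>\<beta>\<in>{0, 1::nat}. \<forall>(t, x)\<in>slab \<infinity>.
        \<bar>(Dt ^^ \<alpha>) ((Dx ^^ \<beta>) b) t x\<bar> \<le> \<delta> / (1 + t) powr (k + real \<alpha>))"

definition eq_H :: "real \<Rightarrow> (real \<Rightarrow> real \<Rightarrow> real) \<Rightarrow> (real \<Rightarrow> real \<Rightarrow> real) \<Rightarrow> bool" where
  "eq_H \<mu> b h \<longleftrightarrow>
     (\<forall>(t, x)\<in>slab \<infinity>.
        Dt (Dt h) t x - Dx (Dx h) t x + (\<mu> / (1 + t) - b t x) * Dt h t x
        - (\<mu> / (1 + t) * b t x + Dt b t x) * (1 + h t x) = 0)"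

definition cond_B :: "real \<Rightarrow> real \<Rightarrow> (real \<Rightarrow> real \<Rightarrow> real) \<Rightarrow> bool" where
  "cond_B \<theta> k h \<longleftrightarrow>
     (\<exists>C>0. \<forall>(t, x)\<in>slab \<infinity>.
        \<bar>h t x\<bar> \<le> \<theta> / (1 + t) powr (k - 1) \<and>
        \<bar>Dt h t x\<bar> + \<bar>Dx h t x\<bar> \<le> C / (1 + t) powr k)"

end

theory Submission
  imports Defs "HOL-Real_Asymp.Real_Asymp"
begin

text \<open>If the solution were global, test the equation with \<open>\<psi> = g \<phi>\<^sub>R\<close>, where \<open>\<phi>\<^sub>R\<close> is a cutoff at scale \<open>R\<close> in
  both \<open>t\<close> and \<open>x\<close>. Since \<open>g\<close> solves the adjoint equation, only terms containing derivatives of \<open>\<phi>\<^sub>R\<close> survive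
  on the left; by Young's inequality and \<open>p \<le> 1 + 2 / \<mu>\<close> they are bounded by a small multiple of the
  integral of \<open>\<bar>u\<bar>\<^sup>p g \<phi>\<^sub>R\<close> over the annulus between the scales \<open>R\<close> and \<open>2R\<close> plus a constant that can be made
  small. The initial data contribute at least a fixed positive amount. Hence \<open>\<bar>u\<bar>\<^sup>p g\<close> is integrable, yet
  its mass on every dyadic annulus is bounded below, a contradiction. The integrals make sense because
  \<open>H\<^sup>1\<close> embeds into \<open>L\<^sup>\<infinity>\<close>, so that \<open>u\<close> is locally bounded. Once the existence time is known to be finite,
  the norm blows up by the local theory.\<close>

section \<open>Smooth ramps\<close>

text \<open>With \<open>q\<close> conjugate to \<open>p\<close>, the condition
  \<open>p \<le> 1 + 2 / \<mu>\<close> is equivalent to \<open>\<mu> + 2 \<le> 2 * q\<close>. At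
  equality the remainder in Young's inequality scales exactly like a constant in \<open>R\<close>,
  so letting \<open>R\<close> grow yields no smallness. Smallness comes from Young's parameter
  \<epsilon>, but only one kind at a time: a small \<epsilon> absorbs the nonlinear term and gives a
  bound uniform in \<open>R\<close>; a suitably large \<epsilon> pushes the remainder below the data
  term, at the price of a large factor in front of the mass on the annulus. The contradiction
  combines the two choices.

  Two obstacles shape the rest. The data integrand is not known to be integrable on the line: only
  its integrals over symmetric intervals are eventually bounded below. Moreover, \<open>H1\<close>
  and \<open>X\<close> consist of almost everywhere classes given by representatives, so bounds
  valid for each single time must be made joint in \<open>(t, x)\<close>, and norm blow-up must be
  carried from one representative of the solution to another.\<close>

definition flat :: "nat \<Rightarrow> real \<Rightarrow> real" where
  "flat k x = (if x > 0 then exp (- inverse x) * inverse x ^ k else 0)"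

lemma flat_tendsto_0: "(flat k \<longlongrightarrow> 0) (at 0)"
proof (rule filterlim_split_at)
  show "(flat k \<longlongrightarrow> 0) (at_left 0)"
    by (rule tendsto_eventually) (auto simp: flat_def eventually_at_filter)
  have "((\<lambda>x. inverse x ^ k / exp (inverse x)) \<longlongrightarrow> 0) (at_right (0::real))"
    by (rule filterlim_compose[OF tendsto_power_div_exp_0 filterlim_inverse_at_top_right])
  then show "(flat k \<longlongrightarrow> 0) (at_right 0)"
    by (rule Lim_transform_eventually)
      (auto simp: flat_def eventually_at_filter exp_minus field_simps)
qed

text \<open>The difference quotient of \<open>flat k\<close> at the origin is
  \<open>flat (k + 1)\<close>, which tends to \<open>0\<close> there. The factors
  \<open>inverse x ^ k\<close> are carried along so that the linear span of the family is closed
  under differentiation.\<close>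

lemma DERIV_flat: "(flat k has_real_derivative flat (k+2) x - real k * flat (k+1) x) (at x)"
proof -
  consider "x > 0" | "x < 0" | "x = 0" by linarith
  then show ?thesis
  proof cases
    case 1
    let ?y = "inverse x"
    have "((\<lambda>x. exp (- inverse x) * inverse x ^ k) has_real_derivative
            exp (- ?y) * (?y * ?y) * ?y ^ k - exp (- ?y) * (real k * ?y ^ (k - 1) * (?y * ?y))) (at x)"
      using 1 by (auto intro!: derivative_eq_intros simp: algebra_simps)
    also have "exp (- ?y) * (?y * ?y) * ?y ^ k - exp (- ?y) * (real k * ?y ^ (k - 1) * (?y * ?y))
        = flat (k+2) x - real k * flat (k+1) x"
      using 1 by (cases k) (simp_all add: flat_def algebra_simps)
    finally have "((\<lambda>x. exp (- inverse x) * inverse x ^ k) has_real_derivative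
            flat (k+2) x - real k * flat (k+1) x) (at x)" .
    note D = this
    have ev: "\<forall>\<^sub>F y in nhds x. flat k y = exp (- inverse y) * inverse y ^ k"
      using eventually_nhds_in_open[of "{0<..}" x] 1
      by (auto elim!: eventually_mono simp: flat_def)
    show ?thesis using DERIV_cong_ev[OF refl ev refl] D by simp
  next
    case 2
    have D: "((\<lambda>x. 0) has_real_derivative flat (k+2) x - real k * flat (k+1) x) (at x)"
      using 2 by (auto simp: flat_def)
    have ev: "\<forall>\<^sub>F y in nhds x. flat k y = 0"
      using eventually_nhds_in_open[of "{..<0}" x] 2
      by (auto elim!: eventually_mono simp: flat_def)
    show ?thesis using DERIV_cong_ev[OF refl ev refl] D by simp
  next
    case 3
    have "flat (Suc k) = (\<lambda>h. (flat k (0+h) - flat k 0) / h)"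
      by (auto simp: flat_def fun_eq_iff field_simps)
    then have "((\<lambda>h. (flat k (0+h) - flat k 0) / h) \<longlongrightarrow> 0) (at 0)"
      using flat_tendsto_0[of "Suc k"] by simp
    then show ?thesis using 3 by (simp add: DERIV_def flat_def)
  qed
qed

text \<open>A class closed under differentiation that contains a bump supported on the unit
  interval. Smoothness then follows by induction, with no formula for the derivative of order
  \<open>n\<close>.\<close>

inductive_set bumps :: "(real \<Rightarrow> real) set" where
  bumps_flat: "(\<lambda>x. flat i x * flat j (1 - x)) \<in> bumps"
| bumps_add: "f \<in> bumps \<Longrightarrow> g \<in> bumps \<Longrightarrow> (\<lambda>x. f x + g x) \<in> bumps"
| bumps_mult: "f \<in> bumps \<Longrightarrow> (\<lambda>x. c * f x) \<in> bumps"

lemma bumps_DERIV: "f \<in> bumps \<Longrightarrow> \<exists>f'\<in>bumps. \<forall>x. (f has_real_derivative f' x) (at x)"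
proof (induction rule: bumps.induct)
  case (bumps_flat i j)
  let ?f' = "\<lambda>x. (flat (i+2) x * flat j (1-x) + (- real i) * (flat (i+1) x * flat j (1-x)))
     + ((-1) * (flat i x * flat (j+2) (1-x)) + real j * (flat i x * flat (j+1) (1-x)))"
  have "?f' \<in> bumps" by (intro bumps.intros)
  moreover have "((\<lambda>x. flat i x * flat j (1 - x)) has_real_derivative ?f' x) (at x)" for x
    by (rule derivative_eq_intros DERIV_flat DERIV_chain2[OF DERIV_flat] refl)+
      (simp add: algebra_simps)
  ultimately show ?case by (intro bexI[of _ ?f']) auto
next
  case (bumps_add f g)
  then obtain f' g' where "f' \<in> bumps" "g' \<in> bumps" "\<forall>x. (f has_real_derivative f' x) (at x)"
    "\<forall>x. (g has_real_derivative g' x) (at x)" by blast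
  then show ?case
    by (intro bexI[of _ "\<lambda>x. f' x + g' x"]) (auto intro!: derivative_intros bumps.intros)
next
  case (bumps_mult f c)
  then obtain f' where "f' \<in> bumps" "\<forall>x. (f has_real_derivative f' x) (at x)" by blast
  then show ?case
    by (intro bexI[of _ "\<lambda>x. c * f' x"]) (auto intro!: DERIV_cmult bumps.intros)
qed

definition smooth :: "(real \<Rightarrow> real) \<Rightarrow> bool" where
  "smooth f \<longleftrightarrow> (\<forall>n x. (deriv ^^ n) f differentiable (at x))"

lemma deriv_eqI: "(\<And>x. (f has_real_derivative f' x) (at x)) \<Longrightarrow> deriv f = f'" for f' :: "real \<Rightarrow> real"
  by (rule ext) (simp add: DERIV_imp_deriv)

lemma smooth_bumps:
  assumes "f \<in> bumps" shows "smooth f"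
proof -
  have *: "(deriv ^^ n) f \<in> bumps" for n
  proof (induction n)
    case (Suc n)
    then obtain f' where "f' \<in> bumps" "deriv ((deriv ^^ n) f) = f'"
      using bumps_DERIV deriv_eqI by metis
    then show ?case by simp
  qed (use assms in simp)
  show ?thesis unfolding smooth_def
    using bumps_DERIV[OF *] by (meson real_differentiable_def)
qed

lemma smooth_antideriv:
  assumes "\<And>x. (f has_real_derivative f' x) (at x)" "smooth f'"
  shows "smooth f"
  unfolding smooth_def
proof (intro allI)
  fix n x
  show "(deriv ^^ n) f differentiable (at x)"
  proof (cases n)
    case 0 then show ?thesis using assms(1) real_differentiable_def by auto
  next
    case (Suc m)
    then have "(deriv ^^ n) f = (deriv ^^ m) f'"
      using deriv_eqI[OF assms(1)] by (simp only: funpow_Suc_right o_def)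
    then show ?thesis using assms(2) by (simp add: smooth_def)
  qed
qed

lemma smooth_deriv_DERIV:
  "smooth f \<Longrightarrow> ((deriv ^^ n) f has_real_derivative (deriv ^^ Suc n) f x) (at x)"
  by (simp add: smooth_def DERIV_deriv_iff_real_differentiable)

lemma smoothI:
  assumes "\<And>n x. (F n has_real_derivative F (Suc n) x) (at x)" 
  shows "smooth (F 0)"
proof -
  have *: "(deriv ^^ n) (F 0) = F n" for n
    by (induction n) (use deriv_eqI[OF assms] in auto)
  show ?thesis unfolding smooth_def *
    using assms real_differentiable_def by blast
qed

text \<open>Three terms, one for each kink of the piecewise linear function used below as a test
  function.\<close>

lemma smooth_affine_comb3:
  fixes f :: "real \<Rightarrow> real"
  assumes "smooth f"
  shows "smooth (\<lambda>x. c1 * f (m * (x - y1)) + c2 * f (m * (x - y2)) + c3 * f (m * (x - y3)))"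
proof -
  let ?F = "\<lambda>n x. m ^ n * (c1 * (deriv ^^ n) f (m * (x - y1)) + c2 * (deriv ^^ n) f (m * (x - y2))
     + c3 * (deriv ^^ n) f (m * (x - y3)))"
  have "smooth (?F 0)"
    by (rule smoothI[of ?F])
      (rule derivative_eq_intros DERIV_chain2[OF smooth_deriv_DERIV[OF assms]] refl | 
       simp add: algebra_simps)+
  then show ?thesis by simp
qed

lemma antiderivative_exists:
  fixes f :: "real \<Rightarrow> real"
  assumes "\<And>x. isCont f x"
  shows "\<exists>F. F 0 = 0 \<and> (\<forall>x. (F has_real_derivative f x) (at x))"
proof -
  obtain F where F: "\<And>x. (F has_real_derivative f x) (at x)"
    using einterval_antiderivative[of "-\<infinity>" \<infinity> f] assms
    by (auto simp: has_real_derivative_iff_has_vector_derivative)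
  show ?thesis
    by (rule exI[of _ "\<lambda>x. F x - F 0"]) (auto intro!: derivative_eq_intros F)
qed

lemma DERIV_zero_imp_eq:
  fixes f :: "real \<Rightarrow> real"
  assumes "\<And>x. (f has_real_derivative f' x) (at x)" "\<And>x. x \<in> {a..b} \<Longrightarrow> f' x = 0" "a \<le> b"
  shows "f a = f b"
proof (cases "a = b")
  case False
  have "continuous_on {a..b} f"
    using DERIV_isCont[OF assms(1)] by (intro continuous_at_imp_continuous_on) auto
  moreover have "(f has_real_derivative 0) (at x)" if "a < x" "x < b" for x
    using assms(1)[of x] assms(2)[of x] that by auto
  ultimately have "f b = f a" using DERIV_isconst2[of a b f b] assms(3) False by simp
  then show ?thesis by simp
qed simp

text \<open>A bump is integrated twice: its normalised antiderivative is a smooth step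
  \<open>H\<close>, and the antiderivative of \<open>H\<close> is a ramp \<open>K\<close> that
  beyond \<open>1\<close> is the identity up to a constant shift. The shift disappears later because
  the coefficients \<open>1 - d\<close>, \<open>-1\<close>, \<open>d\<close> of the three ramps add
  up to zero.\<close>

lemma smooth_ramp_exists:
  obtains K H :: "real \<Rightarrow> real"
  where "\<And>x. isCont H x" "\<And>x. (K has_real_derivative H x) (at x)" "smooth K"
    "\<And>x. x \<le> 0 \<Longrightarrow> K x = 0" "\<And>x. x \<ge> 1 \<Longrightarrow> K x = x - (1 - K 1)"
    "\<And>x. x \<le> 0 \<Longrightarrow> H x = 0" "\<And>x. x \<ge> 1 \<Longrightarrow> H x = 1" "\<And>x. 0 \<le> H x" "\<And>x. H x \<le> 1"
    "\<And>x. 0 \<le> K x" "\<And>x. K x \<le> max 0 x"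
proof -
  define B where "B = (\<lambda>x. flat 0 x * flat 0 (1 - x))"
  have B: "B \<in> bumps" unfolding B_def by (rule bumps_flat)
  have B0: "B x \<ge> 0" for x by (simp add: B_def flat_def)
  have Bpos: "B x > 0" if "0 < x" "x < 1" for x using that by (simp add: B_def flat_def)
  have Bz: "B x = 0" if "x \<le> 0 \<or> 1 \<le> x" for x using that by (auto simp: B_def flat_def)
  obtain G where G0: "G 0 = 0" and G: "\<And>x. (G has_real_derivative B x) (at x)"
    using antiderivative_exists[of B] bumps_DERIV[OF B] DERIV_isCont by metis
  have mono: "G x \<le> G y" if "x \<le> y" for x y
    by (rule DERIV_nonneg_imp_nondecreasing[OF that]) (use G B0 in blast)
  have "G 0 < G 1"
    by (rule DERIV_pos_imp_increasing_open[of 0 1 G]) 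
      (use G Bpos DERIV_isCont[OF G] in \<open>auto intro!: continuous_at_imp_continuous_on\<close>)
  then have G1: "G 1 > 0" using G0 by simp
  define H where "H = (\<lambda>x. (1 / G 1) * G x)"
  have HD: "(H has_real_derivative (1 / G 1) * B x) (at x)" for x
    unfolding H_def by (intro DERIV_cmult G)
  have "smooth H" 
    by (rule smooth_antideriv[OF HD smooth_bumps[OF bumps_mult[OF B]]])
  have Hl: "H x = 0" if "x \<le> 0" for x
    using DERIV_zero_imp_eq[OF G, of x 0] that Bz G0 by (auto simp: H_def)
  have Hr: "H x = 1" if "x \<ge> 1" for x
    using DERIV_zero_imp_eq[OF G, of 1 x] that Bz G1 by (auto simp: H_def)
  have H0: "0 \<le> H x" for x
  proof (cases "x \<le> 0")
    case False
    then have "0 \<le> G x" using mono[of 0 x] G0 by simp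
    then show ?thesis using G1 by (simp add: H_def)
  qed (simp add: Hl)
  have H1: "H x \<le> 1" for x
  proof (cases "x \<ge> 1")
    case False
    then have "G x \<le> G 1" using mono by simp
    then show ?thesis using G1 by (simp add: H_def)
  qed (simp add: Hr)
  obtain K where K0: "K 0 = 0" and K: "\<And>x. (K has_real_derivative H x) (at x)"
    using antiderivative_exists[of H] HD DERIV_isCont by metis
  have "smooth K" by (rule smooth_antideriv[OF K \<open>smooth H\<close>])
  have Kl: "K x = 0" if "x \<le> 0" for x
    using DERIV_zero_imp_eq[OF K, of x 0] that Hl K0 by auto
  have D: "((\<lambda>x. x - K x) has_real_derivative 1 - H x) (at x)" for x
    by (auto intro!: derivative_eq_intros K)
  have Kr: "K x = x - (1 - K 1)" if "x \<ge> 1" for x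
    using DERIV_zero_imp_eq[OF D, of 1 x] that Hr by auto
  have Kpos: "0 \<le> K x" for x
    using Kl DERIV_nonneg_imp_nondecreasing[of 0 x K] K H0 K0 by (metis le_cases order_refl)
  have "K x \<le> x" if "x \<ge> 0" for x
    using DERIV_nonneg_imp_nondecreasing[of 0 x "\<lambda>x. x - K x"] D H1 K0 that by force
  then have Kmax: "K x \<le> max 0 x" for x
    using Kl[of x] by (cases "x \<ge> 0") auto
  show thesis
    by (rule that[OF DERIV_isCont[OF HD] K \<open>smooth K\<close> Kl Kr Hl Hr H0 H1 Kpos Kmax])
qed

lemma L2_set_integrable:
  assumes "f \<in> L2" "S \<in> lmeasurable"
  shows "integrable lebesgue (\<lambda>x. indicator S x * f x)"
proof (rule Bochner_Integration.integrable_bound)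
  show "integrable lebesgue (\<lambda>x. indicator S x + (f x)\<^sup>2 :: real)"
    using assms by (auto simp: L2_def lmeasurable_iff_integrable)
  have [measurable]: "S \<in> sets lebesgue" "f \<in> borel_measurable lebesgue"
    using assms by (auto simp: L2_def fmeasurableD)
  show "(\<lambda>x. indicator S x * f x) \<in> borel_measurable lebesgue" by measurable
  have *: "\<bar>z\<bar> \<le> \<bar>1 + z\<^sup>2\<bar>" for z :: real
  proof -
    have "0 \<le> (\<bar>z\<bar> - 1/2)\<^sup>2" by (rule zero_le_power2)
    also have "\<dots> = z\<^sup>2 - \<bar>z\<bar> + 1/4" by (simp add: power2_diff power_divide)
    finally show ?thesis by linarith
  qed
  show "AE x in lebesgue. norm (indicator S x * f x) \<le> norm (indicator S x + (f x)\<^sup>2)"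
  proof (rule AE_I2)
    fix x
    show "norm (indicator S x * f x) \<le> norm (indicator S x + (f x)\<^sup>2)"
      using *[of "f x"] by (cases "x \<in> S") simp_all
  qed
qed

section \<open>Weak derivatives and boundedness\<close>

text \<open>The trapezoid tested here has derivative \<open>1\<close> on an interval of length \<open>d\<close> minus \<open>d\<close> times the
  indicator of a unit interval. It is the limit of the smooth test functions obtained by replacing each
  kink by a rescaled smooth ramp, so that no mollification of \<open>f\<close> is needed.\<close>

lemma weak_deriv_hat:
  assumes f: "f \<in> L2" and v: "v \<in> L2" and w: "weak_deriv f v" and d: "0 < d" "d \<le> 1"
  shows "(LINT x|lebesgue. f x * ((1 - d) * indicator {y<..} x - indicator {y+d<..} x + d * indicator {y+1<..} x))
     = - (LINT x|lebesgue. v x * ((1 - d) * max 0 (x - y) - max 0 (x - (y+d)) + d * max 0 (x - (y+1))))"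
proof -
  obtain K H :: "real \<Rightarrow> real" where cH: "\<And>x. isCont H x"
    and DK: "\<And>x. (K has_real_derivative H x) (at x)" and sK: "smooth K"
    and K0: "\<And>x. x \<le> 0 \<Longrightarrow> K x = 0" and K1: "\<And>x. x \<ge> 1 \<Longrightarrow> K x = x - (1 - K 1)"
    and H0: "\<And>x. x \<le> 0 \<Longrightarrow> H x = 0" and H1: "\<And>x. x \<ge> 1 \<Longrightarrow> H x = 1" 
    and Hb: "\<And>x. 0 \<le> H x" "\<And>x. H x \<le> 1"
    and Kb: "\<And>x. 0 \<le> K x" "\<And>x. K x \<le> max 0 x"
    using smooth_ramp_exists by metis
  define c0 where "c0 = 1 - K 1"
  have K1': "x \<ge> 1 \<Longrightarrow> K x = x - c0" for x unfolding c0_def by (rule K1)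
  define \<phi> where "\<phi> n x = (1-d)/real n * K (real n * (x - y)) + (-1/real n) * K (real n * (x - (y+d)))
       + d / real n * K (real n * (x - (y+1)))" for n x
  define \<phi>' where "\<phi>' n x = (1-d) * H (real n * (x - y)) - H (real n * (x - (y+d)))
       + d * H (real n * (x - (y+1)))" for n x
  have D: "(\<phi> n has_real_derivative \<phi>' n x) (at x)" if "n \<ge> 1" for n x
    unfolding \<phi>_def \<phi>'_def
    by (rule derivative_eq_intros DERIV_chain2[OF DK] refl)+ (use that in \<open>simp add: field_simps\<close>)
  \<comment> \<open>The interval reaches to \<open>y + 2\<close> although the last kink is at
    \<open>y + 1\<close>: a rescaled ramp becomes affine only at distance \<open>1 / n\<close>
    beyond its kink. To the right of that, the three affine pieces cancel, in slope and in constant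
    term.\<close>
  have supp: "\<phi> n x = 0" "\<phi>' n x = 0" if "n \<ge> 1" "x \<notin> {y..y+2}" for n x
  proof -
    have "\<phi> n x = 0 \<and> \<phi>' n x = 0"
    proof (cases "x < y")
      case True
      then have "real n * (x - y) \<le> 0" "real n * (x - (y+d)) \<le> 0" "real n * (x - (y+1)) \<le> 0"
        using d by (auto simp: mult_le_0_iff)
      then show ?thesis by (simp add: \<phi>_def \<phi>'_def H0 K0)
    next
      case False
      then have "x > y + 2" using that by auto
      then have "x - y \<ge> 1" "x - (y+d) \<ge> 1" "x - (y+1) \<ge> 1" using d by auto
      then have "real n * (x - y) \<ge> 1" "real n * (x - (y+d)) \<ge> 1" "real n * (x - (y+1)) \<ge> 1"
        using mult_mono[of 1 "real n" 1] that(1) by auto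
      then show ?thesis using that(1)
        by (simp only: \<phi>_def \<phi>'_def H1 K1') (simp add: field_simps)
    qed
    then show "\<phi> n x = 0" "\<phi>' n x = 0" by auto
  qed
  have test: "smooth_test (\<phi> n)" if "n \<ge> 1" for n
    unfolding smooth_test_def
  proof
    show "\<forall>m x. (deriv ^^ m) (\<phi> n) differentiable at x"
      using smooth_affine_comb3[OF sK] unfolding \<phi>_def[abs_def] smooth_def[symmetric] .
    have "{x. \<phi> n x \<noteq> 0} \<subseteq> {y..y+2}" using supp(1)[OF that] by blast
    then have "bounded {x. \<phi> n x \<noteq> 0}" using bounded_closed_interval bounded_subset by blast
    then show "compact (closure {x. \<phi> n x \<noteq> 0})" by (simp add: compact_closure)
  qed
  have eq: "(LINT x|lebesgue. f x * \<phi>' (Suc n) x) = - (LINT x|lebesgue. v x * \<phi> (Suc n) x)" for n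
    using w test[of "Suc n"] deriv_eqI[OF D[of "Suc n"]] by (auto simp: weak_deriv_def)
  have [measurable]: "f \<in> borel_measurable lebesgue" "v \<in> borel_measurable lebesgue"
    using f v by (auto simp: L2_def)
  have [measurable]: "{a<..} \<in> sets lebesgue" for a :: real by simp
  have [measurable]: "(\<lambda>x. x) \<in> borel_measurable lebesgue" by (auto intro: measurable_completion)
  have cK: "continuous_on UNIV K" using DERIV_isCont[OF DK] by (auto intro: continuous_at_imp_continuous_on)
  have cH': "continuous_on UNIV H" using cH by (auto intro: continuous_at_imp_continuous_on)
  have cphi: "continuous_on UNIV (\<phi> n)" "continuous_on UNIV (\<phi>' n)" for n
    unfolding \<phi>_def \<phi>'_def
    by (intro continuous_intros continuous_on_compose2[OF cK] continuous_on_compose2[OF cH'] subset_UNIV)+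
  have mphi [measurable]: "\<phi> n \<in> borel_measurable lebesgue" "\<phi>' n \<in> borel_measurable lebesgue" for n
    using borel_measurable_continuous_onI[OF cphi(1)] borel_measurable_continuous_onI[OF cphi(2)]
    by (auto intro!: measurable_completion)
  have int: "integrable lebesgue (\<lambda>x. indicator {y..y+2} x * f x)" "integrable lebesgue (\<lambda>x. indicator {y..y+2} x * v x)"
    using L2_set_integrable f v by auto
  have limH: "(\<lambda>n. H (real (Suc n) * (x - c))) \<longlonglongrightarrow> indicator {c<..} x" for x c
  proof (cases "x > c")
    case True
    have "\<forall>\<^sub>F n in sequentially. real n * (x - c) \<ge> 1"
      using True by real_asymp
    then have "\<forall>\<^sub>F n in sequentially. real (Suc n) * (x - c) \<ge> 1"
      by (rule eventually_compose_filterlim[OF _ filterlim_Suc])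
    then have "\<forall>\<^sub>F n in sequentially. H (real (Suc n) * (x - c)) = 1" by eventually_elim (rule H1)
    then show ?thesis using True by (simp add: tendsto_eventually)
  next
    case False
    then have "real (Suc n) * (x - c) \<le> 0" for n by (simp only: mult_le_0_iff) simp
    then have "H (real (Suc n) * (x - c)) = 0" for n by (rule H0)
    then show ?thesis using False by (simp add: indicator_def)
  qed
  have limK: "(\<lambda>n. K (real (Suc n) * (x - c)) / real (Suc n)) \<longlonglongrightarrow> max 0 (x - c)" for x c
  proof (cases "x > c")
    case True
    have "\<forall>\<^sub>F n in sequentially. real n * (x - c) \<ge> 1"
      using True by real_asymp
    then have "\<forall>\<^sub>F n in sequentially. real (Suc n) * (x - c) \<ge> 1"
      by (rule eventually_compose_filterlim[OF _ filterlim_Suc])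
    then have "\<forall>\<^sub>F n in sequentially. (x - c) - c0 / real (Suc n) = K (real (Suc n) * (x - c)) / real (Suc n)" 
      by eventually_elim (simp add: K1' field_simps)
    moreover have "(\<lambda>n. (x - c) - c0 / real (Suc n)) \<longlonglongrightarrow> (x - c)" by real_asymp
    ultimately show ?thesis using True Lim_transform_eventually by fastforce
  next
    case False
    then have "real (Suc n) * (x - c) \<le> 0" for n by (simp only: mult_le_0_iff) simp
    then have "K (real (Suc n) * (x - c)) = 0" for n by (rule K0)
    then show ?thesis using False by simp
  qed
  have "(\<lambda>n. LINT x|lebesgue. f x * \<phi>' (Suc n) x) \<longlonglongrightarrow>
    (LINT x|lebesgue. f x * ((1 - d) * indicator {y<..} x - indicator {y+d<..} x + d * indicator {y+1<..} x))"
  proof (rule integral_dominated_convergence[where w = "\<lambda>x. 3 * \<bar>indicator {y..y+2} x * f x\<bar>"])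
    show "integrable lebesgue (\<lambda>x. 3 * \<bar>indicator {y..y+2} x * f x\<bar>)" using int by auto
    show "AE x in lebesgue. (\<lambda>n. f x * \<phi>' (Suc n) x) \<longlonglongrightarrow>
      f x * ((1 - d) * indicator {y<..} x - indicator {y+d<..} x + d * indicator {y+1<..} x)"
      unfolding \<phi>'_def by (intro AE_I2 tendsto_intros limH)
    show "AE x in lebesgue. norm (f x * \<phi>' (Suc n) x) \<le> 3 * \<bar>indicator {y..y+2} x * f x\<bar>" for n
    proof (rule AE_I2)
      fix x
      show "norm (f x * \<phi>' (Suc n) x) \<le> 3 * \<bar>indicator {y..y+2} x * f x\<bar>"
      proof (cases "x \<in> {y..y+2}")
        case True
        have "0 \<le> (1-d) * H (real (Suc n) * (x - y))" "(1-d) * H (real (Suc n) * (x - y)) \<le> 1"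
          "0 \<le> d * H (real (Suc n) * (x - (y+1)))" "d * H (real (Suc n) * (x - (y+1))) \<le> 1"
          using Hb d by (auto intro!: mult_nonneg_nonneg mult_le_one)
        then have "\<bar>\<phi>' (Suc n) x\<bar> \<le> 3"
          unfolding \<phi>'_def using Hb[of "real (Suc n) * (x - (y+d))"] by linarith
        then show ?thesis using True by (simp add: abs_mult mult_left_mono mult.commute)
      qed (simp add: supp)
    qed
  qed (measurable)
  moreover have "(\<lambda>n. LINT x|lebesgue. v x * \<phi> (Suc n) x) \<longlonglongrightarrow>
    (LINT x|lebesgue. v x * ((1 - d) * max 0 (x - y) - max 0 (x - (y+d)) + d * max 0 (x - (y+1))))"
  proof (rule integral_dominated_convergence[where w = "\<lambda>x. 6 * \<bar>indicator {y..y+2} x * v x\<bar>"])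
    show "integrable lebesgue (\<lambda>x. 6 * \<bar>indicator {y..y+2} x * v x\<bar>)" using int by auto
    have \<phi>eq: "\<phi> (Suc n) x = (1-d) * (K (real (Suc n) * (x - y)) / real (Suc n)) - K (real (Suc n) * (x - (y+d))) / real (Suc n)
         + d * (K (real (Suc n) * (x - (y+1))) / real (Suc n))" for n x
      unfolding \<phi>_def by simp
    show "AE x in lebesgue. (\<lambda>n. v x * \<phi> (Suc n) x) \<longlonglongrightarrow>
      v x * ((1 - d) * max 0 (x - y) - max 0 (x - (y+d)) + d * max 0 (x - (y+1)))"
      unfolding \<phi>eq by (intro AE_I2 tendsto_intros limK)
    show "AE x in lebesgue. norm (v x * \<phi> (Suc n) x) \<le> 6 * \<bar>indicator {y..y+2} x * v x\<bar>" for n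
    proof (rule AE_I2)
      fix x
      show "norm (v x * \<phi> (Suc n) x) \<le> 6 * \<bar>indicator {y..y+2} x * v x\<bar>"
      proof (cases "x \<in> {y..y+2}")
        case True
        have *: "0 \<le> K (real (Suc n) * (x - c)) / real (Suc n)" "K (real (Suc n) * (x - c)) / real (Suc n) \<le> 2"
          if "c \<ge> y" for c
        proof -
          show "0 \<le> K (real (Suc n) * (x - c)) / real (Suc n)" using Kb by simp
          have "K (real (Suc n) * (x - c)) \<le> max 0 (real (Suc n) * (x - c))" by (rule Kb)
          also have "\<dots> \<le> real (Suc n) * 2" using True that by (intro max.boundedI mult_left_mono) auto
          finally show "K (real (Suc n) * (x - c)) / real (Suc n) \<le> 2"
            by (simp add: field_simps)
        qed
        have "0 \<le> (1-d) * (K (real (Suc n) * (x - y)) / real (Suc n))" 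
          "(1-d) * (K (real (Suc n) * (x - y)) / real (Suc n)) \<le> 1 * 2"
          "0 \<le> d * (K (real (Suc n) * (x - (y+1))) / real (Suc n))" 
          "d * (K (real (Suc n) * (x - (y+1))) / real (Suc n)) \<le> 1 * 2"
          using d *[of y] *[of "y+1"] by (intro mult_nonneg_nonneg mult_mono; simp)+
        then have "\<bar>\<phi> (Suc n) x\<bar> \<le> 6"
          unfolding \<phi>eq using *[of "y+d"] d by linarith
        then show ?thesis using True by (simp add: abs_mult mult_left_mono mult.commute)
      qed (simp add: supp)
    qed
  qed (measurable)
  then have "(\<lambda>n. LINT x|lebesgue. f x * \<phi>' (Suc n) x) \<longlonglongrightarrow>
     - (LINT x|lebesgue. v x * ((1 - d) * max 0 (x - y) - max 0 (x - (y+d)) + d * max 0 (x - (y+1))))"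
    unfolding eq by (rule tendsto_minus)
  ultimately show ?thesis by (rule LIMSEQ_unique)
qed


text \<open>The tested function has slope \<open>1 - d\<close> on the short interval and
  \<open>- d\<close> from there to \<open>y + 1\<close>. Its derivative plus \<open>d\<close> times
  the indicator of the unit interval is thus the indicator of \<open>{y..y+d}\<close> almost
  everywhere, and its height is at most \<open>d\<close>. Both contributions carry a factor
  \<open>d\<close>, which pays for the later division by the length of the interval.\<close>

lemma weak_deriv_interval_bound:
  assumes f: "f \<in> L2" and v: "v \<in> L2" and w: "weak_deriv f v" and d: "0 < d" "d \<le> 1"
  shows "\<bar>LINT x|lebesgue. indicator {y..y+d} x * f x\<bar>
     \<le> d * (1 + ((LINT x|lebesgue. (f x)\<^sup>2) + (LINT x|lebesgue. (v x)\<^sup>2)) / 2)"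
proof -
  let ?D = "\<lambda>x. (1 - d) * indicator {y<..} x - indicator {y+d<..} x + d * indicator {y+1<..} x"
  let ?\<Phi> = "\<lambda>x. (1 - d) * max 0 (x - y) - max 0 (x - (y+d)) + d * max 0 (x - (y+1))"
  let ?I = "indicator {y..y+1} :: real \<Rightarrow> real"
  have [measurable]: "f \<in> borel_measurable lebesgue" "v \<in> borel_measurable lebesgue"
    using f v by (auto simp: L2_def)
  have \<Phi>: "0 \<le> ?\<Phi> x \<and> ?\<Phi> x \<le> d * ?I x" for x
  proof -
    consider "x < y" | "y \<le> x" "x < y + d" | "y + d \<le> x" "x \<le> y + 1" | "x > y + 1" by linarith
    then show ?thesis
    proof cases
      case 2
      have "(1 - d) * (x - y) \<le> 1 * d" using 2 d by (intro mult_mono) auto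
      then show ?thesis using 2 d by (auto simp: max_def)
    next
      case 3
      have "?\<Phi> x = d * (y + 1 - x)" using 3 d by (auto simp: max_def algebra_simps)
      moreover have "d * (y + 1 - x) \<le> d * 1" using 3 d by (intro mult_left_mono) auto
      ultimately show ?thesis using 3 d by auto
    next
      case 4
      have "?\<Phi> x = 0" using 4 d by (auto simp: max_def algebra_simps)
      then show ?thesis using 4 by simp
    qed (use d in \<open>auto simp: max_def\<close>)
  qed
  have iI: "integrable lebesgue (\<lambda>x. ?I x * g x)" if "g \<in> L2" for g using L2_set_integrable that by auto
  have sq: "\<bar>z\<bar> \<le> 1/2 + z\<^sup>2/2" for z :: real
    using zero_le_power2[of "\<bar>z\<bar> - 1"] by (simp add: power2_eq_square algebra_simps)
  have I1: "(LINT x|lebesgue. ?I x) = 1" "integrable lebesgue ?I" by auto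
  have bd: "(LINT x|lebesgue. ?I x * \<bar>g x\<bar>) \<le> 1/2 + (LINT x|lebesgue. (g x)\<^sup>2) / 2" 
    and ig: "integrable lebesgue (\<lambda>x. ?I x * \<bar>g x\<bar>)" if g: "g \<in> L2" for g
  proof -
    show ig: "integrable lebesgue (\<lambda>x. ?I x * \<bar>g x\<bar>)"
      using integrable_abs[OF iI[OF g]] by (simp add: abs_mult)
    have "(LINT x|lebesgue. ?I x * \<bar>g x\<bar>) \<le> (LINT x|lebesgue. ?I x / 2 + (g x)\<^sup>2 / 2)"
    proof (rule integral_mono)
      show "integrable lebesgue (\<lambda>x. ?I x / 2 + (g x)\<^sup>2 / 2)"
        using g I1 by (intro Bochner_Integration.integrable_add integrable_divide) (auto simp: L2_def)
      show "?I x * \<bar>g x\<bar> \<le> ?I x / 2 + (g x)\<^sup>2 / 2" for x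
        using sq[of "g x"] by (auto simp: indicator_def)
    qed (use ig in auto)
    also have "\<dots> = 1/2 + (LINT x|lebesgue. (g x)\<^sup>2) / 2"
      using g I1 by (subst Bochner_Integration.integral_add) (auto simp: L2_def)
    finally show "(LINT x|lebesgue. ?I x * \<bar>g x\<bar>) \<le> 1/2 + (LINT x|lebesgue. (g x)\<^sup>2) / 2" .
  qed
  \<comment> \<open>The half lines in \<open>?D\<close> are open, so the pointwise identity below
    can fail at \<open>x = y\<close>, and only there.\<close>
  have ne: "AE x in lebesgue. x \<noteq> y" using AE_completion[OF AE_lborel_singleton] .
  have iD: "integrable lebesgue (\<lambda>x. f x * ?D x)"
  proof (rule Bochner_Integration.integrable_bound[of _ "\<lambda>x. 3 * (?I x * \<bar>f x\<bar>)"])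
    show "AE x in lebesgue. norm (f x * ?D x) \<le> norm (3 * (?I x * \<bar>f x\<bar>))"
    proof (rule AE_I2)
      fix x
      have "\<bar>?D x\<bar> \<le> 3 * ?I x" using d by (auto simp: indicator_def)
      from mult_left_mono[OF this, of "\<bar>f x\<bar>"] 
      show "norm (f x * ?D x) \<le> norm (3 * (?I x * \<bar>f x\<bar>))" by (simp add: abs_mult mult_ac)
    qed
    have [measurable]: "{a<..} \<in> sets lebesgue" for a :: real by simp
    show "(\<lambda>x. f x * ?D x) \<in> borel_measurable lebesgue" by measurable
  qed (use ig[OF f] in auto)
  have "(LINT x|lebesgue. indicator {y..y+d} x * f x) = (LINT x|lebesgue. f x * ?D x + d * (?I x * f x))"
  proof (rule integral_cong_AE)
    have [measurable]: "{a<..} \<in> sets lebesgue" "{a..b} \<in> sets lebesgue" for a b :: real by simp_all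
    show "(\<lambda>x. indicator {y..y+d} x * f x) \<in> borel_measurable lebesgue"
      "(\<lambda>x. f x * ?D x + d * (?I x * f x)) \<in> borel_measurable lebesgue" by measurable
    show "AE x in lebesgue. indicator {y..y+d} x * f x = f x * ?D x + d * (?I x * f x)"
      using ne by eventually_elim (use d in \<open>auto simp: indicator_def algebra_simps\<close>)
  qed
  also have "\<dots> = (LINT x|lebesgue. f x * ?D x) + d * (LINT x|lebesgue. ?I x * f x)"
    using iD iI[OF f] by (subst Bochner_Integration.integral_add) auto
  also have "\<dots> = - (LINT x|lebesgue. v x * ?\<Phi> x) + d * (LINT x|lebesgue. ?I x * f x)"
    using weak_deriv_hat[OF assms] by simp
  finally have eq: "(LINT x|lebesgue. indicator {y..y+d} x * f x)
    = - (LINT x|lebesgue. v x * ?\<Phi> x) + d * (LINT x|lebesgue. ?I x * f x)" .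
  have "\<bar>LINT x|lebesgue. indicator {y..y+d} x * f x\<bar> \<le> (LINT x|lebesgue. d * (?I x * \<bar>v x\<bar>)) + d * (LINT x|lebesgue. ?I x * \<bar>f x\<bar>)"
  proof -
    have "\<bar>LINT x|lebesgue. v x * ?\<Phi> x\<bar> \<le> (LINT x|lebesgue. \<bar>v x * ?\<Phi> x\<bar>)"
      by (rule integral_abs_bound)
    also have "\<dots> \<le> (LINT x|lebesgue. d * (?I x * \<bar>v x\<bar>))"
    proof (rule integral_mono')
      show "\<bar>v x * ?\<Phi> x\<bar> \<le> d * (?I x * \<bar>v x\<bar>)" for x
        using \<Phi>[of x] mult_left_mono[of "?\<Phi> x" "d * ?I x" "\<bar>v x\<bar>"] by (simp add: abs_mult mult_ac)
    qed (use ig[OF v] d in \<open>auto simp: indicator_def\<close>)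
    finally have 1: "\<bar>LINT x|lebesgue. v x * ?\<Phi> x\<bar> \<le> (LINT x|lebesgue. d * (?I x * \<bar>v x\<bar>))" .
    have "\<bar>LINT x|lebesgue. ?I x * f x\<bar> \<le> (LINT x|lebesgue. ?I x * \<bar>f x\<bar>)"
      using integral_abs_bound[of lebesgue "\<lambda>x. ?I x * f x"] by (simp add: abs_mult)
    then have "\<bar>d * (LINT x|lebesgue. ?I x * f x)\<bar> \<le> d * (LINT x|lebesgue. ?I x * \<bar>f x\<bar>)"
      using d by (simp add: abs_mult)
    then show ?thesis unfolding eq using 1 by linarith
  qed
  also have "\<dots> = d * ((LINT x|lebesgue. ?I x * \<bar>v x\<bar>) + (LINT x|lebesgue. ?I x * \<bar>f x\<bar>))"
    by (simp add: distrib_left)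
  also have "\<dots> \<le> d * (1 + ((LINT x|lebesgue. (f x)\<^sup>2) + (LINT x|lebesgue. (v x)\<^sup>2)) / 2)"
  proof (rule mult_left_mono)
    show "(LINT x|lebesgue. ?I x * \<bar>v x\<bar>) + (LINT x|lebesgue. ?I x * \<bar>f x\<bar>)
      \<le> 1 + ((LINT x|lebesgue. (f x)\<^sup>2) + (LINT x|lebesgue. (v x)\<^sup>2)) / 2"
      using bd[OF f] bd[OF v] by argo
  qed (use d in simp)
  finally show ?thesis .
qed
text \<open>Dividing the interval bound by the length of the interval and applying Lebesgue's
  differentiation theorem gives the embedding of \<open>H\<^sup>1\<close> into \<open>L\<^sup>\<infinity>\<close>; the bound need not be homogeneous
  for local boundedness.\<close>

lemma sobolev_AE:
  assumes f: "f \<in> L2" and v: "v \<in> L2" and w: "weak_deriv f v"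
  shows "AE x in lebesgue. \<bar>f x\<bar> \<le> 1 + ((LINT x|lebesgue. (f x)\<^sup>2) + (LINT x|lebesgue. (v x)\<^sup>2)) / 2"
    (is "AE x in lebesgue. _ \<le> ?M")
proof -
  have ai: "f absolutely_integrable_on {a..b}" for a b
    using L2_set_integrable[OF f] by (simp add: set_integrable_def)
  then have io: "f integrable_on cbox a b" for a b
    using set_lebesgue_integral_eq_integral(1) by auto
  have le: "integral {a..b} f = (LINT x|lebesgue. indicator {a..b} x * f x)" for a b
    using set_lebesgue_integral_eq_integral(2)[OF ai] by (simp add: set_lebesgue_integral_def)
  obtain N where N: "negligible N"
    and lim: "\<And>x e. x \<notin> N \<Longrightarrow> 0 < e \<Longrightarrow> \<exists>d>0. \<forall>h. 0 < h \<and> h < d \<longrightarrow>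
       norm (integral (cbox x (x + h *\<^sub>R One)) f /\<^sub>R h ^ DIM(real) - f x) < e"
    using integrable_ccontinuous_explicit[OF io] by metis
  have "\<bar>f x\<bar> \<le> ?M" if xN: "x \<notin> N" for x
  proof (rule ccontr)
    assume "\<not> \<bar>f x\<bar> \<le> ?M"
    then obtain d where "d > 0" and d: "\<forall>h. 0 < h \<and> h < d \<longrightarrow>
       norm (integral (cbox x (x + h *\<^sub>R One)) f /\<^sub>R h ^ DIM(real) - f x) < \<bar>f x\<bar> - ?M"
      using lim[OF xN, of "\<bar>f x\<bar> - ?M"] by auto
    define h where "h = min (d/2) 1"
    have h: "0 < h" "h < d" "h \<le> 1" using \<open>d > 0\<close> by (auto simp: h_def)
    have "\<bar>integral {x..x+h} f / h - f x\<bar> < \<bar>f x\<bar> - ?M"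
    proof -
      have "integral (cbox x (x + h *\<^sub>R One)) f /\<^sub>R h ^ DIM(real) = integral {x..x+h} f / h"
        by (simp add: divide_real_def)
      then show ?thesis using d h(1,2) unfolding real_norm_def by metis
    qed
    moreover have "\<bar>integral {x..x+h} f\<bar> \<le> h * ?M"
      unfolding le by (rule weak_deriv_interval_bound[OF f v w h(1,3)])
    then have "\<bar>integral {x..x+h} f / h\<bar> \<le> ?M" using h by (simp add: field_simps)
    ultimately show False by linarith
  qed
  then show ?thesis
    using N by (intro AE_I'[of N]) (auto simp: negligible_iff_null_sets)
qed

section \<open>Local boundedness of curves in \<open>X\<close>\<close>

lemma smooth_test_cont:
  assumes "smooth_test \<phi>"
  shows "continuous_on UNIV \<phi>" "continuous_on UNIV (deriv \<phi>)"
proof -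
  have "\<phi> differentiable (at x)" "deriv \<phi> differentiable (at x)" for x
    using assms[unfolded smooth_test_def, THEN conjunct1, rule_format, of 0 x]
      assms[unfolded smooth_test_def, THEN conjunct1, rule_format, of 1 x] by auto
  then show "continuous_on UNIV \<phi>" "continuous_on UNIV (deriv \<phi>)"
    by (auto intro!: continuous_at_imp_continuous_on differentiable_imp_continuous_within)
qed

lemma smooth_test_deriv_support:
  assumes "smooth_test \<phi>" "deriv \<phi> x \<noteq> 0"
  shows "x \<in> closure {x. \<phi> x \<noteq> 0}"
proof (rule ccontr)
  let ?S = "closure {x. \<phi> x \<noteq> 0}"
  assume "x \<notin> ?S"
  then have "\<forall>\<^sub>F y in nhds x. y \<in> - ?S" by (intro eventually_nhds_in_open) auto
  then have "\<forall>\<^sub>F y in nhds x. \<phi> y = (\<lambda>_. 0) y"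
  proof eventually_elim
    case (elim y)
    then have "y \<notin> {x. \<phi> x \<noteq> 0}" using closure_subset[of "{x. \<phi> x \<noteq> 0}"] by (meson ComplD subsetD)
    then show ?case by simp
  qed
  then have "deriv \<phi> x = deriv (\<lambda>_. 0) x" by (intro deriv_cong_ev refl)
  with assms show False by simp
qed

lemma L2_mult_continuous_integrable:
  fixes \<psi> :: "real \<Rightarrow> real"
  assumes "f \<in> L2" "continuous_on UNIV \<psi>" "compact K"
  shows "integrable lebesgue (\<lambda>x. indicator K x * (f x * \<psi> x))"
proof -
  have "bounded (\<psi> ` K)" using assms by (meson compact_continuous_image compact_imp_bounded continuous_on_subset subset_UNIV)
  then obtain B where B: "\<And>x. x \<in> K \<Longrightarrow> \<bar>\<psi> x\<bar> \<le> B" by (auto simp: bounded_iff)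
  have [measurable]: "f \<in> borel_measurable lebesgue" "\<psi> \<in> borel_measurable lebesgue"
    using assms borel_measurable_continuous_onI by (auto simp: L2_def intro!: measurable_completion)
  have K: "K \<in> lmeasurable" using assms by (simp add: lmeasurable_compact)
  then have [measurable]: "K \<in> sets lebesgue" by (rule fmeasurableD)
  from L2_set_integrable[OF assms(1) K]
  show ?thesis
  proof (rule Bochner_Integration.integrable_bound[OF integrable_mult_right[of B]])
    show "AE x in lebesgue. norm (indicator K x * (f x * \<psi> x)) \<le> norm (B * (indicator K x * f x))"
    proof (rule AE_I2)
      fix x show "norm (indicator K x * (f x * \<psi> x)) \<le> norm (B * (indicator K x * f x))"
      proof (cases "x \<in> K")
        case True
        then have "\<bar>\<psi> x\<bar> \<le> \<bar>B\<bar>" using B[of x] by linarith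
        then have "\<bar>f x\<bar> * \<bar>\<psi> x\<bar> \<le> \<bar>f x\<bar> * \<bar>B\<bar>" by (rule mult_left_mono) simp
        then show ?thesis using True by (simp add: abs_mult mult.commute)
      qed simp
    qed
  qed measurable
qed

lemma L2_mult_integrable:
  fixes \<psi> :: "real \<Rightarrow> real"
  assumes "f \<in> L2" "continuous_on UNIV \<psi>" "compact K" "\<And>x. x \<notin> K \<Longrightarrow> \<psi> x = 0"
  shows "integrable lebesgue (\<lambda>x. f x * \<psi> x)"
proof -
  have "(\<lambda>x. f x * \<psi> x) = (\<lambda>x. indicator K x * (f x * \<psi> x))"
    using assms(4) by (auto simp: fun_eq_iff indicator_def)
  then show ?thesis using L2_mult_continuous_integrable[OF assms(1-3)] by simp
qed

text \<open>The integral of a non-integrable function is \<open>0\<close> by convention, so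
  \<open>weak_deriv\<close> is compatible with differences only once these products are known to be
  integrable.\<close>

lemma smooth_test_integrable:
  assumes "f \<in> L2" "smooth_test \<phi>"
  shows "integrable lebesgue (\<lambda>x. f x * \<phi> x)" "integrable lebesgue (\<lambda>x. f x * deriv \<phi> x)"
  using assms smooth_test_cont[OF assms(2)] smooth_test_deriv_support[OF assms(2)] closure_subset[of "{x. \<phi> x \<noteq> 0}"]
  by (auto intro!: L2_mult_integrable[where K = "closure {x. \<phi> x \<noteq> 0}"] simp: smooth_test_def)

lemma L2_diff:
  assumes "f \<in> L2" "g \<in> L2" shows "(\<lambda>x. f x - g x) \<in> L2"
proof -
  have [measurable]: "f \<in> borel_measurable lebesgue" "g \<in> borel_measurable lebesgue"
    using assms by (auto simp: L2_def)
  have "integrable lebesgue (\<lambda>x. 2 * (f x)\<^sup>2 + 2 * (g x)\<^sup>2)"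
    using assms by (auto simp: L2_def)
  then have "integrable lebesgue (\<lambda>x. (f x - g x)\<^sup>2)"
  proof (rule Bochner_Integration.integrable_bound)
    have "(f x - g x)\<^sup>2 \<le> 2 * (f x)\<^sup>2 + 2 * (g x)\<^sup>2" for x
      using zero_le_power2[of "f x + g x"] by (simp add: power2_eq_square algebra_simps)
    then show "AE x in lebesgue. norm ((f x - g x)\<^sup>2) \<le> norm (2 * (f x)\<^sup>2 + 2 * (g x)\<^sup>2)"
      by (intro AE_I2) simp
  qed measurable
  then show ?thesis by (simp add: L2_def)
qed

lemma H1_diff:
  assumes "f \<in> H1" "g \<in> H1" shows "(\<lambda>x. f x - g x) \<in> H1"
proof -
  obtain v w where f: "f \<in> L2" "v \<in> L2" "weak_deriv f v" and g: "g \<in> L2" "w \<in> L2" "weak_deriv g w"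
    using assms by (auto simp: H1_def)
  have "weak_deriv (\<lambda>x. f x - g x) (\<lambda>x. v x - w x)"
    unfolding weak_deriv_def
  proof (intro allI impI)
    fix \<phi> assume \<phi>: "smooth_test \<phi>"
    show "(LINT x|lebesgue. (f x - g x) * deriv \<phi> x) = - (LINT x|lebesgue. (v x - w x) * \<phi> x)"
      using f(3) g(3) \<phi> smooth_test_integrable[OF f(1) \<phi>] smooth_test_integrable[OF f(2) \<phi>]
        smooth_test_integrable[OF g(1) \<phi>] smooth_test_integrable[OF g(2) \<phi>]
      by (simp add: weak_deriv_def left_diff_distrib)
  qed
  then show ?thesis using f g L2_diff by (auto simp: H1_def)
qed

lemma H1_norm_bound_AE:
  assumes "f \<in> H1"
  shows "AE x in lebesgue. \<bar>f x\<bar> \<le> 1 + (H1_norm f)\<^sup>2 / 2"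
proof -
  define v where "v = (SOME v. v \<in> L2 \<and> weak_deriv f v)"
  have v: "v \<in> L2 \<and> weak_deriv f v"
  proof -
    obtain w where "w \<in> L2 \<and> weak_deriv f w" using assms by (auto simp: H1_def)
    then show ?thesis unfolding v_def by (rule someI[of "\<lambda>v. v \<in> L2 \<and> weak_deriv f v"])
  qed
  have "(L2_norm h)\<^sup>2 = (LINT x|lebesgue. (h x)\<^sup>2)" for h
    by (simp add: L2_norm_def)
  then have "(H1_norm f)\<^sup>2 = (LINT x|lebesgue. (f x)\<^sup>2) + (LINT x|lebesgue. (v x)\<^sup>2)"
    unfolding H1_norm_def v_def[symmetric] by (simp add: add_nonneg_nonneg)
  then show ?thesis
    using sobolev_AE[of f v] v assms by (auto simp: H1_def)
qed

text \<open>By continuity in \<open>H1_norm\<close>, \<open>u s\<close> stays within distance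
  \<open>1\<close> of \<open>u t\<close> for \<open>s\<close> near \<open>t\<close>, so the
  embedding bounds it locally uniformly in time; a finite subcover of \<open>{0..R}\<close> does the
  rest. The exceptional null set still depends on the time.\<close>

lemma X_bounded_AE:
  assumes u: "u \<in> X \<infinity>"
  shows "\<exists>M\<ge>0. \<forall>t\<in>{0..R}. AE x in lebesgue. \<bar>u t x\<bar> \<le> M"
proof -
  have H: "u t \<in> H1" "((\<lambda>s. H1_norm (\<lambda>x. u s x - u t x)) \<longlongrightarrow> 0) (at t within {0..})" if "0 \<le> t" for t
    using u that by (auto simp: X_def)
  have "\<exists>d M. 0 < d \<and> 0 \<le> M \<and> (\<forall>s\<ge>0. dist s t < d \<longrightarrow> (AE x in lebesgue. \<bar>u s x\<bar> \<le> M))" if t: "0 \<le> t" for t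
  proof -
    have "\<forall>\<^sub>F s in at t within {0..}. H1_norm (\<lambda>x. u s x - u t x) < 1"
      using order_tendstoD(2)[OF H(2)[OF t], of 1] by simp
    then obtain d where d: "d > 0" 
      and *: "\<And>s. s \<ge> 0 \<Longrightarrow> s \<noteq> t \<Longrightarrow> dist s t < d \<Longrightarrow> H1_norm (\<lambda>x. u s x - u t x) < 1"
      by (auto simp: eventually_at)
    \<comment> \<open>The summand \<open>3 / 2\<close> is the embedding bound
      \<open>1 + 1 / 2\<close> for a difference whose \<open>H1_norm\<close> is at most
      \<open>1\<close>.\<close>
    let ?M = "1 + (H1_norm (u t))\<^sup>2 / 2 + 3 / 2"
    have "AE x in lebesgue. \<bar>u s x\<bar> \<le> ?M" if s: "s \<ge> 0" "dist s t < d" for s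
    proof (cases "s = t")
      case True
      then show ?thesis using H1_norm_bound_AE[OF H(1)[OF t]] by (auto elim!: eventually_mono)
    next
      case False
      have "0 \<le> H1_norm (\<lambda>x. u s x - u t x)" by (simp add: H1_norm_def L2_norm_def)
      then have "(H1_norm (\<lambda>x. u s x - u t x))\<^sup>2 \<le> 1"
        using *[OF s(1) False s(2)] by (simp add: power_le_one)
      then have "AE x in lebesgue. \<bar>u s x - u t x\<bar> \<le> 3/2"
        using H1_norm_bound_AE[OF H1_diff[OF H(1)[OF s(1)] H(1)[OF t]]]
        by (auto elim!: eventually_mono)
      with H1_norm_bound_AE[OF H(1)[OF t]] show ?thesis
        by eventually_elim linarith
    qed
    then show ?thesis using d by (intro exI[of _ d] exI[of _ ?M]) auto
  qed
  then obtain d M where dM: "\<And>t. 0 \<le> t \<Longrightarrow> 0 < d t" "\<And>t. 0 \<le> t \<Longrightarrow> 0 \<le> M t"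
    "\<And>t s. 0 \<le> t \<Longrightarrow> s \<ge> 0 \<Longrightarrow> dist s t < d t \<Longrightarrow> (AE x in lebesgue. \<bar>u s x\<bar> \<le> M t)"
    by metis
  obtain C where C: "C \<subseteq> {0..R}" "finite C" "{0..R} \<subseteq> (\<Union>t\<in>C. ball t (d t))"
    by (rule compactE_image[of "{0..R}" "{0..R}" "\<lambda>t. ball t (d t)"])
      (use dM(1) in \<open>auto intro!: bexI\<close>)
  define B where "B = (\<Sum>t\<in>C. M t)"
  have Mnn: "0 \<le> M t" if "t \<in> C" for t using C dM(2) that by auto
  have "AE x in lebesgue. \<bar>u s x\<bar> \<le> B" if sR: "s \<in> {0..R}" for s
  proof -
    obtain t where "t \<in> C" "s \<in> ball t (d t)" using C(3) sR by blast
    then have t: "t \<in> C" "dist s t < d t" by (auto simp: dist_commute)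
    then have "AE x in lebesgue. \<bar>u s x\<bar> \<le> M t" using dM(3)[of t s] C sR by auto
    moreover have "M t \<le> B" unfolding B_def by (rule member_le_sum) (use t C Mnn in auto)
    ultimately show ?thesis by (auto elim!: eventually_mono)
  qed
  moreover have "0 \<le> B" unfolding B_def by (rule sum_nonneg) (rule Mnn)
  ultimately show ?thesis by blast
qed

text \<open>Lebesgue measure on the plane is the completion of the product of \<open>lborel\<close>
  with itself, so Tonelli's theorem is applied to the Borel part \<open>S\<close> of
  \<open>E\<close>; the remaining part lies in a null set by the definition of the
  completion.\<close>

lemma null_sets_lebesgue_sections:
  fixes E :: "(real \<times> real) set"
  assumes "E \<in> sets lebesgue" "\<And>t. {x. (t, x) \<in> E} \<in> null_sets lebesgue"
  shows "E \<in> null_sets lebesgue"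
proof -
  obtain S N N' where E: "E = S \<union> N" "N \<subseteq> N'" "N' \<in> null_sets lborel" "S \<in> sets lborel"
    using assms(1) by (rule sets_completionE)
  have "emeasure lborel (Pair t -` S) = 0" for t
  proof -
    have "Pair t -` S \<subseteq> {x. (t, x) \<in> E}" using E by auto
    then have "Pair t -` S \<in> null_sets lebesgue"
      using assms(2) null_sets_completion_subset by blast
    moreover have "Pair t -` S \<in> sets lborel"
      using E(4) by (metis lborel_prod sets_Pair1)
    ultimately show ?thesis by (simp add: null_setsD1 null_sets_completion_iff)
  qed
  moreover have "emeasure (lborel \<Otimes>\<^sub>M lborel) S = (\<integral>\<^sup>+ t. emeasure lborel (Pair t -` S) \<partial>lborel)"
    by (rule lborel.emeasure_pair_measure_alt) (unfold lborel_prod, rule E(4))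
  ultimately have "emeasure lborel S = 0" by (simp only: lborel_prod) simp
  then have "S \<in> null_sets lebesgue" using E(4) null_sets_completionI by blast
  moreover have "N \<in> null_sets lebesgue"
    using E null_sets_completionI null_sets_completion_subset by blast
  ultimately show ?thesis unfolding E by (rule null_sets.Un)
qed

lemma slab_infty: "slab \<infinity> = {0..} \<times> UNIV"
  by (auto simp: slab_def)

text \<open>The null sets belonging to the individual times are uncountably many and cannot simply
  be united. The measurability clause of \<open>X\<close> makes the joint exceptional set
  measurable, and a measurable set with null sections is null.\<close>

lemma X_bounded_AE_joint:
  assumes u: "u \<in> X \<infinity>"
  shows "\<exists>M\<ge>0. AE z in lebesgue. fst z \<in> {0..R} \<longrightarrow> \<bar>u (fst z) (snd z)\<bar> \<le> M"
proof -
  obtain M where M: "M \<ge> 0" "\<And>t. t \<in> {0..R} \<Longrightarrow> AE x in lebesgue. \<bar>u t x\<bar> \<le> M"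
    using X_bounded_AE[OF u, of R] by auto
  have ms: "(\<lambda>z. indicator (slab \<infinity>) z * u (fst z) (snd z)) \<in> borel_measurable lebesgue"
    using u by (simp add: X_def set_borel_measurable_def case_prod_unfold)
  define E where "E = {z. fst z \<in> {0..R} \<and> \<bar>u (fst z) (snd z)\<bar> > M}"
  have Eeq: "E = ({0..R} \<times> UNIV) \<inter> {z \<in> space lebesgue. \<bar>indicator (slab \<infinity>) z * u (fst z) (snd z)\<bar> > M}"
    by (auto simp: E_def slab_infty)
  have "{0..R} \<times> (UNIV :: real set) \<in> sets lebesgue"
    by (simp add: closed_Times borel_closed)
  moreover have "{z \<in> space lebesgue. \<bar>indicator (slab \<infinity>) z * u (fst z) (snd z)\<bar> > M} \<in> sets lebesgue"
    using ms by measurable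
  ultimately have "E \<in> sets lebesgue" unfolding Eeq by blast
  then have "E \<in> null_sets lebesgue"
  proof (rule null_sets_lebesgue_sections)
    fix t
    show "{x. (t, x) \<in> E} \<in> null_sets lebesgue"
    proof (cases "t \<in> {0..R}")
      case True
      then have "{x. (t, x) \<in> E} = {x\<in>space lebesgue. \<not> \<bar>u t x\<bar> \<le> M}" by (auto simp: E_def)
      moreover have "(AE x in lebesgue. \<bar>u t x\<bar> \<le> M) " using M(2)[OF True] .
      moreover have "{x\<in>space lebesgue. \<not> \<bar>u t x\<bar> \<le> M} \<in> sets lebesgue"
      proof -
        have "u t \<in> borel_measurable lebesgue" using u True by (auto simp: X_def H1_def L2_def)
        then show ?thesis by measurable
      qed
      ultimately show ?thesis using AE_iff_null by metis
    next
      case False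
      then have "{x. (t, x) \<in> E} = {}" by (auto simp: E_def)
      then show ?thesis by simp
    qed
  qed
  then have "AE z in lebesgue. fst z \<in> {0..R} \<longrightarrow> \<bar>u (fst z) (snd z)\<bar> \<le> M"
    by (rule AE_I') (auto simp: E_def)
  then show ?thesis using M(1) by blast
qed

section \<open>Invariance of norms and blow-up under change of representative\<close>

lemma L2_norm_cong_AE:
  assumes "AE x in lebesgue. f x = g x" "f \<in> borel_measurable lebesgue" "g \<in> borel_measurable lebesgue"
  shows "L2_norm f = L2_norm g"
proof -
  have "(LINT x|lebesgue. (f x)\<^sup>2) = (LINT x|lebesgue. (g x)\<^sup>2)"
    using assms by (intro integral_cong_AE) (auto elim!: eventually_mono)
  then show ?thesis by (simp add: L2_norm_def)
qed

text \<open>\<open>H1_norm\<close> picks a weak derivative with \<open>SOME\<close>. Two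
  representatives satisfy the same predicate \<open>weak_deriv\<close>, so the very same function is
  picked for both.\<close>

lemma H1_norm_cong_AE:
  assumes eq: "AE x in lebesgue. f x = g x" and [measurable]: "f \<in> borel_measurable lebesgue" "g \<in> borel_measurable lebesgue"
  shows "H1_norm f = H1_norm g"
proof -
  have "(LINT x|lebesgue. f x * deriv \<phi> x) = (LINT x|lebesgue. g x * deriv \<phi> x)" if "smooth_test \<phi>" for \<phi>
  proof (rule integral_cong_AE)
    have [measurable]: "deriv \<phi> \<in> borel_measurable lebesgue"
      using smooth_test_cont[OF that] borel_measurable_continuous_onI by (auto intro!: measurable_completion)
    show "(\<lambda>x. f x * deriv \<phi> x) \<in> borel_measurable lebesgue" "(\<lambda>x. g x * deriv \<phi> x) \<in> borel_measurable lebesgue"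
      by measurable
    show "AE x in lebesgue. f x * deriv \<phi> x = g x * deriv \<phi> x" using eq by eventually_elim simp
  qed
  then have "weak_deriv f = weak_deriv g" by (auto simp: weak_deriv_def fun_eq_iff)
  then show ?thesis unfolding H1_norm_def using L2_norm_cong_AE[OF assms] by simp
qed

text \<open>Again the predicates under \<open>SOME\<close> coincide, hence the chosen functions are
  equal and not merely almost everywhere equal. As a derivative in time is a limit of quotients,
  \<open>u\<close> and \<open>v\<close> must agree at all times near \<open>t\<close>.\<close>

lemma L2_dt_cong_AE:
  fixes T :: real
  assumes eq: "\<And>s. 0 \<le> s \<Longrightarrow> s < T \<Longrightarrow> AE x in lebesgue. u s x = v s x"
    and m: "\<And>s. 0 \<le> s \<Longrightarrow> s < T \<Longrightarrow> u s \<in> borel_measurable lebesgue \<and> v s \<in> borel_measurable lebesgue"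
    and t: "0 \<le> t" "t < T"
  shows "L2_dt u t = L2_dt v t"
proof -
  have "has_L2_deriv u w t = has_L2_deriv v w t" for w
  proof (cases "w \<in> L2")
    case True
    then have [measurable]: "w \<in> borel_measurable lebesgue" by (simp add: L2_def)
    have ev: "\<forall>\<^sub>F s in at t within {0..}. L2_norm (\<lambda>x. (u s x - u t x) / (s - t) - w x)
        = L2_norm (\<lambda>x. (v s x - v t x) / (s - t) - w x)"
      unfolding eventually_at
    proof (intro exI[of _ "T - t"] conjI ballI impI)
      fix s assume "s \<in> {0..}" "s \<noteq> t \<and> dist s t < T - t"
      then have s: "0 \<le> s" "s < T" by (auto simp: dist_real_def)
      have [measurable]: "u s \<in> borel_measurable lebesgue" "v s \<in> borel_measurable lebesgue"
        "u t \<in> borel_measurable lebesgue" "v t \<in> borel_measurable lebesgue" using m s t by auto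
      show "L2_norm (\<lambda>x. (u s x - u t x) / (s - t) - w x) = L2_norm (\<lambda>x. (v s x - v t x) / (s - t) - w x)"
      proof (rule L2_norm_cong_AE)
        show "AE x in lebesgue. (u s x - u t x) / (s - t) - w x = (v s x - v t x) / (s - t) - w x"
          using eq[OF s] eq[OF t] by eventually_elim simp
      qed measurable
    qed (use t in auto)
    show ?thesis unfolding has_L2_deriv_def by (simp only: filterlim_cong[OF refl refl ev])
  qed (simp add: has_L2_deriv_def)
  then show ?thesis by (simp add: L2_dt_def)
qed

lemma norm_blowup_at_cong_AE:
  assumes u: "u \<in> X (ereal T)" and v: "v \<in> X (ereal T)" and T: "0 < T"
    and eq: "\<And>t. 0 \<le> t \<Longrightarrow> t < T \<Longrightarrow> AE x in lebesgue. u t x = v t x"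
    and nb: "norm_blowup_at T v"
  shows "norm_blowup_at T u"
proof -
  have m: "u s \<in> borel_measurable lebesgue \<and> v s \<in> borel_measurable lebesgue" if "0 \<le> s" "s < T" for s
    using u v that by (auto simp: X_def H1_def L2_def)
  have "\<forall>\<^sub>F t in at_left T. H1_L2_norm (u t) (L2_dt u t) = H1_L2_norm (v t) (L2_dt v t)"
    using eventually_at_left_real[OF T]
  proof eventually_elim
    case (elim t)
    then have t: "0 \<le> t" "t < T" by auto
    show ?case using H1_norm_cong_AE[OF eq[OF t]] m[OF t] L2_dt_cong_AE[OF eq m t]
      by (simp add: H1_L2_norm_def)
  qed
  then show ?thesis using nb unfolding norm_blowup_at_def by (simp add: filterlim_cong)
qed

section \<open>Classical derivatives and cutoffs\<close>

definition contS :: "(real \<Rightarrow> real \<Rightarrow> real) \<Rightarrow> bool" where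
  "contS f \<longleftrightarrow> continuous_on ({0..} \<times> UNIV) (\<lambda>z. f (fst z) (snd z))"

text \<open>Stated as a relation, the derivative can be computed by sum and product rules on
  explicit witnesses; \<open>Dt\<close> is recovered afterwards by uniqueness of the one-sided
  limit.\<close>

definition has_dt :: "(real \<Rightarrow> real \<Rightarrow> real) \<Rightarrow> (real \<Rightarrow> real \<Rightarrow> real) \<Rightarrow> bool" where
  "has_dt f f' \<longleftrightarrow> (\<forall>t\<ge>0. \<forall>x. ((\<lambda>s. f s x) has_real_derivative f' t x) (at t within {0..}))"

definition has_dx :: "(real \<Rightarrow> real \<Rightarrow> real) \<Rightarrow> (real \<Rightarrow> real \<Rightarrow> real) \<Rightarrow> bool" where
  "has_dx f f' \<longleftrightarrow> (\<forall>t\<ge>0. \<forall>x. (f t has_real_derivative f' t x) (at x))"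

lemma at_within_atLeast_neq_bot: "0 \<le> t \<Longrightarrow> at t within {0..} \<noteq> bot" for t :: real
  by (metis atLeast_iff islimpt_greaterThanLessThan1 trivial_limit_within
    islimpt_subset less_add_one subset_eq greaterThanLessThan_iff less_eq_real_def order.trans)

lemma has_dt_imp_Dt: "has_dt f f' \<Longrightarrow> 0 \<le> t \<Longrightarrow> Dt f t x = f' t x"
  unfolding has_dt_def Dt_def
  by (auto intro!: vector_derivative_within at_within_atLeast_neq_bot simp: has_real_derivative_iff_has_vector_derivative)

lemma has_dx_imp_Dx: "has_dx f f' \<Longrightarrow> 0 \<le> t \<Longrightarrow> Dx f t x = f' t x"
  unfolding has_dx_def Dx_def by (auto intro: DERIV_imp_deriv)

lemma has_dt_cong: "has_dt f f' \<Longrightarrow> (\<And>t x. 0 \<le> t \<Longrightarrow> g t x = f t x) \<Longrightarrow> (\<And>t x. 0 \<le> t \<Longrightarrow> g' t x = f' t x) \<Longrightarrow> has_dt g g'"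
  unfolding has_dt_def
proof (intro allI impI)
  fix t x :: real
  assume *: "\<forall>t\<ge>0. \<forall>x. ((\<lambda>s. f s x) has_real_derivative f' t x) (at t within {0..})"
    "\<And>t x. 0 \<le> t \<Longrightarrow> g t x = f t x" "\<And>t x. 0 \<le> t \<Longrightarrow> g' t x = f' t x" "0 \<le> t"
  from *(1,4) have "((\<lambda>s. f s x) has_real_derivative f' t x) (at t within {0..})" by blast
  then show "((\<lambda>s. g s x) has_real_derivative g' t x) (at t within {0..})"
    unfolding *(3)[OF *(4)]
    by (rule has_field_derivative_transform_within[OF _ zero_less_one]) (use * in auto)
qed

lemma has_dx_cong: "has_dx f f' \<Longrightarrow> (\<And>t x. 0 \<le> t \<Longrightarrow> g t x = f t x) \<Longrightarrow> (\<And>t x. 0 \<le> t \<Longrightarrow> g' t x = f' t x) \<Longrightarrow> has_dx g g'"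
proof -
  assume *: "has_dx f f'" "\<And>t x. 0 \<le> t \<Longrightarrow> g t x = f t x" "\<And>t x. 0 \<le> t \<Longrightarrow> g' t x = f' t x"
  then have "g t = f t" if "0 \<le> t" for t using that by auto
  with * show ?thesis by (auto simp: has_dx_def)
qed

lemma contS_cong: "contS f \<Longrightarrow> (\<And>t x. 0 \<le> t \<Longrightarrow> g t x = f t x) \<Longrightarrow> contS g"
  unfolding contS_def by (subst continuous_on_cong[OF refl, of _ _ "\<lambda>z. f (fst z) (snd z)"]) auto

lemma C1_on_slabI:
  assumes "has_dt f ft" "has_dx f fx" "contS f" "contS ft" "contS fx"
  shows "C1_on (slab \<infinity>) f"
proof -
  have "(\<lambda>s. f s x) differentiable (at t within {0..}) \<and> f t differentiable (at x)" if "0 \<le> t" for t x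
    using assms(1,2) that unfolding has_dt_def has_dx_def real_differentiable_def by blast
  moreover have "contS (Dt f)" "contS (Dx f)"
    using contS_cong[OF assms(4) has_dt_imp_Dt[OF assms(1)]] contS_cong[OF assms(5) has_dx_imp_Dx[OF assms(2)]] by auto
  ultimately show ?thesis
    using assms(3) by (auto simp: C1_on_def slab_infty contS_def case_prod_unfold)
qed

lemma C1_on_slabD:
  assumes "C1_on (slab \<infinity>) f"
  shows "has_dt f (Dt f)" "has_dx f (Dx f)" "contS f" "contS (Dt f)" "contS (Dx f)"
proof -
  have d: "(\<lambda>s. f s x) differentiable (at t within {0..})" "f t differentiable (at x)" if "0 \<le> t" for t x
    using assms that by (auto simp: C1_on_def slab_infty)
  show "has_dt f (Dt f)" unfolding has_dt_def Dt_def
    using d(1) vector_derivative_works has_real_derivative_iff_has_vector_derivative by blast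
  show "has_dx f (Dx f)" unfolding has_dx_def Dx_def
    using d(2) DERIV_deriv_iff_real_differentiable by blast
  show "contS f" "contS (Dt f)" "contS (Dx f)"
    using assms by (auto simp: C1_on_def slab_infty contS_def case_prod_unfold)
qed

text \<open>The function together with named witnesses for all its derivatives up to order two. The
  two mixed derivatives are separate components, so that products of jets are formed without
  appealing to the symmetry of second derivatives.\<close>

definition C2_jet where
  "C2_jet f ft fx ftt ftx fxt fxx \<longleftrightarrow>
     has_dt f ft \<and> has_dx f fx \<and> has_dt ft ftt \<and> has_dx ft ftx \<and> has_dt fx fxt \<and> has_dx fx fxx \<and>
     contS f \<and> contS ft \<and> contS fx \<and> contS ftt \<and> contS ftx \<and> contS fxt \<and> contS fxx"

lemma C2_on_imp_jet:
  "C2_on (slab \<infinity>) f \<Longrightarrow> C2_jet f (Dt f) (Dx f) (Dt (Dt f)) (Dx (Dt f)) (Dt (Dx f)) (Dx (Dx f))"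
  unfolding C2_on_def C2_jet_def using C1_on_slabD by blast

lemma C2_jet_imp_C2_on:
  assumes "C2_jet f ft fx ftt ftx fxt fxx"
  shows "C2_on (slab \<infinity>) f"
proof -
  note j = assms[unfolded C2_jet_def]
  have "C1_on (slab \<infinity>) f" using j C1_on_slabI by blast
  moreover have "C1_on (slab \<infinity>) (Dt f)"
  proof (rule C1_on_slabI)
    show "has_dt (Dt f) ftt" "has_dx (Dt f) ftx" "contS (Dt f)"
      using j has_dt_imp_Dt[of f ft] by (auto intro: has_dt_cong has_dx_cong contS_cong)
  qed (use j in auto)
  moreover have "C1_on (slab \<infinity>) (Dx f)"
  proof (rule C1_on_slabI)
    show "has_dt (Dx f) fxt" "has_dx (Dx f) fxx" "contS (Dx f)"
      using j has_dx_imp_Dx[of f fx] by (auto intro: has_dt_cong has_dx_cong contS_cong)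
  qed (use j in auto)
  ultimately show ?thesis by (simp add: C2_on_def)
qed

lemma C2_jet_derivs:
  assumes "C2_jet f ft fx ftt ftx fxt fxx" "0 \<le> t"
  shows "Dt f t x = ft t x" "Dx f t x = fx t x" "Dt (Dt f) t x = ftt t x" "Dx (Dx f) t x = fxx t x"
proof -
  note j = assms(1)[unfolded C2_jet_def]
  show "Dt f t x = ft t x" "Dx f t x = fx t x"
    using j assms(2) has_dt_imp_Dt has_dx_imp_Dx by auto
  have "has_dt (Dt f) ftt" "has_dx (Dx f) fxx"
    using j has_dt_imp_Dt[of f ft] has_dx_imp_Dx[of f fx] by (auto intro: has_dt_cong has_dx_cong)
  then show "Dt (Dt f) t x = ftt t x" "Dx (Dx f) t x = fxx t x"
    using assms(2) has_dt_imp_Dt has_dx_imp_Dx by auto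
qed

lemma contS_intros:
  "contS f \<Longrightarrow> contS g \<Longrightarrow> contS (\<lambda>t x. f t x + g t x)"
  "contS f \<Longrightarrow> contS g \<Longrightarrow> contS (\<lambda>t x. f t x * g t x)"
  "contS (\<lambda>t x. c)"
  unfolding contS_def by (auto intro!: continuous_intros)

lemma has_dt_add: "has_dt f f' \<Longrightarrow> has_dt g g' \<Longrightarrow> has_dt (\<lambda>t x. f t x + g t x) (\<lambda>t x. f' t x + g' t x)"
  unfolding has_dt_def by (auto intro!: derivative_intros)

lemma has_dx_add: "has_dx f f' \<Longrightarrow> has_dx g g' \<Longrightarrow> has_dx (\<lambda>t x. f t x + g t x) (\<lambda>t x. f' t x + g' t x)"
  unfolding has_dx_def by (auto intro!: derivative_intros)

lemma has_dt_mult: "has_dt f f' \<Longrightarrow> has_dt g g' \<Longrightarrow> has_dt (\<lambda>t x. f t x * g t x) (\<lambda>t x. f' t x * g t x + g' t x * f t x)"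
  unfolding has_dt_def by (auto intro!: DERIV_mult)

lemma has_dx_mult: "has_dx f f' \<Longrightarrow> has_dx g g' \<Longrightarrow> has_dx (\<lambda>t x. f t x * g t x) (\<lambda>t x. f' t x * g t x + g' t x * f t x)"
  unfolding has_dx_def by (auto intro!: DERIV_mult)

lemma C2_jet_mult:
  assumes "C2_jet f ft fx ftt ftx fxt fxx" "C2_jet g gt gx gtt gtx gxt gxx"
  shows "C2_jet (\<lambda>t x. f t x * g t x)
     (\<lambda>t x. ft t x * g t x + gt t x * f t x)
     (\<lambda>t x. fx t x * g t x + gx t x * f t x)
     (\<lambda>t x. (ftt t x * g t x + gt t x * ft t x) + (gtt t x * f t x + ft t x * gt t x))
     (\<lambda>t x. (ftx t x * g t x + gx t x * ft t x) + (gtx t x * f t x + fx t x * gt t x))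
     (\<lambda>t x. (fxt t x * g t x + gt t x * fx t x) + (gxt t x * f t x + ft t x * gx t x))
     (\<lambda>t x. (fxx t x * g t x + gx t x * fx t x) + (gxx t x * f t x + fx t x * gx t x))"
  using assms unfolding C2_jet_def
  by (intro conjI contS_intros has_dt_add has_dx_add has_dt_mult has_dx_mult) blast+

lemma C2_jet_one_plus:
  assumes "C2_jet f ft fx ftt ftx fxt fxx"
  shows "C2_jet (\<lambda>t x. 1 + f t x) ft fx ftt ftx fxt fxx"
  using assms unfolding C2_jet_def has_dt_def has_dx_def
  by (auto intro!: contS_intros derivative_eq_intros)

lemma C2_jet_powr:
  "C2_jet (\<lambda>t x. (1 + t) powr m) (\<lambda>t x. m * (1 + t) powr (m - 1)) (\<lambda>t x. 0)
     (\<lambda>t x. m * ((m - 1) * (1 + t) powr (m - 2))) (\<lambda>t x. 0) (\<lambda>t x. 0) (\<lambda>t x. 0)"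
proof -
  have 1: "has_dt (\<lambda>t x. (1 + t) powr m) (\<lambda>t x. m * (1 + t) powr (m - 1))" for m
    unfolding has_dt_def by (auto intro!: derivative_eq_intros)
  have 2: "has_dt (\<lambda>t x. m * (1 + t) powr (m - 1)) (\<lambda>t x. m * ((m - 1) * (1 + t) powr (m - 2)))"
    using 1[of "m - 1"] unfolding has_dt_def by (auto intro!: DERIV_cmult)
  have c: "contS (\<lambda>t x. (1 + t) powr m)" for m
    unfolding contS_def by (auto intro!: continuous_intros)
  show ?thesis unfolding C2_jet_def using 1 2
    by (auto intro!: contS_intros c simp: has_dx_def has_dt_def)
qed

section \<open>A twice continuously differentiable cutoff\<close>

text \<open>The truncated power of order \<open>n \<ge> 1\<close> has \<open>n - 1\<close>
  continuous derivatives, so the cube is the lowest power fit for a \<open>C2\<close> cutoff. For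
  \<open>n = 0\<close> the value is \<open>1\<close> everywhere, also for negative
  \<open>z\<close>.\<close>

definition pos_pow :: "nat \<Rightarrow> real \<Rightarrow> real" where
  "pos_pow n z = max 0 z ^ n"

lemma pos_pow_bounds: "0 \<le> pos_pow n z" "z \<le> 1 \<Longrightarrow> pos_pow n z \<le> 1"
  by (auto simp: pos_pow_def intro!: power_le_one)

lemma pos_pow_eq_0: "z \<le> 0 \<Longrightarrow> n > 0 \<Longrightarrow> pos_pow n z = 0"
  by (simp add: pos_pow_def)

lemma continuous_pos_pow [continuous_intros]:
  "continuous_on S f \<Longrightarrow> continuous_on S (\<lambda>x. pos_pow n (f x))"
  unfolding pos_pow_def by (intro continuous_intros)

lemma DERIV_pos_pow: "(pos_pow (Suc (Suc n)) has_real_derivative real (Suc (Suc n)) * pos_pow (Suc n) z) (at z)"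
proof -
  consider "z > 0" | "z < 0" | "z = 0" by linarith
  then show ?thesis
  proof cases
    case 1
    have D: "((\<lambda>z. z ^ Suc (Suc n)) has_real_derivative real (Suc (Suc n)) * pos_pow (Suc n) z) (at z)"
      using 1 DERIV_pow[of "Suc (Suc n)" z] by (simp add: pos_pow_def)
    have ev: "\<forall>\<^sub>F y in nhds z. pos_pow (Suc (Suc n)) y = y ^ Suc (Suc n)"
      using eventually_nhds_in_open[of "{0<..}" z] 1
      by (auto elim!: eventually_mono simp: pos_pow_def)
    show ?thesis using DERIV_cong_ev[OF refl ev refl] D by simp
  next
    case 2
    have D: "((\<lambda>z. 0) has_real_derivative real (Suc (Suc n)) * pos_pow (Suc n) z) (at z)"
      using 2 by (simp add: pos_pow_def)
    have ev: "\<forall>\<^sub>F y in nhds z. pos_pow (Suc (Suc n)) y = 0"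
      using eventually_nhds_in_open[of "{..<0}" z] 2
      by (auto elim!: eventually_mono simp: pos_pow_def)
    show ?thesis using DERIV_cong_ev[OF refl ev refl] D by simp
  next
    case 3
    have "((\<lambda>h. max 0 h ^ Suc n) \<longlongrightarrow> max 0 0 ^ Suc n) (at (0::real))"
      by (intro tendsto_intros)
    moreover have "max 0 h ^ Suc n = (pos_pow (Suc (Suc n)) (0+h) - pos_pow (Suc (Suc n)) 0) / h" if "h \<noteq> 0" for h :: real
      using that by (cases "h > 0") (auto simp: pos_pow_def)
    ultimately have "((\<lambda>h. (pos_pow (Suc (Suc n)) (0+h) - pos_pow (Suc (Suc n)) 0) / h) \<longlongrightarrow> 0) (at 0)"
      by (subst Lim_cong_within[OF refl refl refl, symmetric]) auto
    then show ?thesis using 3 by (simp add: DERIV_def pos_pow_def)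
  qed
qed

text \<open>The cutoff is \<open>max 0 P ^ (n + 3)\<close> where \<open>P = cut_arg R t x\<close> is \<open>1\<close> for \<open>t, \<bar>x\<bar> \<le> R\<close> and nonpositive
  once \<open>t \<ge> 2 * R\<close> or \<open>\<bar>x\<bar> \<ge> 2 * R\<close>. It is only \<open>C\<^sup>2\<close>, which suffices, and its derivatives up to order two are
  controlled by the power \<open>n + 1\<close> of \<open>max 0 P\<close>: for large \<open>n\<close> they can be absorbed by the cutoff itself.\<close>

definition cut_arg :: "real \<Rightarrow> real \<Rightarrow> real \<Rightarrow> real" where
  "cut_arg R t x = 1 - pos_pow 3 (t / R - 1) - pos_pow 3 (x / R - 1) - pos_pow 3 (- x / R - 1)"

definition cut_arg_t :: "real \<Rightarrow> real \<Rightarrow> real \<Rightarrow> real" where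
  "cut_arg_t R t x = - (3 / R) * pos_pow 2 (t / R - 1)"

definition cut_arg_x :: "real \<Rightarrow> real \<Rightarrow> real \<Rightarrow> real" where
  "cut_arg_x R t x = (3 / R) * (pos_pow 2 (- x / R - 1) - pos_pow 2 (x / R - 1))"

definition cut_arg_tt :: "real \<Rightarrow> real \<Rightarrow> real \<Rightarrow> real" where
  "cut_arg_tt R t x = - (6 / R\<^sup>2) * pos_pow 1 (t / R - 1)"

definition cut_arg_xx :: "real \<Rightarrow> real \<Rightarrow> real \<Rightarrow> real" where
  "cut_arg_xx R t x = - (6 / R\<^sup>2) * (pos_pow 1 (x / R - 1) + pos_pow 1 (- x / R - 1))"

definition cutoff :: "nat \<Rightarrow> real \<Rightarrow> real \<Rightarrow> real \<Rightarrow> real" where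
  "cutoff n R t x = pos_pow (n + 3) (cut_arg R t x)"

definition cutoff_t :: "nat \<Rightarrow> real \<Rightarrow> real \<Rightarrow> real \<Rightarrow> real" where
  "cutoff_t n R t x = real (n + 3) * pos_pow (n + 2) (cut_arg R t x) * cut_arg_t R t x"

definition cutoff_x :: "nat \<Rightarrow> real \<Rightarrow> real \<Rightarrow> real \<Rightarrow> real" where
  "cutoff_x n R t x = real (n + 3) * pos_pow (n + 2) (cut_arg R t x) * cut_arg_x R t x"

definition cutoff_tt :: "nat \<Rightarrow> real \<Rightarrow> real \<Rightarrow> real \<Rightarrow> real" where
  "cutoff_tt n R t x = real (n + 3) * (real (n + 2) * pos_pow (n + 1) (cut_arg R t x) * (cut_arg_t R t x)\<^sup>2
      + pos_pow (n + 2) (cut_arg R t x) * cut_arg_tt R t x)"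

definition cutoff_xx :: "nat \<Rightarrow> real \<Rightarrow> real \<Rightarrow> real \<Rightarrow> real" where
  "cutoff_xx n R t x = real (n + 3) * (real (n + 2) * pos_pow (n + 1) (cut_arg R t x) * (cut_arg_x R t x)\<^sup>2
      + pos_pow (n + 2) (cut_arg R t x) * cut_arg_xx R t x)"

definition cutoff_tx :: "nat \<Rightarrow> real \<Rightarrow> real \<Rightarrow> real \<Rightarrow> real" where
  "cutoff_tx n R t x = real (n + 3) * (real (n + 2) * pos_pow (n + 1) (cut_arg R t x) * cut_arg_t R t x * cut_arg_x R t x)"

lemma DERIV_pos_pow':
  assumes "(f has_real_derivative f') (at x within S)"
  shows "((\<lambda>x. pos_pow (Suc (Suc n)) (f x)) has_real_derivative (real (Suc (Suc n)) * pos_pow (Suc n) (f x)) * f') (at x within S)"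
  by (rule DERIV_chain2[OF DERIV_pos_pow assms])

lemma cutoff_jet:
  assumes R: "R > 0"
  shows "C2_jet (cutoff n R) (cutoff_t n R) (cutoff_x n R) (cutoff_tt n R) (cutoff_tx n R) (cutoff_tx n R) (cutoff_xx n R)"
proof -
  have D3: "((\<lambda>x. pos_pow 3 (f x)) has_real_derivative (3 * pos_pow 2 (f x)) * f') (at x within S)"
    and D2: "((\<lambda>x. pos_pow 2 (f x)) has_real_derivative (2 * pos_pow 1 (f x)) * f') (at x within S)"
    and Dn3: "((\<lambda>x. pos_pow (n+3) (f x)) has_real_derivative (real (n+3) * pos_pow (n+2) (f x)) * f') (at x within S)"
    and Dn2: "((\<lambda>x. pos_pow (n+2) (f x)) has_real_derivative (real (n+2) * pos_pow (n+1) (f x)) * f') (at x within S)"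
    if "(f has_real_derivative f') (at x within S)" for f f' x S
    using DERIV_pos_pow'[OF that, of 1] DERIV_pos_pow'[OF that, of 0] DERIV_pos_pow'[OF that, of n]
      DERIV_pos_pow'[OF that, of "Suc n"] by (simp_all add: numeral_3_eq_3 numeral_2_eq_2)
  have L1: "((\<lambda>t. t / R - 1) has_real_derivative 1 / R) (at t within S)"
    and L2: "((\<lambda>t. - t / R - 1) has_real_derivative - 1 / R) (at t within S)" for t S
    by (auto intro!: derivative_eq_intros simp: R[THEN less_imp_neq, symmetric])
  have at: "((\<lambda>t. cut_arg R t x) has_real_derivative cut_arg_t R t x) (at t within S)" for t x S
  proof -
    have "((\<lambda>t. cut_arg R t x) has_real_derivative 0 - (3 * pos_pow 2 (t / R - 1)) * (1 / R) - 0 - 0) (at t within S)"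
      unfolding cut_arg_def by (intro DERIV_diff DERIV_const D3 L1)
    then show ?thesis by (simp add: cut_arg_t_def)
  qed
  have ax: "((\<lambda>x. cut_arg R t x) has_real_derivative cut_arg_x R t x) (at x within S)" for t x S
  proof -
    have "((\<lambda>x. cut_arg R t x) has_real_derivative 0 - 0 - (3 * pos_pow 2 (x / R - 1)) * (1 / R)
       - (3 * pos_pow 2 (- x / R - 1)) * (- 1 / R)) (at x within S)"
      unfolding cut_arg_def by (intro DERIV_diff DERIV_const D3 L1 L2)
    moreover have "0 - 0 - (3 * pos_pow 2 (x / R - 1)) * (1 / R)
       - (3 * pos_pow 2 (- x / R - 1)) * (- 1 / R) = cut_arg_x R t x"
      by (simp add: cut_arg_x_def right_diff_distrib)
    ultimately show ?thesis by simp
  qed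
  have att: "((\<lambda>t. cut_arg_t R t x) has_real_derivative cut_arg_tt R t x) (at t within S)" for t x S
  proof -
    have "((\<lambda>t. cut_arg_t R t x) has_real_derivative - (3 / R) * ((2 * pos_pow 1 (t / R - 1)) * (1 / R))) (at t within S)"
      unfolding cut_arg_t_def by (intro DERIV_cmult D2 L1)
    then show ?thesis by (simp add: cut_arg_tt_def power2_eq_square)
  qed
  have axx: "((\<lambda>x. cut_arg_x R t x) has_real_derivative cut_arg_xx R t x) (at x within S)" for t x S
  proof -
    have "((\<lambda>x. cut_arg_x R t x) has_real_derivative (3 / R) * ((2 * pos_pow 1 (- x / R - 1)) * (- 1 / R)
       - (2 * pos_pow 1 (x / R - 1)) * (1 / R))) (at x within S)"
      unfolding cut_arg_x_def by (intro DERIV_cmult DERIV_diff D2 L1 L2)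
    moreover have "(3 / R) * ((2 * pos_pow 1 (- x / R - 1)) * (- 1 / R) - (2 * pos_pow 1 (x / R - 1)) * (1 / R)) = cut_arg_xx R t x"
      using R by (simp add: cut_arg_xx_def power2_eq_square field_simps)
    ultimately show ?thesis by simp
  qed
  have atx: "((\<lambda>x. cut_arg_t R t x) has_real_derivative 0) (at x within S)"
    and axt: "((\<lambda>t. cut_arg_x R t x) has_real_derivative 0) (at t within S)" for t x S
    unfolding cut_arg_t_def cut_arg_x_def by auto
  have "has_dt (cutoff n R) (cutoff_t n R)" "has_dx (cutoff n R) (cutoff_x n R)"
    unfolding has_dt_def has_dx_def cutoff_def[abs_def] cutoff_t_def cutoff_x_def
    using Dn3[OF at] Dn3[OF ax] by blast+
  moreover have "has_dt (cutoff_t n R) (cutoff_tt n R)"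
    unfolding has_dt_def
  proof (intro allI impI)
    fix t x
    have "((\<lambda>s. cutoff_t n R s x) has_real_derivative
       ((real (n + 3) * ((real (n + 2) * pos_pow (n + 1) (cut_arg R t x)) * cut_arg_t R t x)) * cut_arg_t R t x
        + cut_arg_tt R t x * (real (n + 3) * pos_pow (n + 2) (cut_arg R t x)))) (at t within {0..})"
      unfolding cutoff_t_def by (intro DERIV_mult DERIV_cmult Dn2 at att)
    then show "((\<lambda>s. cutoff_t n R s x) has_real_derivative cutoff_tt n R t x) (at t within {0..})"
      by (rule DERIV_cong) (simp only: cutoff_tt_def power2_eq_square distrib_left mult_ac)
  qed
  moreover have "has_dx (cutoff_x n R) (cutoff_xx n R)"
    unfolding has_dx_def
  proof (intro allI impI)
    fix t x
    have "((\<lambda>x. cutoff_x n R t x) has_real_derivative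
       ((real (n + 3) * ((real (n + 2) * pos_pow (n + 1) (cut_arg R t x)) * cut_arg_x R t x)) * cut_arg_x R t x
        + cut_arg_xx R t x * (real (n + 3) * pos_pow (n + 2) (cut_arg R t x)))) (at x)"
      unfolding cutoff_x_def by (intro DERIV_mult DERIV_cmult Dn2 ax axx)
    then show "(cutoff_x n R t has_real_derivative cutoff_xx n R t x) (at x)"
      by (rule DERIV_cong) (simp only: cutoff_xx_def power2_eq_square distrib_left mult_ac)
  qed
  moreover have "has_dx (cutoff_t n R) (cutoff_tx n R)"
    unfolding has_dx_def
  proof (intro allI impI)
    fix t x
    have "((\<lambda>x. cutoff_t n R t x) has_real_derivative
       ((real (n + 3) * ((real (n + 2) * pos_pow (n + 1) (cut_arg R t x)) * cut_arg_x R t x)) * cut_arg_t R t x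
        + 0 * (real (n + 3) * pos_pow (n + 2) (cut_arg R t x)))) (at x)"
      unfolding cutoff_t_def by (intro DERIV_mult DERIV_cmult Dn2 ax atx)
    then show "(cutoff_t n R t has_real_derivative cutoff_tx n R t x) (at x)"
      by (rule DERIV_cong) (simp add: cutoff_tx_def mult_ac)
  qed
  moreover have "has_dt (cutoff_x n R) (cutoff_tx n R)"
    unfolding has_dt_def
  proof (intro allI impI)
    fix t x
    have "((\<lambda>s. cutoff_x n R s x) has_real_derivative
       ((real (n + 3) * ((real (n + 2) * pos_pow (n + 1) (cut_arg R t x)) * cut_arg_t R t x)) * cut_arg_x R t x
        + 0 * (real (n + 3) * pos_pow (n + 2) (cut_arg R t x)))) (at t within {0..})"
      unfolding cutoff_x_def by (intro DERIV_mult DERIV_cmult Dn2 at axt)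
    then show "((\<lambda>s. cutoff_x n R s x) has_real_derivative cutoff_tx n R t x) (at t within {0..})"
      by (rule DERIV_cong) (simp add: cutoff_tx_def mult_ac)
  qed
  moreover have "contS (cutoff n R)" "contS (cutoff_t n R)" "contS (cutoff_x n R)" "contS (cutoff_tt n R)"
     "contS (cutoff_tx n R)" "contS (cutoff_xx n R)"
    unfolding contS_def cutoff_def cutoff_t_def cutoff_x_def cutoff_tt_def cutoff_tx_def cutoff_xx_def 
      cut_arg_def cut_arg_t_def cut_arg_x_def cut_arg_tt_def cut_arg_xx_def divide_inverse
    by (intro continuous_intros)+
  ultimately show ?thesis unfolding C2_jet_def by blast
qed

lemma cut_arg_le_1: "cut_arg R t x \<le> 1"
  using pos_pow_bounds(1)[of 3 "t / R - 1"] pos_pow_bounds(1)[of 3 "x / R - 1"] pos_pow_bounds(1)[of 3 "- x / R - 1"]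
  unfolding cut_arg_def by linarith

lemma cut_arg_eq_1:
  assumes "R > 0" "t \<le> R" "\<bar>x\<bar> \<le> R"
  shows "cut_arg R t x = 1"
  using assms by (simp add: cut_arg_def pos_pow_eq_0 field_simps)

lemma pos_pow_less_1_imp: "pos_pow n z < 1 \<Longrightarrow> z < 1"
proof (rule ccontr)
  assume *: "pos_pow n z < 1" "\<not> z < 1"
  then have "1 \<le> z ^ n" by (intro one_le_power) simp
  with * show False by (simp add: pos_pow_def max_absorb2)
qed

lemma cut_arg_pos_imp:
  assumes "cut_arg R t x > 0"
  shows "t / R - 1 < 1" "x / R - 1 < 1" "- x / R - 1 < 1"
proof -
  have "pos_pow 3 (t / R - 1) < 1" "pos_pow 3 (x / R - 1) < 1" "pos_pow 3 (- x / R - 1) < 1"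
    using assms pos_pow_bounds(1)[of 3 "t / R - 1"] pos_pow_bounds(1)[of 3 "x / R - 1"] pos_pow_bounds(1)[of 3 "- x / R - 1"]
    unfolding cut_arg_def by linarith+
  then show "t / R - 1 < 1" "x / R - 1 < 1" "- x / R - 1 < 1"
    using pos_pow_less_1_imp by blast+
qed

lemma cut_arg_nonpos:
  assumes "R > 0" "t \<ge> 2 * R \<or> \<bar>x\<bar> \<ge> 2 * R"
  shows "cut_arg R t x \<le> 0"
proof (rule ccontr)
  assume "\<not> cut_arg R t x \<le> 0"
  then have "t / R < 2" "x / R < 2" "- x / R < 2" using cut_arg_pos_imp[of R t x] by auto
  then show False using assms by (auto simp: field_simps)
qed

text \<open>Each derivative costs a factor \<open>1 / R\<close> and lowers the power of the
  truncated \<open>cut_arg\<close> by at most one; the power \<open>n + 2\<close> is weakened to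
  \<open>n + 1\<close>, which is legitimate because \<open>cut_arg\<close> is at most
  \<open>1\<close>. Where \<open>cut_arg\<close> is positive, the inner truncated powers lie between
  \<open>0\<close> and \<open>1\<close>; elsewhere all four derivatives vanish. The factor
  \<open>48\<close> is a generous choice that serves all four bounds.\<close>

lemma cutoff_bounds:
  fixes n :: nat and R t x :: real
  assumes R: "R > 0"
  defines "N \<equiv> real (n + 3) * real (n + 3) * 48" and "Y \<equiv> pos_pow (n + 1) (cut_arg R t x)"
  shows "\<bar>cutoff_t n R t x\<bar> \<le> N / R * Y" "\<bar>cutoff_x n R t x\<bar> \<le> N / R * Y"
    "\<bar>cutoff_tt n R t x\<bar> \<le> N / R\<^sup>2 * Y" "\<bar>cutoff_xx n R t x\<bar> \<le> N / R\<^sup>2 * Y"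
proof -
  let ?p = "cut_arg R t x"
  have Y0: "0 \<le> Y" by (simp add: Y_def pos_pow_bounds)
  have Y2: "0 \<le> pos_pow (n+2) ?p" "pos_pow (n+2) ?p \<le> Y"
    unfolding Y_def pos_pow_def using cut_arg_le_1[of R t x] by (intro zero_le_power power_decreasing; simp)+
  have N: "0 \<le> N" by (simp add: N_def)
  show "\<bar>cutoff_t n R t x\<bar> \<le> N / R * Y" "\<bar>cutoff_x n R t x\<bar> \<le> N / R * Y"
    "\<bar>cutoff_tt n R t x\<bar> \<le> N / R\<^sup>2 * Y" "\<bar>cutoff_xx n R t x\<bar> \<le> N / R\<^sup>2 * Y"
  proof (atomize(full), cases "?p > 0")
    case False
    then have z: "pos_pow (n+2) ?p = 0" "pos_pow (n+1) ?p = 0" by (simp_all add: pos_pow_eq_0)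
    show "(\<bar>cutoff_t n R t x\<bar> \<le> N / R * Y \<and> \<bar>cutoff_x n R t x\<bar> \<le> N / R * Y) \<and>
      \<bar>cutoff_tt n R t x\<bar> \<le> N / R\<^sup>2 * Y \<and> \<bar>cutoff_xx n R t x\<bar> \<le> N / R\<^sup>2 * Y"
      unfolding cutoff_t_def cutoff_x_def cutoff_tt_def cutoff_xx_def z using Y0 N R by simp
  next
    case True
    note lt = cut_arg_pos_imp[OF True]
    have b: "0 \<le> pos_pow m (t / R - 1)" "pos_pow m (t / R - 1) \<le> 1"
       "0 \<le> pos_pow m (x / R - 1)" "pos_pow m (x / R - 1) \<le> 1"
       "0 \<le> pos_pow m (- x / R - 1)" "pos_pow m (- x / R - 1) \<le> 1" for m
      using lt by (intro pos_pow_bounds; simp)+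
    have a: "\<bar>cut_arg_t R t x\<bar> \<le> 3 / R"
      unfolding cut_arg_t_def using b(1,2)[of 2] R by (simp add: abs_mult divide_simps)
    have c: "\<bar>cut_arg_x R t x\<bar> \<le> 3 / R"
    proof -
      have "\<bar>pos_pow 2 (- x / R - 1) - pos_pow 2 (x / R - 1)\<bar> \<le> 1" using b(3-6)[of 2] by linarith
      then show ?thesis unfolding cut_arg_x_def using R by (simp add: abs_mult divide_simps)
    qed
    have d: "\<bar>cut_arg_tt R t x\<bar> \<le> 12 / R\<^sup>2"
      unfolding cut_arg_tt_def using b(1,2)[of 1] R by (simp add: abs_mult divide_simps)
    have e: "\<bar>cut_arg_xx R t x\<bar> \<le> 12 / R\<^sup>2"
    proof -
      have "\<bar>pos_pow 1 (x / R - 1) + pos_pow 1 (- x / R - 1)\<bar> \<le> 2" using b(3-6)[of 1] by linarith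
      then show ?thesis unfolding cut_arg_xx_def using R by (simp add: abs_mult divide_simps)
    qed
    have first: "\<bar>real (n+3) * pos_pow (n+2) ?p * z\<bar> \<le> N / R * Y" if "\<bar>z\<bar> \<le> 3 / R" for z
    proof -
      have "\<bar>real (n+3) * pos_pow (n+2) ?p * z\<bar> = (real (n+3) * pos_pow (n+2) ?p) * \<bar>z\<bar>"
        using Y2 by (simp add: abs_mult)
      also have "\<dots> \<le> (real (n+3) * Y) * (3 / R)"
        using Y2 Y0 that R by (intro mult_mono mult_nonneg_nonneg) auto
      also have "\<dots> = (real (n+3) * 3) / R * Y" by simp
      also have "\<dots> \<le> N / R * Y"
        using Y0 R by (intro mult_right_mono divide_right_mono) (auto simp: N_def algebra_simps)
      finally show ?thesis .
    qed
    have second: "\<bar>real (n+3) * (real (n+2) * pos_pow (n+1) ?p * z\<^sup>2 + pos_pow (n+2) ?p * v)\<bar> \<le> N / R\<^sup>2 * Y"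
      if "\<bar>z\<bar> \<le> 3 / R" "\<bar>v\<bar> \<le> 12 / R\<^sup>2" for z v
    proof -
      have z2: "z\<^sup>2 \<le> 9 / R\<^sup>2" using power_mono[OF that(1), of 2] by (simp add: power_divide)
      have "\<bar>real (n+3) * (real (n+2) * pos_pow (n+1) ?p * z\<^sup>2 + pos_pow (n+2) ?p * v)\<bar>
         \<le> real (n+3) * (real (n+2) * Y * z\<^sup>2 + pos_pow (n+2) ?p * \<bar>v\<bar>)"
        using Y0 Y2 unfolding Y_def[symmetric] 
        by (auto simp: abs_mult intro!: mult_left_mono order_trans[OF abs_triangle_ineq])
      also have "\<dots> \<le> real (n+3) * (real (n+2) * Y * (9 / R\<^sup>2) + Y * (12 / R\<^sup>2))"
        using Y2 Y0 that(2) z2 by (intro mult_left_mono add_mono mult_mono) auto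
      also have "\<dots> = (real (n+3) * (real (n+2) * 9 + 12)) / R\<^sup>2 * Y" by (simp add: algebra_simps add_divide_distrib)
      also have "\<dots> \<le> N / R\<^sup>2 * Y"
        using Y0 by (intro mult_right_mono divide_right_mono) (auto simp: N_def algebra_simps)
      finally show ?thesis .
    qed
    show "(\<bar>cutoff_t n R t x\<bar> \<le> N / R * Y \<and> \<bar>cutoff_x n R t x\<bar> \<le> N / R * Y) \<and>
      \<bar>cutoff_tt n R t x\<bar> \<le> N / R\<^sup>2 * Y \<and> \<bar>cutoff_xx n R t x\<bar> \<le> N / R\<^sup>2 * Y"
      unfolding cutoff_t_def cutoff_x_def cutoff_tt_def cutoff_xx_def
      using first[OF a] first[OF c] second[OF a d] second[OF c e] by blast
  qed
qed

lemma cutoff_derivs_zero_inner: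
  assumes "R > 0" "t \<le> R" "\<bar>x\<bar> \<le> R"
  shows "cutoff_t n R t x = 0" "cutoff_x n R t x = 0" "cutoff_tt n R t x = 0" "cutoff_xx n R t x = 0"
proof -
  have "t / R - 1 \<le> 0" "x / R - 1 \<le> 0" "- x / R - 1 \<le> 0" using assms by (auto simp: field_simps)
  then show "cutoff_t n R t x = 0" "cutoff_x n R t x = 0" "cutoff_tt n R t x = 0" "cutoff_xx n R t x = 0"
    by (simp_all add: cutoff_t_def cutoff_x_def cutoff_tt_def cutoff_xx_def cut_arg_t_def cut_arg_x_def
      cut_arg_tt_def cut_arg_xx_def pos_pow_eq_0)
qed

section \<open>The test function argument\<close>

lemma cutoff_bounds01: "0 \<le> cutoff n R t x" "cutoff n R t x \<le> 1"
  unfolding cutoff_def by (intro pos_pow_bounds cut_arg_le_1)+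

text \<open>At time \<open>0\<close> the cutoff is even in \<open>x\<close> and nonincreasing in
  \<open>\<bar>x\<bar>\<close>. Undoing the outer power and then the cube gives the radius
  explicitly as \<open>R * (1 + z)\<close>.\<close>

lemma cutoff_0_superlevel:
  assumes R: "R > 0" and s: "0 < s" "s < 1"
  shows "\<exists>\<rho>\<ge>R. {x. s < cutoff n R 0 x} = {-\<rho><..<\<rho>}"
proof -
  have *: "a ^ k < b ^ k \<longleftrightarrow> a < b" if "0 \<le> a" "0 \<le> b" "0 < k" for a b :: real and k
    using power_mono_iff[OF that(2,1,3)] by (simp add: linorder_not_le[symmetric])
  define y where "y = root (n + 3) s"
  have y: "y ^ (n + 3) = s" "0 < y" "y < 1"
    using s by (simp_all add: y_def real_root_pow_pos2)
  define z where "z = root 3 (1 - y)"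
  have z: "z ^ 3 = 1 - y" "0 < z"
    using y by (simp_all add: z_def real_root_pow_pos2)
  have "s < cutoff n R 0 x \<longleftrightarrow> \<bar>x\<bar> < R * (1 + z)" for x
  proof -
    have "s < cutoff n R 0 x \<longleftrightarrow> y ^ (n + 3) < max 0 (cut_arg R 0 x) ^ (n + 3)"
      by (simp add: cutoff_def pos_pow_def y)
    also have "\<dots> \<longleftrightarrow> y < max 0 (cut_arg R 0 x)"
      by (rule *) (use y in auto)
    also have "\<dots> \<longleftrightarrow> y < cut_arg R 0 x" using y by auto
    also have "cut_arg R 0 x = 1 - max 0 (\<bar>x\<bar> / R - 1) ^ 3"
    proof -
      have "pos_pow 3 (0 / R - 1) = 0" by (simp add: pos_pow_eq_0)
      moreover have "pos_pow 3 (x / R - 1) + pos_pow 3 (- x / R - 1) = max 0 (\<bar>x\<bar> / R - 1) ^ 3"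
      proof (cases "x \<ge> 0")
        case True
        then have "- x / R - 1 \<le> 0" using R by (simp add: field_simps)
        then have "pos_pow 3 (- x / R - 1) = 0" by (intro pos_pow_eq_0) auto
        then show ?thesis using True by (simp add: pos_pow_def)
      next
        case False
        then have "x / R - 1 \<le> 0" using R by (simp add: field_simps)
        then have "pos_pow 3 (x / R - 1) = 0" by (intro pos_pow_eq_0) auto
        then show ?thesis using False by (simp add: pos_pow_def)
      qed
      ultimately show ?thesis unfolding cut_arg_def by linarith
    qed
    also have "y < 1 - max 0 (\<bar>x\<bar> / R - 1) ^ 3 \<longleftrightarrow> max 0 (\<bar>x\<bar> / R - 1) ^ 3 < z ^ 3" using z by auto
    also have "\<dots> \<longleftrightarrow> max 0 (\<bar>x\<bar> / R - 1) < z"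
      by (rule *) (use z in auto)
    also have "\<dots> \<longleftrightarrow> \<bar>x\<bar> / R < 1 + z" using z by auto
    also have "\<dots> \<longleftrightarrow> \<bar>x\<bar> < R * (1 + z)" using R by (simp add: pos_divide_less_eq mult.commute)
    finally show ?thesis .
  qed
  then have "{x. s < cutoff n R 0 x} = {x. \<bar>x\<bar> < R * (1 + z)}" by (simp only:)
  moreover have "{x. \<bar>x\<bar> < r} = {-r<..<r}" for r :: real by auto
  ultimately have "{x. s < cutoff n R 0 x} = {- (R * (1 + z))<..<R * (1 + z)}" by (simp only:)
  moreover have "R \<le> R * (1 + z)" using R z by simp
  ultimately show ?thesis by blast
qed

lemma cutoff_eq_0:
  assumes "R > 0" "t \<ge> 2 * R \<or> \<bar>x\<bar> \<ge> 2 * R"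
  shows "cutoff n R t x = 0"
  unfolding cutoff_def by (rule pos_pow_eq_0[OF cut_arg_nonpos[OF assms]]) simp

lemma cutoff_eq_1:
  assumes "R > 0" "t \<le> R" "\<bar>x\<bar> \<le> R"
  shows "cutoff n R t x = 1"
  unfolding cutoff_def cut_arg_eq_1[OF assms] by (simp add: pos_pow_def)

lemma continuous_cutoff: "continuous_on S (\<lambda>z. cutoff n R (f z) (g z))"
  if "continuous_on S f" "continuous_on S g" for f g :: "'a::topological_space \<Rightarrow> real"
  unfolding cutoff_def cut_arg_def divide_inverse by (intro continuous_intros that)

text \<open>Layer cake: the superlevel sets of the cutoff at time \<open>0\<close> are symmetric intervals containing
  \<open>(-R, R)\<close>, so the integral against it is an average of integrals over such intervals.\<close>

lemma integral_cutoff_ge: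
  fixes F :: "real \<Rightarrow> real"
  assumes F [measurable]: "F \<in> borel_measurable lebesgue"
    and int: "\<And>r. integrable lebesgue (\<lambda>x. indicator {-r..r} x * F x)"
    and c: "\<And>r. r \<ge> R \<Longrightarrow> c \<le> (LINT x|lebesgue. indicator {-r..r} x * F x)"
    and R: "R > 0"
  shows "c \<le> (LINT x|lebesgue. F x * cutoff n R 0 x)"
proof -
  \<comment> \<open>Fubini's theorem will be applied on the product of \<open>lborel\<close> with
    itself, so \<open>F\<close> is exchanged for a Borel function that agrees with it almost
    everywhere.\<close>
  obtain F' where [measurable]: "F' \<in> borel_measurable lborel" and "AE x in lborel. F x = F' x"
    using completion_ex_borel_measurable_real[OF F] by blast
  then have eq: "AE x in lebesgue. F x = F' x" by (intro AE_completion)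
  have F'l [measurable]: "F' \<in> borel_measurable lebesgue" by (rule measurable_completion) measurable
  define Z where "Z = cutoff n R 0"
  have Z01: "0 \<le> Z x" "Z x \<le> 1" for x by (simp_all add: Z_def cutoff_bounds01)
  have Z0: "Z x = 0" if "\<bar>x\<bar> \<ge> 2 * R" for x using cutoff_eq_0[OF R] that by (simp add: Z_def)
  have [measurable]: "Z \<in> borel_measurable borel"
    unfolding Z_def by (intro borel_measurable_continuous_onI continuous_cutoff continuous_intros)
  have int': "integrable lborel (\<lambda>x. indicator {-r..r} x * F' x)"
    and ieq: "(LINT x|lebesgue. indicator {-r..r} x * F x) = (LINT x|lborel. indicator {-r..r} x * F' x)" for r
  proof -
    have [measurable]: "{-r..r} \<in> sets lebesgue" by simp
    have m: "(\<lambda>x. indicator {-r..r} x * F x) \<in> borel_measurable lebesgue"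
       "(\<lambda>x. indicator {-r..r} x * F' x) \<in> borel_measurable lebesgue" by measurable
    have ae: "AE x in lebesgue. indicator {-r..r} x * F x = indicator {-r..r} x * F' x"
      using eq by eventually_elim simp
    have "integrable lebesgue (\<lambda>x. indicator {-r..r} x * F' x)"
      using integrable_cong_AE[OF m ae] int by simp
    then show "integrable lborel (\<lambda>x. indicator {-r..r} x * F' x)"
      by (subst (asm) integrable_completion) auto
    have "(LINT x|lebesgue. indicator {-r..r} x * F x) = (LINT x|lebesgue. indicator {-r..r} x * F' x)"
      by (rule integral_cong_AE[OF m ae])
    also have "\<dots> = (LINT x|lborel. indicator {-r..r} x * F' x)"
      by (rule integral_completion) measurable
    finally show "(LINT x|lebesgue. indicator {-r..r} x * F x) = (LINT x|lborel. indicator {-r..r} x * F' x)" .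
  qed
  \<comment> \<open>Integrated over \<open>s\<close>, the kernel gives back
    \<open>F' x * Z x\<close>; integrated over \<open>x\<close>, it gives the integral of
    \<open>F'\<close> over the superlevel set of the cutoff at height \<open>s\<close>.\<close>
  define k where "k x s = F' x * indicator {0<..<Z x} s" for x s
  have ks: "(LINT s|lborel. k x s) = F' x * Z x" "(LINT s|lborel. norm (k x s)) = \<bar>F' x\<bar> * Z x"
    "integrable lborel (k x)" for x
    using Z01(1)[of x] by (auto simp: k_def[abs_def] abs_mult)
  have ik: "integrable (lborel \<Otimes>\<^sub>M lborel) (\<lambda>(x, s). k x s)"
  proof (rule lborel_pair.Fubini_integrable)
    have "(\<lambda>(x, s). k x s) = (\<lambda>z. F' (fst z) * indicator {z \<in> space (lborel \<Otimes>\<^sub>M lborel). 0 < snd z \<and> snd z < Z (fst z)} z)"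
      by (auto simp: k_def indicator_def space_pair_measure)
    also have "\<dots> \<in> borel_measurable (lborel \<Otimes>\<^sub>M lborel)" by measurable
    finally show "(\<lambda>(x, s). k x s) \<in> borel_measurable (lborel \<Otimes>\<^sub>M lborel)" .
    have "integrable lborel (\<lambda>x. \<bar>F' x\<bar> * Z x)"
    proof (rule Bochner_Integration.integrable_bound[OF int'[of "2 * R"]])
      show "AE x in lborel. norm (\<bar>F' x\<bar> * Z x) \<le> norm (indicator {- (2 * R)..2 * R} x * F' x)"
      proof (rule AE_I2)
        fix x show "norm (\<bar>F' x\<bar> * Z x) \<le> norm (indicator {- (2 * R)..2 * R} x * F' x)"
        proof (cases "\<bar>x\<bar> \<ge> 2 * R")
          case False
          have "\<bar>F' x\<bar> * Z x \<le> \<bar>F' x\<bar>" using Z01[of x] by (simp add: mult_left_le)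
          moreover have "x \<in> {- (2 * R)..2 * R}" using False by auto
          ultimately show ?thesis using Z01[of x] by (simp add: abs_mult)
        qed (simp add: Z0)
      qed
    qed measurable
    then show "integrable lborel (\<lambda>x. LINT y|lborel. norm (case (x, y) of (x, s) \<Rightarrow> k x s))"
      by (simp add: ks(2)[simplified])
    show "AE x in lborel. integrable lborel (\<lambda>y. case (x, y) of (x, s) \<Rightarrow> k x s)"
      using ks(3) by simp
  qed
  have inner: "c * indicator {0<..<1} s \<le> (LINT x|lborel. k x s)" for s
  proof (cases "0 < s \<and> s < 1")
    case True
    then obtain \<rho> where \<rho>: "\<rho> \<ge> R" "{x. s < cutoff n R 0 x} = {-\<rho><..<\<rho>}"
      using cutoff_0_superlevel[OF R] by blast
    have kk: "k x s = indicator {-\<rho><..<\<rho>} x * F' x" for x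
      using True \<rho>(2) by (auto simp: k_def indicator_def Z_def set_eq_iff)
    have "(LINT x|lborel. k x s) = (LINT x|lborel. indicator {-\<rho>..\<rho>} x * F' x)"
    proof (rule integral_cong_AE)
      show "AE x in lborel. k x s = indicator {-\<rho>..\<rho>} x * F' x"
        using AE_lborel_singleton[of \<rho>] AE_lborel_singleton[of "-\<rho>"]
        by eventually_elim (auto simp: kk indicator_def)
    qed (unfold kk, measurable)
    then show ?thesis using c[OF \<rho>(1)] ieq[of \<rho>] True by simp
  next
    case False
    then have "k x s = 0" for x using Z01(2)[of x] by (auto simp: k_def indicator_def)
    then show ?thesis using False by (auto simp: indicator_def)
  qed
  have "c = (LINT s|lborel. c * indicator {0<..<1::real} s)" by simp
  also have "\<dots> \<le> (LINT s|lborel. LINT x|lborel. k x s)"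
    by (rule integral_mono[OF _ lborel_pair.integrable_snd[OF ik] inner]) auto
  also have "\<dots> = (LINT x|lborel. LINT s|lborel. k x s)"
    by (rule lborel_pair.Fubini_integral[OF ik])
  also have "\<dots> = (LINT x|lborel. F' x * Z x)" by (simp add: ks)
  also have "\<dots> = (LINT x|lebesgue. F' x * Z x)"
    by (rule integral_completion[symmetric]) measurable
  also have "\<dots> = (LINT x|lebesgue. F x * Z x)"
  proof (rule integral_cong_AE)
    have [measurable]: "Z \<in> borel_measurable lebesgue" by (rule measurable_completion) measurable
    show "(\<lambda>x. F' x * Z x) \<in> borel_measurable lebesgue" "(\<lambda>x. F x * Z x) \<in> borel_measurable lebesgue" by measurable
    show "AE x in lebesgue. F' x * Z x = F x * Z x" using eq by eventually_elim simp
  qed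
  finally show ?thesis by (simp add: Z_def)
qed

text \<open>The exponent of \<open>s\<close> produced by Young's inequality is \<open>m - q\<close>; it is weakened to \<open>q - 2 > -1\<close>,
  which is where \<open>p \<le> 1 + 2 / m\<close> enters and which makes the remainder integrate to a constant over boxes
  of size \<open>R\<close>.\<close>

lemma young_weighted:
  fixes U y s R \<epsilon> G w L c m p q :: real and n :: nat
  assumes p: "p > 1" and q: "q = p / (p - 1)" and n: "2 * q \<le> real (n + 3)" and m: "m + 2 \<le> 2 * q"
    and U: "0 \<le> U" and y: "0 \<le> y" "y \<le> 1" and s: "1 \<le> s" and R: "0 < R" and \<epsilon>: "0 < \<epsilon>"
    and L: "0 < L" and c: "0 < c"
    and G: "\<bar>G\<bar> \<le> L * s powr (m - 1) / R * y ^ (n + 1)" and w: "c * s powr m \<le> w"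
  shows "U * \<bar>G\<bar> \<le> \<epsilon> powr p * (U powr p * (w * y ^ (n + 3)))
     + \<epsilon> powr (- q) * (L * c powr (- (1 / p))) powr q * R powr (- q) * s powr (q - 2)"
proof -
  have "q = 1 + 1 / (p - 1)" unfolding q using p by (simp add: field_simps)
  then have q1: "q > 1" using p by simp
  have pq: "1 / p + 1 / q = 1" unfolding q using p by (simp add: field_simps)
  have "0 \<le> c * s powr m" using c by simp
  then have w0: "0 \<le> w" using w by linarith
  have nonneg: "0 \<le> \<epsilon> powr p * (U powr p * (w * y ^ (n + 3)))"
     "0 \<le> \<epsilon> powr (- q) * (L * c powr (- (1 / p))) powr q * R powr (- q) * s powr (q - 2)"
    using w0 y by simp_all
  show ?thesis
  proof (cases "y = 0")
    case True
    then have "\<bar>G\<bar> \<le> 0" using G by simp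
    then have "U * \<bar>G\<bar> = 0" by simp
    then show ?thesis using nonneg by linarith
  next
    case False
    then have y0: "y > 0" using y by simp
    have s0: "s > 0" using s by simp
    let ?k = "real (n + 3) / p"
    define A where "A = \<epsilon> * U * (c * s powr m) powr (1 / p) * y powr ?k"
    define B where "B = (1 / \<epsilon>) * (L * s powr (m - 1) / R) * (c * s powr m) powr (- (1 / p)) * y powr (real (n + 1) - ?k)"
    have AB0: "0 \<le> A" "0 \<le> B" unfolding A_def B_def using U \<epsilon> L R by (auto intro!: mult_nonneg_nonneg)
    have AB: "A * B = U * (L * s powr (m - 1) / R * y ^ (n + 1))"
    proof -
      have 1: "(c * s powr m) powr (1 / p) * (c * s powr m) powr (- (1 / p)) = 1"
        using c s0 by (simp add: powr_add[symmetric])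
      have 2: "y powr ?k * y powr (real (n + 1) - ?k) = y ^ (n + 1)"
      proof -
        have "y powr ?k * y powr (real (n + 1) - ?k) = y powr (?k + (real (n + 1) - ?k))"
          by (rule powr_add[symmetric])
        also have "\<dots> = y powr real (n + 1)" by simp
        also have "\<dots> = y ^ (n + 1)" by (rule powr_realpow[OF y0])
        finally show ?thesis .
      qed
      have "A * B = U * (L * s powr (m - 1) / R) * (\<epsilon> * (1 / \<epsilon>)) *
         ((c * s powr m) powr (1 / p) * (c * s powr m) powr (- (1 / p))) * (y powr ?k * y powr (real (n + 1) - ?k))"
        unfolding A_def B_def by (simp only: mult_ac)
      then show ?thesis unfolding 1 2 using \<epsilon> by simp
    qed
    have Ap: "A powr p = \<epsilon> powr p * (U powr p * ((c * s powr m) * y ^ (n + 3)))"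
    proof -
      have "A powr p = \<epsilon> powr p * U powr p * ((c * s powr m) powr (1 / p)) powr p * (y powr ?k) powr p"
        unfolding A_def using \<epsilon> U by (simp add: powr_mult)
      also have "((c * s powr m) powr (1 / p)) powr p = c * s powr m"
        using p c s0 by (simp add: powr_powr)
      also have "(y powr ?k) powr p = y ^ (n + 3)"
        using p y0 powr_realpow[of y "n + 3"] by (simp add: powr_powr)
      finally show ?thesis by (simp only: mult_ac)
    qed
    have Bq: "B powr q = \<epsilon> powr (- q) * (L * c powr (- (1 / p))) powr q * R powr (- q) * s powr (m - q) * y powr (real (n + 3) - 2 * q)"
    proof -
      have e1: "(1 / \<epsilon>) powr q = \<epsilon> powr (- q)" using \<epsilon> by (simp add: powr_minus powr_divide field_simps)
      have e2: "(1 / R) powr q = R powr (- q)" using R by (simp add: powr_minus powr_divide field_simps)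
      have e3: "(c * s powr m) powr (- (1 / p)) = c powr (- (1 / p)) * s powr (- (m / p))"
        using c s0 by (simp add: powr_mult powr_powr)
      have qp: "q / p = q - 1" unfolding q using p by (simp add: field_simps)
      have e4: "(s powr (m - 1) * s powr (- (m / p))) powr q = s powr (m - q)"
      proof -
        have "(m - 1 + - (m / p)) * q = m * q - q - m * (q / p)" by (simp add: algebra_simps)
        also have "\<dots> = m - q" unfolding qp by (simp add: algebra_simps)
        finally have "(m - 1 + - (m / p)) * q = m - q" .
        then show ?thesis by (simp only: powr_add[symmetric] powr_powr)
      qed
      have e5: "(y powr (real (n + 1) - ?k)) powr q = y powr (real (n + 3) - 2 * q)"
      proof -
        have "(real (n + 1) - ?k) * q = real (n + 1) * q - real (n + 3) * (q / p)"
          by (simp only: left_diff_distrib times_divide_eq_left times_divide_eq_right)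
        also have "\<dots> = real (n + 3) - 2 * q" unfolding qp by (simp add: algebra_simps)
        finally show ?thesis by (simp only: powr_powr)
      qed
      have "B = (1 / \<epsilon>) * (L * c powr (- (1 / p))) * (1 / R) * (s powr (m - 1) * s powr (- (m / p))) * y powr (real (n + 1) - ?k)"
        unfolding B_def e3 by simp
      then have "B powr q = (1 / \<epsilon>) powr q * (L * c powr (- (1 / p))) powr q * (1 / R) powr q
         * (s powr (m - 1) * s powr (- (m / p))) powr q * (y powr (real (n + 1) - ?k)) powr q"
        using \<epsilon> L R by (simp only: powr_mult)
      then show ?thesis unfolding e1 e2 e4 e5 .
    qed
    have "U * \<bar>G\<bar> \<le> A * B" unfolding AB using G U by (intro mult_left_mono) auto
    also have "\<dots> \<le> A powr p / p + B powr q / q"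
      using Youngs_inequality[OF p q1 pq AB0] .
    also have "\<dots> \<le> A powr p + B powr q"
    proof -
      have dv: "x / k \<le> x" if "0 \<le> x" "1 < k" for x k :: real
        using mult_left_mono[of 1 k x] that by (simp add: divide_le_eq)
      show ?thesis using p q1 by (intro add_mono dv) auto
    qed
    also have "\<dots> \<le> \<epsilon> powr p * (U powr p * (w * y ^ (n + 3)))
       + \<epsilon> powr (- q) * (L * c powr (- (1 / p))) powr q * R powr (- q) * s powr (q - 2)"
    proof (rule add_mono)
      show "A powr p \<le> \<epsilon> powr p * (U powr p * (w * y ^ (n + 3)))"
        unfolding Ap using w y by (intro mult_left_mono mult_right_mono) auto
      have "s powr (m - q) * y powr (real (n + 3) - 2 * q) \<le> s powr (q - 2) * 1"
      proof (rule mult_mono)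
        show "s powr (m - q) \<le> s powr (q - 2)" using m s by (intro powr_mono) auto
        show "y powr (real (n + 3) - 2 * q) \<le> 1" using n y0 y by (intro powr_le1) auto
      qed auto
      then have "\<epsilon> powr (- q) * (L * c powr (- (1 / p))) powr q * R powr (- q) * (s powr (m - q) * y powr (real (n + 3) - 2 * q))
        \<le> \<epsilon> powr (- q) * (L * c powr (- (1 / p))) powr q * R powr (- q) * (s powr (q - 2) * 1)"
        by (intro mult_left_mono) auto
      then show "B powr q \<le> \<epsilon> powr (- q) * (L * c powr (- (1 / p))) powr q * R powr (- q) * s powr (q - 2)"
        unfolding Bq by (simp only: mult.assoc mult_1_right)
    qed
    finally show ?thesis .
  qed
qed

definition tbox :: "real \<Rightarrow> (real \<times> real) set" where
  "tbox r = {0..r} \<times> {-r..r}"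

text \<open>The integrand factorises. Space contributes the length \<open>4 * r\<close>, and time a
  multiple of \<open>r powr (q - 1)\<close>, because \<open>q - 2 > -1\<close> lets the upper
  endpoint dominate. The resulting \<open>r powr q\<close> is exactly what the factor
  \<open>R powr (- q)\<close> from Young's inequality cancels.\<close>

lemma tbox_powr_integral:
  fixes q r :: real
  assumes q: "q > 1" and r: "r \<ge> 1"
  shows "integrable lebesgue (\<lambda>z. indicator (tbox (2 * r)) z * (1 + fst z) powr (q - 2))"
    and "(LINT z|lebesgue. indicator (tbox (2 * r)) z * (1 + fst z) powr (q - 2))
       \<le> 4 * 3 powr (q - 1) / (q - 1) * r powr q"
proof -
  define f where "f t = (1 + t) powr (q - 2) * indicator {0..2 * r} t" for t :: real
  define h where "h x = (indicator {- (2 * r)..2 * r} x :: real)" for x :: real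
  have fm [measurable]: "f \<in> borel_measurable borel" "h \<in> borel_measurable borel"
    unfolding f_def h_def by measurable
  have f0: "0 \<le> f t" for t by (simp add: f_def)
  have D: "((\<lambda>t. (1 + t) powr (q - 1) / (q - 1)) has_real_derivative (1 + t) powr (q - 2)) (at t)" if "0 \<le> t" for t
    using that q by (auto intro!: derivative_eq_intros)
  have C: "isCont (\<lambda>t. (1 + t) powr (q - 2)) t" if "0 \<le> t" for t :: real
    using that by (intro continuous_intros) auto
  have fi: "(LINT t|lborel. f t) = (1 + 2 * r) powr (q - 1) / (q - 1) - (1 + 0) powr (q - 1) / (q - 1)"
    unfolding f_def by (rule integral_FTC_Icc_real) (use r D C in auto)
  have fint: "integrable lborel f"
  proof -
    have "integrable lborel (\<lambda>t. indicator {0..2 * r} t *\<^sub>R ((1 + t) powr (q - 2)))"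
      by (rule borel_integrable_compact) (auto intro!: continuous_intros)
    then show ?thesis unfolding f_def by (simp add: mult.commute)
  qed
  have hi: "(LINT x|lborel. h x) = 4 * r" "integrable lborel h"
    using r by (auto simp: h_def[abs_def])
  have int: "integrable (lborel \<Otimes>\<^sub>M lborel) (\<lambda>(t, x). f t * h x)"
  proof (rule lborel_pair.Fubini_integrable)
    show "(\<lambda>(t, x). f t * h x) \<in> borel_measurable (lborel \<Otimes>\<^sub>M lborel)"
      unfolding case_prod_unfold by measurable
    have "(LINT x|lborel. norm (f t * h x)) = f t * (4 * r)" for t
    proof -
      have "norm (f t * h x) = f t * h x" for x using f0 by (simp add: h_def)
      then show ?thesis using hi by simp
    qed
    then show "integrable lborel (\<lambda>t. LINT x|lborel. norm (case (t, x) of (t, x) \<Rightarrow> f t * h x))"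
      using fint by simp
    show "AE t in lborel. integrable lborel (\<lambda>x. case (t, x) of (t, x) \<Rightarrow> f t * h x)"
      using hi by simp
  qed
  have e: "(\<lambda>z. indicator (tbox (2 * r)) z * (1 + fst z) powr (q - 2)) = (\<lambda>(t, x). f t * h x)"
    by (auto simp: fun_eq_iff tbox_def f_def h_def indicator_def)
  have i2: "integrable lborel (\<lambda>z. indicator (tbox (2 * r)) z * (1 + fst z) powr (q - 2))"
    unfolding e using int by (simp add: lborel_prod)
  then have ml: "(\<lambda>z. indicator (tbox (2 * r)) z * (1 + fst z) powr (q - 2)) \<in> borel_measurable lborel" by auto
  show "integrable lebesgue (\<lambda>z. indicator (tbox (2 * r)) z * (1 + fst z) powr (q - 2))"
    using i2 integrable_completion[OF ml] by simp
  have "(LINT z|lebesgue. indicator (tbox (2 * r)) z * (1 + fst z) powr (q - 2)) 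
      = integral\<^sup>L (lborel \<Otimes>\<^sub>M lborel) (\<lambda>(t, x). f t * h x)"
    using integral_completion[OF ml] by (simp only: e lborel_prod)
  also have "\<dots> = (LINT t|lborel. LINT x|lborel. f t * h x)"
    using lborel_pair.integral_fst'[OF int] by simp
  also have "\<dots> = ((1 + 2 * r) powr (q - 1) / (q - 1) - 1 / (q - 1)) * (4 * r)" using hi fi by simp
  also have "\<dots> \<le> (3 * r) powr (q - 1) / (q - 1) * (4 * r)"
  proof (rule mult_right_mono)
    have "(1 + 2 * r) powr (q - 1) \<le> (3 * r) powr (q - 1)" using r q by (intro powr_mono2) auto
    then have "(1 + 2 * r) powr (q - 1) / (q - 1) \<le> (3 * r) powr (q - 1) / (q - 1)"
      using q by (intro divide_right_mono) auto
    moreover have "0 \<le> 1 / (q - 1)" using q by simp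
    ultimately show "(1 + 2 * r) powr (q - 1) / (q - 1) - 1 / (q - 1) \<le> (3 * r) powr (q - 1) / (q - 1)" by linarith
  qed (use r in simp)
  also have "\<dots> = 4 * 3 powr (q - 1) / (q - 1) * (r powr (q - 1) * r powr 1)" using r by (simp add: powr_mult)
  also have "\<dots> = 4 * 3 powr (q - 1) / (q - 1) * r powr q" using r by (simp only: powr_add[symmetric]) simp
  finally show "(LINT z|lebesgue. indicator (tbox (2 * r)) z * (1 + fst z) powr (q - 2))
       \<le> 4 * 3 powr (q - 1) / (q - 1) * r powr q" .
qed

lemma tbox_lmeasurable: "tbox r \<in> lmeasurable"
  unfolding tbox_def by (intro lmeasurable_compact compact_Times) auto

lemma contS_measurable:
  assumes "contS f"
  shows "(\<lambda>z. indicator ({0..} \<times> UNIV) z * f (fst z) (snd z)) \<in> borel_measurable lebesgue"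
proof -
  have "closed ({0::real..} \<times> (UNIV :: real set))" by (intro closed_Times) auto
  then have "{0::real..} \<times> (UNIV :: real set) \<in> sets borel" by (rule borel_closed)
  from borel_measurable_continuous_on_indicator[OF this assms[unfolded contS_def]]
  show ?thesis by (auto intro: measurable_completion)
qed

text \<open>With \<open>Q(R)\<close> the integral of \<open>\<bar>u\<bar>\<^sup>p g\<close> over the box of size \<open>R\<close>, absorbing the nonlinear term bounds
  \<open>Q\<close>, whereas the fact that \<open>G R\<close> lives on an annulus forces \<open>Q(2R) - Q(R)\<close> to stay above a positive
  constant.\<close>

lemma weighted_test_function_contradiction:
  fixes u g :: "real \<Rightarrow> real \<Rightarrow> real" and G :: "real \<Rightarrow> real \<Rightarrow> real \<Rightarrow> real" and D :: "real \<Rightarrow> real"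
    and p q m c1 c2 L c R0 :: real and n :: nat
  assumes p: "p > 1" and q: "q = p / (p - 1)" and n: "2 * q \<le> real (n + 3)" and m: "0 < m" "m + 2 \<le> 2 * q"
    and u_meas: "(\<lambda>z. indicator ({0..} \<times> UNIV) z * u (fst z) (snd z)) \<in> borel_measurable lebesgue"
    and u_bdd: "\<And>r. \<exists>M\<ge>0. AE z in lebesgue. fst z \<in> {0..r} \<longrightarrow> \<bar>u (fst z) (snd z)\<bar> \<le> M"
    and g_cont: "contS g"
    and c1: "0 < c1" and g_lower: "\<And>t x. 0 \<le> t \<Longrightarrow> c1 * (1 + t) powr m \<le> g t x"
    and g_upper: "\<And>t x. 0 \<le> t \<Longrightarrow> g t x \<le> c2 * (1 + t) powr m"
    and L: "0 < L"
    and G_bound: "\<And>R t x. 1 \<le> R \<Longrightarrow> 0 \<le> t \<Longrightarrow> t \<le> 2 * R \<Longrightarrow>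
        \<bar>G R t x\<bar> \<le> L * (1 + t) powr (m - 1) / R * max 0 (cut_arg R t x) ^ (n + 1)"
    and G_outer: "\<And>R t x. 1 \<le> R \<Longrightarrow> 0 \<le> t \<Longrightarrow> t \<ge> 2 * R \<or> \<bar>x\<bar> \<ge> 2 * R \<Longrightarrow> G R t x = 0"
    and G_inner: "\<And>R t x. 1 \<le> R \<Longrightarrow> 0 \<le> t \<Longrightarrow> t \<le> R \<Longrightarrow> \<bar>x\<bar> \<le> R \<Longrightarrow> G R t x = 0"
    and ident: "\<And>R. 1 \<le> R \<Longrightarrow>
        (LINT z|lebesgue. indicator ({0..} \<times> UNIV) z * (u (fst z) (snd z) * G R (fst z) (snd z)))
        = D R + (LINT z|lebesgue. indicator ({0..} \<times> UNIV) z *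
              (\<bar>u (fst z) (snd z)\<bar> powr p * (g (fst z) (snd z) * cutoff n R (fst z) (snd z))))"
    and c: "0 < c" and D: "\<And>R. R0 \<le> R \<Longrightarrow> c \<le> D R"
  shows False
proof -
  let ?S = "{0..} \<times> UNIV :: (real \<times> real) set"
  have "q = 1 + 1 / (p - 1)" unfolding q using p by (simp add: field_simps)
  then have q1: "q > 1" using p by simp
  define v where "v z = indicator ?S z * (\<bar>u (fst z) (snd z)\<bar> powr p * g (fst z) (snd z))" for z :: "real \<times> real"
  have g0: "0 \<le> g t x" if "0 \<le> t" for t x
  proof -
    have "0 \<le> c1 * (1 + t) powr m" using c1 by simp
    then show ?thesis using g_lower[OF that, of x] by linarith
  qed
  have v0: "0 \<le> v z" for z using g0 by (auto simp: v_def indicator_def)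
  have v_meas [measurable]: "v \<in> borel_measurable lebesgue"
  proof -
    have "v = (\<lambda>z. \<bar>indicator ?S z * u (fst z) (snd z)\<bar> powr p * (indicator ?S z * g (fst z) (snd z)))"
      by (auto simp: v_def fun_eq_iff indicator_def)
    also have "\<dots> \<in> borel_measurable lebesgue"
      using u_meas contS_measurable[OF g_cont] by measurable
    finally show ?thesis .
  qed
  have c2: "0 \<le> c2" using g0[of 0 0] g_upper[of 0 0] by simp
  define W where "W r z = indicator (tbox r) z * v z" for r z
  have [measurable]: "tbox r \<in> sets lebesgue" for r using tbox_lmeasurable by (rule fmeasurableD)
  \<comment> \<open>Here the local bound on \<open>u\<close> enters. Absorbing a term into the other
    side is meaningful only if its integral is finite.\<close>
  have W_int: "integrable lebesgue (W r)" for r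
  proof -
    obtain M where M: "M \<ge> 0" "AE z in lebesgue. fst z \<in> {0..r} \<longrightarrow> \<bar>u (fst z) (snd z)\<bar> \<le> M"
      using u_bdd by blast
    let ?B = "M powr p * (c2 * (1 + r) powr m)"
    have "integrable lebesgue (\<lambda>z. indicator (tbox r) z * ?B)"
      using tbox_lmeasurable[of r] by (intro integrable_mult_left) (simp add: lmeasurable_iff_integrable)
    then show ?thesis
    proof (rule Bochner_Integration.integrable_bound)
      show "W r \<in> borel_measurable lebesgue" unfolding W_def by measurable
      show "AE z in lebesgue. norm (W r z) \<le> norm (indicator (tbox r) z * ?B)"
        using M(2)
      proof eventually_elim
        case (elim z)
        show ?case
        proof (cases "z \<in> tbox r")
          case True
          then have t: "0 \<le> fst z" "fst z \<le> r" by (auto simp: tbox_def)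
          have "\<bar>u (fst z) (snd z)\<bar> powr p \<le> M powr p" using elim t p by (intro powr_mono2) auto
          moreover have "g (fst z) (snd z) \<le> c2 * (1 + r) powr m"
          proof -
            have "c2 * (1 + fst z) powr m \<le> c2 * (1 + r) powr m"
              using t m c2 by (intro mult_left_mono powr_mono2) auto
            then show ?thesis using g_upper[OF t(1), of "snd z"] by linarith
          qed
          ultimately have "\<bar>u (fst z) (snd z)\<bar> powr p * g (fst z) (snd z) \<le> ?B"
            using g0[OF t(1)] by (intro mult_mono) auto
          moreover have "v z = \<bar>u (fst z) (snd z)\<bar> powr p * g (fst z) (snd z)"
            using t by (cases z) (simp add: v_def)
          ultimately show ?thesis using True v0[of z] by (simp add: W_def)
        qed (simp add: W_def)
      qed
    qed
  qed
  define Q where "Q r = (LINT z|lebesgue. W r z)" for r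
  define j where "j R z = v z * cutoff n R (fst z) (snd z)" for R and z :: "real \<times> real"
  have j0: "0 \<le> j R z" for R z using v0 cutoff_bounds01 by (simp add: j_def)
  have j_le: "j R z \<le> W (2 * R) z" if "1 \<le> R" for R z
  proof (cases "z \<in> tbox (2 * R)")
    case True
    then show ?thesis using v0[of z] cutoff_bounds01[of n R] by (simp add: j_def W_def mult_left_le)
  next
    case False
    show ?thesis
    proof (cases "z \<in> ?S")
      case True
      then have "fst z \<ge> 2 * R \<or> \<bar>snd z\<bar> \<ge> 2 * R" using False by (auto simp: tbox_def)
      then have "cutoff n R (fst z) (snd z) = 0" using that by (intro cutoff_eq_0) auto
      then show ?thesis using False by (simp add: j_def W_def)
    qed (simp add: j_def v_def W_def)
  qed
  have le_j: "W R z \<le> j R z" if "1 \<le> R" for R z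
  proof (cases "z \<in> tbox R")
    case True
    then have "cutoff n R (fst z) (snd z) = 1" using that by (intro cutoff_eq_1) (auto simp: tbox_def)
    then show ?thesis using True by (simp add: j_def W_def)
  next
    case False
    then show ?thesis using j0 by (simp add: W_def)
  qed
  have j_int: "integrable lebesgue (j R)" if "1 \<le> R" for R
  proof (rule Bochner_Integration.integrable_bound[OF W_int[of "2 * R"]])
    have "(\<lambda>z. cutoff n R (fst z) (snd z)) \<in> borel_measurable borel"
      by (intro borel_measurable_continuous_onI continuous_cutoff continuous_intros)
    then have [measurable]: "(\<lambda>z. cutoff n R (fst z) (snd z)) \<in> borel_measurable lebesgue"
      by (auto intro: measurable_completion)
    show "j R \<in> borel_measurable lebesgue" unfolding j_def by measurable
    show "AE z in lebesgue. norm (j R z) \<le> norm (W (2 * R) z)"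
      using j0 j_le[OF that] by (auto simp: abs_of_nonneg order_trans[OF _ abs_ge_self])
  qed
  define J where "J R = (LINT z|lebesgue. j R z)" for R
  have id': "(LINT z|lebesgue. indicator ?S z * (u (fst z) (snd z) * G R (fst z) (snd z))) = D R + J R"
    if "1 \<le> R" for R
    using ident[OF that] by (simp add: J_def j_def v_def mult.assoc)
  define C0 where "C0 = (L * c1 powr (- (1 / p))) powr q"
  define e where "e R z = indicator (tbox (2 * R)) z * (1 + fst z) powr (q - 2)" for R and z :: "real \<times> real"
  have e0: "0 \<le> e R z" for R z by (simp add: e_def)
  define K where "K = C0 * (4 * 3 powr (q - 1) / (q - 1))"
  have C00: "0 \<le> C0" by (simp add: C0_def)
  have K0: "0 \<le> K" unfolding K_def using C00 q1 by simp
  have young: "indicator ?S z * (u (fst z) (snd z) * G R (fst z) (snd z))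
     \<le> \<epsilon> powr p * j R z + \<epsilon> powr (- q) * C0 * R powr (- q) * e R z"
    if R: "1 \<le> R" and \<epsilon>: "0 < \<epsilon>" for R \<epsilon> z
  proof (cases "z \<in> tbox (2 * R)")
    case True
    then have t: "0 \<le> fst z" "fst z \<le> 2 * R" by (auto simp: tbox_def)
    have zS: "z \<in> ?S" using t by (cases z) auto
    let ?y = "max 0 (cut_arg R (fst z) (snd z))"
    have "\<bar>u (fst z) (snd z)\<bar> * \<bar>G R (fst z) (snd z)\<bar>
       \<le> \<epsilon> powr p * (\<bar>u (fst z) (snd z)\<bar> powr p * (g (fst z) (snd z) * ?y ^ (n + 3)))
        + \<epsilon> powr (- q) * (L * c1 powr (- (1 / p))) powr q * R powr (- q) * (1 + fst z) powr (q - 2)"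
      by (rule young_weighted[OF p q n m(2) _ _ _ _ _ \<epsilon> L c1 G_bound[OF R t] g_lower[OF t(1)]])
        (use t R cut_arg_le_1[of R] in auto)
    moreover have "u (fst z) (snd z) * G R (fst z) (snd z) \<le> \<bar>u (fst z) (snd z)\<bar> * \<bar>G R (fst z) (snd z)\<bar>"
      by (metis abs_ge_self abs_mult)
    ultimately show ?thesis using zS True 
      by (simp add: j_def v_def e_def C0_def cutoff_def pos_pow_def mult.assoc)
  next
    case False
    have "indicator ?S z * (u (fst z) (snd z) * G R (fst z) (snd z)) = 0"
    proof (cases "z \<in> ?S")
      case True
      then have "0 \<le> fst z" "fst z \<ge> 2 * R \<or> \<bar>snd z\<bar> \<ge> 2 * R" using False by (auto simp: tbox_def)
      then show ?thesis using G_outer[OF R] by simp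
    qed simp
    moreover have "0 \<le> \<epsilon> powr p * j R z + \<epsilon> powr (- q) * C0 * R powr (- q) * e R z"
      using j0 e0 C00 by simp
    ultimately show ?thesis by linarith
  qed
  have e_int: "integrable lebesgue (e R)" and e_le: "\<epsilon> powr (- q) * C0 * R powr (- q) * (LINT z|lebesgue. e R z) \<le> \<epsilon> powr (- q) * K"
    if R: "1 \<le> R" for R \<epsilon>
  proof -
    show "integrable lebesgue (e R)" unfolding e_def by (rule tbox_powr_integral[OF q1 R])
    have "\<epsilon> powr (- q) * C0 * R powr (- q) * (LINT z|lebesgue. e R z)
      \<le> \<epsilon> powr (- q) * C0 * R powr (- q) * (4 * 3 powr (q - 1) / (q - 1) * R powr q)"
      unfolding e_def by (intro mult_left_mono tbox_powr_integral[OF q1 R]) (use C00 in auto)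
    also have "\<dots> = \<epsilon> powr (- q) * K * (R powr (- q) * R powr q)" unfolding K_def by (simp only: mult_ac)
    also have "R powr (- q) * R powr q = 1" using R by (simp add: powr_add[symmetric])
    finally show "\<epsilon> powr (- q) * C0 * R powr (- q) * (LINT z|lebesgue. e R z) \<le> \<epsilon> powr (- q) * K" by simp
  qed
  have est1: "D R + J R \<le> \<epsilon> powr p * J R + \<epsilon> powr (- q) * K" if R: "1 \<le> R" and \<epsilon>: "0 < \<epsilon>" for R \<epsilon>
  proof -
    \<comment> \<open>The integrand on the left need not be integrable: if it is not, its integral
      is \<open>0\<close>, and the comparison still holds because the majorant is
      nonnegative.\<close>
    have "D R + J R \<le> (LINT z|lebesgue. \<epsilon> powr p * j R z + \<epsilon> powr (- q) * C0 * R powr (- q) * e R z)"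
      unfolding id'[OF R, symmetric]
      by (rule integral_mono'[OF _ young[OF R \<epsilon>]])
        (use j_int[OF R] e_int[OF R] j0 e0 C00 in auto)
    also have "\<dots> = \<epsilon> powr p * J R + \<epsilon> powr (- q) * C0 * R powr (- q) * (LINT z|lebesgue. e R z)"
      using j_int[OF R] e_int[OF R] by (simp add: J_def)
    finally show ?thesis using e_le[OF R, of \<epsilon>] by linarith
  qed
  have est2: "D R + J R \<le> \<epsilon> powr p * (Q (2 * R) - Q R) + \<epsilon> powr (- q) * K" if R: "1 \<le> R" and \<epsilon>: "0 < \<epsilon>" for R \<epsilon>
  proof -
    have WW: "0 \<le> W (2 * R) z - W R z" for z using le_j[OF R, of z] j_le[OF R, of z] by linarith
    \<comment> \<open>On \<open>tbox R\<close> the left side vanishes together with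
      \<open>G R\<close>; off \<open>tbox R\<close> the subtracted \<open>W R z\<close> is
      \<open>0\<close>, so nothing is lost by subtracting it.\<close>
    have pw: "indicator ?S z * (u (fst z) (snd z) * G R (fst z) (snd z))
      \<le> \<epsilon> powr p * (W (2 * R) z - W R z) + \<epsilon> powr (- q) * C0 * R powr (- q) * e R z" for z
    proof (cases "z \<in> tbox R")
      case True
      then have "G R (fst z) (snd z) = 0" using R by (intro G_inner) (auto simp: tbox_def)
      moreover have "0 \<le> \<epsilon> powr p * (W (2 * R) z - W R z) + \<epsilon> powr (- q) * C0 * R powr (- q) * e R z"
        using WW e0 C00 by simp
      ultimately show ?thesis by simp
    next
      case False
      then have "W R z = 0" by (simp add: W_def)
      then have "\<epsilon> powr p * j R z \<le> \<epsilon> powr p * (W (2 * R) z - W R z)"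
        using j_le[OF R, of z] by (intro mult_left_mono) auto
      then show ?thesis using young[OF R \<epsilon>, of z] by linarith
    qed
    have "D R + J R \<le> (LINT z|lebesgue. \<epsilon> powr p * (W (2 * R) z - W R z) + \<epsilon> powr (- q) * C0 * R powr (- q) * e R z)"
      unfolding id'[OF R, symmetric]
      by (rule integral_mono'[OF _ pw])
        (use W_int e_int[OF R] WW e0 C00 in \<open>auto intro!: add_nonneg_nonneg mult_nonneg_nonneg\<close>)
    also have "\<dots> = \<epsilon> powr p * (Q (2 * R) - Q R) + \<epsilon> powr (- q) * C0 * R powr (- q) * (LINT z|lebesgue. e R z)"
      using W_int e_int[OF R] by (simp add: Q_def)
    finally show ?thesis using e_le[OF R, of \<epsilon>] by linarith
  qed
  define R1 where "R1 = max 1 R0"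
  have R1: "1 \<le> R" "R0 \<le> R" if "R1 \<le> R" for R using that by (auto simp: R1_def)
  have J0: "0 \<le> J R" for R unfolding J_def by (rule Bochner_Integration.integral_nonneg) (rule j0)
  \<comment> \<open>With \<epsilon> equal to \<open>1 / 2\<close>, the coefficient of
    \<open>J R\<close> is at most \<open>1 / 2\<close> because \<open>p > 1\<close>; as
    \<open>D R\<close> is positive, half of \<open>J R\<close> can be moved to the left.\<close>
  have Q_le: "Q R \<le> 2 * ((1/2) powr (- q) * K)" if R: "R1 \<le> R" for R
  proof -
    have "(1/2::real) powr p \<le> (1/2) powr 1" using p by (intro powr_mono') auto
    then have "(1/2) powr p * J R \<le> 1/2 * J R" using J0 by (intro mult_right_mono) auto
    then have "J R \<le> 2 * ((1/2) powr (- q) * K)"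
      using est1[OF R1(1)[OF R], of "1/2"] D[OF R1(2)[OF R]] c by linarith
    moreover have "Q R \<le> J R" unfolding Q_def J_def
      by (intro integral_mono W_int j_int le_j R1(1)[OF R])
    ultimately show ?thesis by linarith
  qed
  \<comment> \<open>The opposite choice: \<epsilon> is taken so large that the remainder uses up at
    most half of the data term \<open>c\<close>. Writing \<open>K + 1\<close> instead of
    \<open>K\<close> keeps \<epsilon> positive when \<open>K = 0\<close>.\<close>
  obtain \<epsilon> :: real where \<epsilon>: "0 < \<epsilon>" "\<epsilon> powr (- q) * K \<le> c / 2"
  proof -
    let ?e = "(2 * (K + 1) / c) powr (1 / q)"
    have b: "2 * (K + 1) / c > 0" using K0 c by simp
    have "?e powr (- q) = (2 * (K + 1) / c) powr (- 1)" using q1 by (simp add: powr_powr)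
    also have "\<dots> = c / (2 * (K + 1))" using b K0 c by (simp add: powr_minus_divide)
    finally have "?e powr (- q) * K = c / 2 * (K / (K + 1))" by simp
    also have "\<dots> \<le> c / 2 * 1" using c K0 by (intro mult_left_mono) auto
    finally have "?e powr (- q) * K \<le> c / 2" by (simp only: mult_1_right)
    moreover have "0 < ?e" by (rule powr_gt_zero[THEN iffD2, OF less_imp_neq[OF b, symmetric]])
    ultimately show thesis by (intro that)
  qed
  define \<kappa> where "\<kappa> = c / 2 / \<epsilon> powr p"
  have \<kappa>: "0 < \<kappa>" using c \<epsilon> by (simp add: \<kappa>_def)
  have step: "\<kappa> \<le> Q (2 * R) - Q R" if R: "R1 \<le> R" for R
  proof -
    have "c / 2 \<le> \<epsilon> powr p * (Q (2 * R) - Q R)"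
      using est2[OF R1(1)[OF R] \<epsilon>(1)] D[OF R1(2)[OF R]] J0[of R] \<epsilon>(2) by linarith
    then show ?thesis unfolding \<kappa>_def using \<epsilon>(1) by (simp add: pos_divide_le_eq mult.commute)
  qed
  have Q0: "0 \<le> Q r" for r unfolding Q_def by (rule Bochner_Integration.integral_nonneg) (simp add: W_def v0)
  have big: "R1 \<le> 2 ^ N * R1" for N :: nat
  proof -
    have "1 * R1 \<le> 2 ^ N * R1" by (rule mult_right_mono) (auto simp: R1_def)
    then show ?thesis by simp
  qed
  \<comment> \<open>Every doubling of the radius adds at least \<kappa>, so \<open>Q\<close> is
    unbounded along dyadic radii, against the uniform bound \<open>Q_le\<close>.\<close>
  have grow: "real N * \<kappa> \<le> Q (2 ^ N * R1)" for N
  proof (induction N)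
    case (Suc N)
    have dbl: "2 ^ Suc N * R1 = 2 * (2 ^ N * R1)" by simp
    have "\<kappa> + Q (2 ^ N * R1) \<le> Q (2 ^ Suc N * R1)"
      unfolding dbl using step[OF big[of N]] by linarith
    moreover have "real (Suc N) * \<kappa> = \<kappa> + real N * \<kappa>" by (simp add: distrib_right)
    ultimately show ?case using Suc by linarith
  qed (simp add: Q0)
  obtain N :: nat where "2 * ((1/2) powr (- q) * K) < real N * \<kappa>"
    using reals_Archimedean3[OF \<kappa>] by blast
  then show False using grow[of N] Q_le[OF big[of N]] by linarith
qed

section \<open>Blow-up\<close>

text \<open>Equation (H) says exactly that \<open>g = (1 + t)\<^sup>\<mu> (1 + h)\<close> solves the adjoint equation
  \<open>g\<^sub>t\<^sub>t - g\<^sub>x\<^sub>x - (a g)\<^sub>t = 0\<close>.\<close>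

lemma adjoint_identity:
  fixes s r r1 r2 m h ht htt hxx b bt :: real
  assumes "s > 0" "r1 = s * r2" "r = s * r1"
    and "htt - hxx + (m / s - b) * ht - (m / s * b + bt) * (1 + h) = 0"
  shows "(m * ((m - 1) * r2) * (1 + h) + ht * (m * r1)) + (htt * r + m * r1 * ht) - hxx * r
     - ((- m / s\<^sup>2 + bt) * (r * (1 + h)) + (m * r1 * (1 + h) + ht * r) * (m / s + b)) = 0"
    (is "?lhs = 0")
proof -
  have "?lhs = r2 * s\<^sup>2 * (htt - hxx + (m / s - b) * ht - (m / s * b + bt) * (1 + h))"
    using assms(1) unfolding assms(2,3) by (simp add: field_simps power2_eq_square)
  then show ?thesis using assms(4) by simp
qed

text \<open>Here \<open>P * s\<close> is the size of \<open>g\<close>. A derivative of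
  \<open>g\<close>, or multiplication by the damping \<open>a\<close>, removes the factor
  \<open>s\<close>; in the terms with a second derivative of the cutoff,
  \<open>s \<le> 3 * R\<close> trades \<open>s\<close> for one of the two factors
  \<open>1 / R\<close>. All terms thus have the common size \<open>P / R * Y\<close>, and the two of
  the last kind contribute the \<open>12\<close>.\<close>

lemma commutator_bound:
  fixes s R P g gt gx a ft fx ftt fxx A B C N Y :: real
  assumes s: "1 \<le> s" "s \<le> 3 * R" and R: "1 \<le> R" and nn: "0 \<le> P" "0 \<le> A" "0 \<le> B" "0 \<le> C" "0 \<le> N" "0 \<le> Y"
    and g: "\<bar>g\<bar> \<le> 2 * (P * s)" "\<bar>gt\<bar> \<le> A * P" "\<bar>gx\<bar> \<le> C * P" "\<bar>a\<bar> \<le> B / s"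
    and f: "\<bar>ft\<bar> \<le> N / R * Y" "\<bar>fx\<bar> \<le> N / R * Y" "\<bar>ftt\<bar> \<le> N / R\<^sup>2 * Y" "\<bar>fxx\<bar> \<le> N / R\<^sup>2 * Y"
  shows "\<bar>2 * (gt * ft) + g * ftt - 2 * (gx * fx) - g * fxx - a * (g * ft)\<bar> \<le> N * (2 * A + 2 * B + 2 * C + 12) * P / R * Y"
proof -
  define E where "E = P * (N / R * Y)"
  have 1: "\<bar>gt * ft\<bar> \<le> A * E"
  proof -
    have "\<bar>gt\<bar> * \<bar>ft\<bar> \<le> (A * P) * (N / R * Y)" using g(2) f(1) nn by (intro mult_mono) auto
    then show ?thesis by (simp add: abs_mult E_def mult.assoc)
  qed
  have 2: "\<bar>gx * fx\<bar> \<le> C * E"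
  proof -
    have "\<bar>gx\<bar> * \<bar>fx\<bar> \<le> (C * P) * (N / R * Y)" using g(3) f(2) nn by (intro mult_mono) auto
    then show ?thesis by (simp add: abs_mult E_def mult.assoc)
  qed
  have 3: "\<bar>g * z\<bar> \<le> 6 * E" if "\<bar>z\<bar> \<le> N / R\<^sup>2 * Y" for z
  proof -
    have "\<bar>g\<bar> * \<bar>z\<bar> \<le> (2 * (P * s)) * (N / R\<^sup>2 * Y)" using g(1) that nn s by (intro mult_mono) auto
    also have "\<dots> \<le> (2 * (P * (3 * R))) * (N / R\<^sup>2 * Y)"
      using s nn by (intro mult_right_mono mult_left_mono) auto
    also have "\<dots> = 6 * E" using R by (simp add: E_def power2_eq_square)
    finally show ?thesis by (simp add: abs_mult)
  qed
  have 4: "\<bar>a * (g * ft)\<bar> \<le> 2 * B * E"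
  proof -
    have "\<bar>a\<bar> * (\<bar>g\<bar> * \<bar>ft\<bar>) \<le> (B / s) * ((2 * (P * s)) * (N / R * Y))"
      using g(1,4) f(1) nn s by (intro mult_mono mult_nonneg_nonneg) auto
    also have "\<dots> = 2 * B * E" using s by (simp add: E_def)
    finally show ?thesis by (simp add: abs_mult)
  qed
  have "\<bar>2 * (gt * ft) + g * ftt - 2 * (gx * fx) - g * fxx - a * (g * ft)\<bar>
     \<le> 2 * (A * E) + 6 * E + 2 * (C * E) + 6 * E + 2 * B * E"
    using 1 2 3[OF f(3)] 3[OF f(4)] 4 by linarith
  also have "\<dots> = N * (2 * A + 2 * B + 2 * C + 12) * P / R * Y"
    unfolding E_def by (simp add: algebra_simps add_divide_distrib)
  finally show ?thesis .
qed

lemma contS_initial: "contS f \<Longrightarrow> continuous_on UNIV (f 0)"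
  unfolding contS_def
  by (drule continuous_on_compose2[where s = UNIV and f = "\<lambda>x. (0, x)"]) (auto intro!: continuous_intros)

lemma cutoff_t_initial: "R > 0 \<Longrightarrow> cutoff_t n R 0 x = 0"
  by (simp add: cutoff_t_def cut_arg_t_def pos_pow_eq_0)

text \<open>The bounds on \<open>b\<close> and \<open>h\<close> act as follows:
  \<open>\<bar>h\<bar> \<le> \<theta> < 1\<close> keeps \<open>g\<close> between positive multiples
  of \<open>(1 + t) powr \<mu>\<close>, and \<open>k > 1\<close> makes \<open>a\<close>, as well as
  the derivatives of \<open>g\<close> relative to \<open>g\<close>, of order
  \<open>1 / (1 + t)\<close>. The perturbation is therefore invisible at the level of
  scaling.\<close>

lemma maximal_time_finite:
  fixes \<mu> p \<theta> k \<delta> :: real and a b g h u :: "real \<Rightarrow> real \<Rightarrow> real" and u0 u1 :: "real \<Rightarrow> real"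
  assumes \<mu>: "\<mu> > 0" and p: "1 < p" "p \<le> 1 + 2 / \<mu>" and \<theta>: "0 < \<theta>" "\<theta> < 1" and k: "k > 1" and \<delta>: "\<delta> > 0"
    and bC2: "C2_on (slab \<infinity>) b" and bA: "cond_A k \<delta> b"
    and a_def: "a = (\<lambda>t x. \<mu> / (1 + t) + b t x)"
    and hC2: "C2_on (slab \<infinity>) h" and hH: "eq_H \<mu> b h" and hB: "cond_B \<theta> k h"
    and g_def: "g = (\<lambda>t x. (1 + t) powr \<mu> * (1 + h t x))"
    and u0: "u0 \<in> H1" and u1: "u1 \<in> L2"
    and data: "Liminf at_top (\<lambda>R::real. ereal (LINT x:{-R..R}|lebesgue.
           (- Dt g 0 x + g 0 x * a 0 x) * u0 x + g 0 x * u1 x)) > 0"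
    and sol: "solution a p u0 u1 \<infinity> u"
  shows False
proof -
  define q where "q = p / (p - 1)"
  have q_eq: "q = 1 + 1 / (p - 1)" unfolding q_def using p by (simp add: field_simps)
  have mq: "\<mu> + 2 \<le> 2 * q"
  proof -
    have "\<mu> * (p - 1) \<le> 2" using p \<mu> by (simp add: field_simps)
    then have "\<mu> \<le> 2 / (p - 1)" using p by (simp add: field_simps)
    then show ?thesis unfolding q_eq by simp
  qed
  obtain n :: nat where n: "2 * q \<le> real (n + 3)"
    using real_arch_simple[of "2 * q"] by (metis le_add1 of_nat_le_iff order_trans)
  have b_bd: "\<bar>b t x\<bar> \<le> \<delta> / (1 + t) powr k" if "0 \<le> t" for t x
    using bA[unfolded cond_A_def, rule_format, of 0 0 "(t, x)"] that by (simp add: slab_infty)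
  obtain C where C: "C > 0" and h_bd: "\<And>t x. 0 \<le> t \<Longrightarrow> \<bar>h t x\<bar> \<le> \<theta> / (1 + t) powr (k - 1)"
    and hd_bd: "\<And>t x. 0 \<le> t \<Longrightarrow> \<bar>Dt h t x\<bar> + \<bar>Dx h t x\<bar> \<le> C / (1 + t) powr k"
    using hB by (auto simp: cond_B_def slab_infty)
  have h_le: "\<bar>h t x\<bar> \<le> \<theta>" if "0 \<le> t" for t x
  proof -
    have "1 \<le> (1 + t) powr (k - 1)" using that k by (intro ge_one_powr_ge_zero) auto
    then have "\<theta> / (1 + t) powr (k - 1) \<le> \<theta> / 1" using \<theta> by (intro divide_left_mono) auto
    then show ?thesis using h_bd[OF that, of x] by simp
  qed
  have powr_k: "Z / (1 + t) powr k \<le> Z / (1 + t)" if "0 \<le> t" "0 \<le> Z" for t Z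
  proof -
    have "(1 + t) powr 1 \<le> (1 + t) powr k" using that k by (intro powr_mono) auto
    then show ?thesis using that by (intro divide_left_mono) auto
  qed
  note hj = C2_on_imp_jet[OF hC2]
  define gt where "gt t x = \<mu> * (1 + t) powr (\<mu> - 1) * (1 + h t x) + Dt h t x * (1 + t) powr \<mu>" for t x
  \<comment> \<open>The zero factors stem from the product rule, as the power of
    \<open>1 + t\<close> is constant in \<open>x\<close>; they are kept so that the definitions
    match the jet of the product literally.\<close>
  define gx where "gx t x = 0 * (1 + h t x) + Dx h t x * (1 + t) powr \<mu>" for t x
  define gtt where "gtt t x = (\<mu> * ((\<mu> - 1) * (1 + t) powr (\<mu> - 2)) * (1 + h t x) + Dt h t x * (\<mu> * (1 + t) powr (\<mu> - 1)))
     + (Dt (Dt h) t x * (1 + t) powr \<mu> + \<mu> * (1 + t) powr (\<mu> - 1) * Dt h t x)" for t x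
  define gxx where "gxx t x = (0 * (1 + h t x) + Dx h t x * 0) + (Dx (Dx h) t x * (1 + t) powr \<mu> + 0 * Dx h t x)" for t x
  obtain gtx gxt where gj: "C2_jet g gt gx gtt gtx gxt gxx"
    using C2_jet_mult[OF C2_jet_powr[of \<mu>] C2_jet_one_plus[OF hj]]
    unfolding g_def gt_def[abs_def] gx_def[abs_def] gtt_def[abs_def] gxx_def[abs_def] by blast
  define adt where "adt t x = - \<mu> / (1 + t)\<^sup>2 + Dt b t x" for t x
  have a_dt: "has_dt a adt"
  proof -
    have "has_dt (\<lambda>t x. \<mu> / (1 + t)) (\<lambda>t x. - \<mu> / (1 + t)\<^sup>2)"
      unfolding has_dt_def by (auto intro!: derivative_eq_intros simp: power2_eq_square)
    moreover have "has_dt b (Dt b)" using C2_on_imp_jet[OF bC2] by (simp add: C2_jet_def)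
    ultimately show ?thesis unfolding a_def adt_def[abs_def] by (rule has_dt_add)
  qed
  have a_cont: "contS a"
  proof -
    have "contS (\<lambda>t x. \<mu> / (1 + t))" unfolding contS_def by (auto intro!: continuous_intros)
    moreover have "contS b" using C2_on_imp_jet[OF bC2] by (simp add: C2_jet_def)
    ultimately show ?thesis unfolding a_def by (rule contS_intros)
  qed
  have adj: "gtt t x - gxx t x - (adt t x * g t x + gt t x * a t x) = 0" if t: "0 \<le> t" for t x
  proof -
    have H: "Dt (Dt h) t x - Dx (Dx h) t x + (\<mu> / (1 + t) - b t x) * Dt h t x
        - (\<mu> / (1 + t) * b t x + Dt b t x) * (1 + h t x) = 0"
      using hH t by (auto simp: eq_H_def slab_infty)
    have s: "1 + t > 0" using t by simp
    have r1: "(1 + t) powr (\<mu> - 1) = (1 + t) * (1 + t) powr (\<mu> - 2)"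
      using powr_add[of "1 + t" 1 "\<mu> - 2"] s by simp
    have r: "(1 + t) powr \<mu> = (1 + t) * (1 + t) powr (\<mu> - 1)"
      using powr_add[of "1 + t" 1 "\<mu> - 1"] s by simp
    have gxx': "gxx t x = Dx (Dx h) t x * (1 + t) powr \<mu>" by (simp add: gxx_def)
    show ?thesis using adjoint_identity[OF s r1 r H] unfolding gtt_def gxx' adt_def gt_def g_def a_def .
  qed
  define \<psi> where "\<psi> R t x = g t x * cutoff n R t x" for R t x
  \<comment> \<open>The commutator of the adjoint operator with the cutoff, applied to
    \<open>g\<close>: what is left once the terms with the undifferentiated cutoff cancel by
    \<open>adj\<close>.\<close>
  define G where "G R t x = 2 * (gt t x * cutoff_t n R t x) + g t x * cutoff_tt n R t x - 2 * (gx t x * cutoff_x n R t x)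
     - g t x * cutoff_xx n R t x - a t x * (g t x * cutoff_t n R t x)" for R t x
  have \<psi>_supp: "C2_compact_support \<infinity> (\<psi> R)" 
    and \<psi>_op: "\<And>t x. 0 \<le> t \<Longrightarrow> Dt (Dt (\<psi> R)) t x - Dx (Dx (\<psi> R)) t x - Dt (\<lambda>s y. a s y * \<psi> R s y) t x = G R t x"
    and \<psi>_init: "\<And>x. Dt (\<psi> R) 0 x = gt 0 x * cutoff n R 0 x"
    if R: "1 \<le> R" for R
  proof -
    have R0: "R > 0" using R by simp
    have "(\<lambda>t x. g t x * cutoff n R t x) = \<psi> R" by (simp add: \<psi>_def fun_eq_iff)
    note \<psi>j = C2_jet_mult[OF gj cutoff_jet[OF R0, of n], unfolded this]
    show "C2_compact_support \<infinity> (\<psi> R)" unfolding C2_compact_support_def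
    proof (intro conjI exI ballI)
      show "C2_on (slab \<infinity>) (\<psi> R)" by (rule C2_jet_imp_C2_on[OF \<psi>j])
      show "compact ({0..2 * R} \<times> {- 2 * R..2 * R})" by (intro compact_Times) auto
      show "{0..2 * R} \<times> {- 2 * R..2 * R} \<subseteq> slab \<infinity>" by (auto simp: slab_infty)
      fix z assume "z \<in> slab \<infinity> - {0..2 * R} \<times> {- 2 * R..2 * R}"
      then have "cutoff n R (fst z) (snd z) = 0"
        by (intro cutoff_eq_0[OF R0]) (auto simp: slab_infty)
      then show "case z of (t, x) \<Rightarrow> \<psi> R t x = 0" by (cases z) (simp add: \<psi>_def)
    qed
    have \<psi>t: "has_dt (\<psi> R) (\<lambda>t x. gt t x * cutoff n R t x + cutoff_t n R t x * g t x)"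
      using \<psi>j by (simp add: C2_jet_def)
    show "Dt (\<psi> R) 0 x = gt 0 x * cutoff n R 0 x" for x
      using has_dt_imp_Dt[OF \<psi>t, of 0 x] cutoff_t_initial[OF R0, of n x] by simp
    fix t x :: real assume t: "0 \<le> t"
    have "Dt (\<lambda>s y. a s y * \<psi> R s y) t x
      = adt t x * \<psi> R t x + (gt t x * cutoff n R t x + cutoff_t n R t x * g t x) * a t x"
      using has_dt_imp_Dt[OF has_dt_mult[OF a_dt \<psi>t] t] .
    then have "Dt (Dt (\<psi> R)) t x - Dx (Dx (\<psi> R)) t x - Dt (\<lambda>s y. a s y * \<psi> R s y) t x
      = G R t x + (gtt t x - gxx t x - (adt t x * g t x + gt t x * a t x)) * cutoff n R t x"
      unfolding C2_jet_derivs(3,4)[OF \<psi>j t] G_def \<psi>_def by (simp add: algebra_simps)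
    then show "Dt (Dt (\<psi> R)) t x - Dx (Dx (\<psi> R)) t x - Dt (\<lambda>s y. a s y * \<psi> R s y) t x = G R t x"
      using adj[OF t] by simp
  qed
  define N where "N = real (n + 3) * real (n + 3) * 48"
  \<comment> \<open>The constant of \<open>commutator_bound\<close> for
    \<open>2 * \<mu> + C\<close>, \<open>\<mu> + \<delta>\<close> and \<open>C\<close> as the bounds
    belonging to \<open>gt\<close>, \<open>a\<close> and \<open>gx\<close>.\<close>
  define L where "L = N * (2 * (2 * \<mu> + C) + 2 * (\<mu> + \<delta>) + 2 * C + 12)"
  have N0: "0 < N" unfolding N_def by simp
  have L0: "0 < L" unfolding L_def using N0 \<mu> \<delta> C by (intro mult_pos_pos add_pos_pos) auto
  define F where "F x = (- Dt g 0 x + g 0 x * a 0 x) * u0 x + g 0 x * u1 x" for x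
  define D where "D R = (LINT x|lebesgue. (a 0 x * u0 x + u1 x) * \<psi> R 0 x - u0 x * Dt (\<psi> R) 0 x)" for R
  have g_init: "Dt g 0 x = gt 0 x" for x using C2_jet_derivs(1)[OF gj, of 0 x] by simp
  \<comment> \<open>The time derivative of the cutoff vanishes at \<open>t = 0\<close>, so there
    \<open>Dt\<close> acts on \<open>g\<close> alone, and the boundary term of the weak formulation
    becomes the integrand of the data condition times the cutoff.\<close>
  have D_eq: "D R = (LINT x|lebesgue. F x * cutoff n R 0 x)" if "1 \<le> R" for R
    unfolding D_def F_def \<psi>_init[OF that] g_init by (simp add: \<psi>_def algebra_simps)
  have F_int: "integrable lebesgue (\<lambda>x. indicator {-r..r} x * F x)" for r
  proof -
    have "contS g" "contS gt" using gj by (auto simp: C2_jet_def)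
    then have c: "continuous_on UNIV (g 0)" "continuous_on UNIV (gt 0)" "continuous_on UNIV (a 0)"
      using a_cont contS_initial by blast+
    have "u0 \<in> L2" using u0 by (simp add: H1_def)
    then have "integrable lebesgue (\<lambda>x. indicator {-r..r} x * (u0 x * (- gt 0 x + g 0 x * a 0 x)))"
      using c by (intro L2_mult_continuous_integrable continuous_intros) auto
    moreover have "integrable lebesgue (\<lambda>x. indicator {-r..r} x * (u1 x * g 0 x))"
      using c u1 by (intro L2_mult_continuous_integrable) auto
    ultimately have "integrable lebesgue (\<lambda>x. indicator {-r..r} x * (u0 x * (- gt 0 x + g 0 x * a 0 x))
      + indicator {-r..r} x * (u1 x * g 0 x))" by (rule Bochner_Integration.integrable_add)
    then show ?thesis unfolding F_def g_init by (simp add: distrib_left mult.commute)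
  qed
  have F_meas: "F \<in> borel_measurable lebesgue"
  proof -
    have "contS g" "contS gt" using gj by (auto simp: C2_jet_def)
    then have c: "continuous_on UNIV (g 0)" "continuous_on UNIV (gt 0)" "continuous_on UNIV (a 0)"
      using a_cont contS_initial by blast+
    then have [measurable]: "g 0 \<in> borel_measurable lebesgue" "gt 0 \<in> borel_measurable lebesgue" "a 0 \<in> borel_measurable lebesgue"
      using borel_measurable_continuous_onI by (auto intro!: measurable_completion)
    have [measurable]: "u0 \<in> borel_measurable lebesgue" "u1 \<in> borel_measurable lebesgue"
      using u0 u1 by (auto simp: H1_def L2_def)
    show ?thesis unfolding F_def[abs_def] g_init by measurable
  qed
  obtain c where c: "0 < c" "ereal c < Liminf at_top (\<lambda>R::real. ereal (LINT x:{-R..R}|lebesgue. F x))"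
    using ereal_dense2[OF data[folded F_def]] by auto
  have "\<forall>\<^sub>F R in at_top. c < (LINT x:{-R..R}|lebesgue. F x)"
    using less_LiminfD[OF c(2)] by simp
  then obtain R0 where R0: "\<And>R. R0 \<le> R \<Longrightarrow> c < (LINT x:{-R..R}|lebesgue. F x)"
    by (auto simp: eventually_at_top_linorder)
  have D_ge: "c \<le> D R" if "max 1 R0 \<le> R" for R
  proof -
    have R: "1 \<le> R" "R0 \<le> R" using that by auto
    have "c \<le> (LINT x|lebesgue. F x * cutoff n R 0 x)"
    proof (rule integral_cutoff_ge[OF F_meas F_int])
      fix r assume "R \<le> r"
      then show "c \<le> (LINT x|lebesgue. indicator {-r..r} x * F x)"
        using R0[of r] R by (simp add: set_lebesgue_integral_def)
    qed (use R in simp)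
    then show ?thesis using D_eq[OF R(1)] by simp
  qed
  have uX: "u \<in> X \<infinity>" using sol by (simp add: solution_def)
  show False
  proof (rule weighted_test_function_contradiction[of p q n \<mu> u g "1 - \<theta>" 2 L G D c "max 1 R0"])
    show "(\<lambda>z. indicator ({0..} \<times> UNIV) z * u (fst z) (snd z)) \<in> borel_measurable lebesgue"
      using uX by (simp add: X_def set_borel_measurable_def case_prod_unfold slab_infty)
    show "\<exists>M\<ge>0. AE z in lebesgue. fst z \<in> {0..r} \<longrightarrow> \<bar>u (fst z) (snd z)\<bar> \<le> M" for r
      by (rule X_bounded_AE_joint[OF uX])
    show "contS g" using gj by (simp add: C2_jet_def)
    show "(1 - \<theta>) * (1 + t) powr \<mu> \<le> g t x" if "0 \<le> t" for t x
      using h_le[OF that, of x] unfolding g_def by (subst mult.commute, intro mult_left_mono) auto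
    show g_up: "g t x \<le> 2 * (1 + t) powr \<mu>" if "0 \<le> t" for t x
      using h_le[OF that, of x] \<theta> unfolding g_def by (subst (2) mult.commute, intro mult_left_mono) auto
    fix R t x :: real assume R: "1 \<le> R" and t: "0 \<le> t"
    show "G R t x = 0" if "t \<ge> 2 * R \<or> \<bar>x\<bar> \<ge> 2 * R"
    proof -
      have "cut_arg R t x \<le> 0" using cut_arg_nonpos[of R t x] that R by auto
      then have "pos_pow (n + 2) (cut_arg R t x) = 0" "pos_pow (n + 1) (cut_arg R t x) = 0"
        by (auto intro!: pos_pow_eq_0)
      then show ?thesis by (simp add: G_def cutoff_t_def cutoff_tt_def cutoff_x_def cutoff_xx_def)
    qed
    show "G R t x = 0" if "t \<le> R" "\<bar>x\<bar> \<le> R"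
      using cutoff_derivs_zero_inner[of R t x n] R that by (simp add: G_def)
    assume tR: "t \<le> 2 * R"
    let ?P = "(1 + t) powr (\<mu> - 1)"
    have s: "1 + t > 0" using t by simp
    have Ps: "(1 + t) powr \<mu> = ?P * (1 + t)"
      using powr_add[of "1 + t" 1 "\<mu> - 1"] s by simp
    have hh: "0 \<le> 1 + h t x" "1 + h t x \<le> 2" using h_le[OF t, of x] \<theta> by auto
    have der: "\<bar>z * (1 + t) powr \<mu>\<bar> \<le> C * ?P" if "\<bar>z\<bar> \<le> C / (1 + t) powr k" for z
    proof -
      have "\<bar>z\<bar> \<le> C / (1 + t)" using that powr_k[OF t, of C] C by linarith
      then have "\<bar>z\<bar> * (?P * (1 + t)) \<le> C / (1 + t) * (?P * (1 + t))" using s by (intro mult_right_mono) auto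
      then show ?thesis unfolding Ps using s by (simp add: abs_mult)
    qed
    show "\<bar>G R t x\<bar> \<le> L * ?P / R * max 0 (cut_arg R t x) ^ (n + 1)"
      unfolding G_def L_def pos_pow_def[symmetric]
    proof (rule commutator_bound[where s = "1 + t"])
      show "\<bar>g t x\<bar> \<le> 2 * (?P * (1 + t))"
        using g_up[OF t, of x] hh(1) unfolding Ps[symmetric] by (simp add: g_def abs_mult)
      show "\<bar>gt t x\<bar> \<le> (2 * \<mu> + C) * ?P"
      proof -
        have "\<bar>Dt h t x * (1 + t) powr \<mu>\<bar> \<le> C * ?P" using hd_bd[OF t, of x] by (intro der) linarith
        moreover have "\<bar>\<mu> * ?P * (1 + h t x)\<bar> \<le> \<mu> * ?P * 2"
          using hh \<mu> by (simp add: abs_mult mult_left_mono)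
        ultimately have "\<bar>gt t x\<bar> \<le> \<mu> * ?P * 2 + C * ?P" unfolding gt_def by linarith
        then show ?thesis by (simp add: algebra_simps)
      qed
      show "\<bar>gx t x\<bar> \<le> C * ?P"
      proof -
        have "\<bar>Dx h t x * (1 + t) powr \<mu>\<bar> \<le> C * ?P" using hd_bd[OF t, of x] by (intro der) linarith
        then show ?thesis by (simp add: gx_def)
      qed
      show "\<bar>a t x\<bar> \<le> (\<mu> + \<delta>) / (1 + t)"
      proof -
        have "\<bar>b t x\<bar> \<le> \<delta> / (1 + t)" using b_bd[OF t, of x] powr_k[OF t, of \<delta>] \<delta> by linarith
        moreover have "\<bar>\<mu> / (1 + t)\<bar> = \<mu> / (1 + t)" using \<mu> t by simp
        ultimately show ?thesis unfolding a_def add_divide_distrib by linarith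
      qed
    qed (use t tR R \<mu> \<delta> C N0 cutoff_bounds[of R n t x] pos_pow_bounds in \<open>auto simp: N_def\<close>)
  next
    fix R :: real assume R: "1 \<le> R"
    have eq: "(LINT (t, x):slab \<infinity>|lebesgue.
           u t x * (Dt (Dt (\<psi> R)) t x - Dx (Dx (\<psi> R)) t x - Dt (\<lambda>s y. a s y * \<psi> R s y) t x))
        = D R + (LINT (t, x):slab \<infinity>|lebesgue. \<bar>u t x\<bar> powr p * \<psi> R t x)"
      using sol \<psi>_supp[OF R] unfolding solution_def D_def by blast
    have "(LINT (t, x):slab \<infinity>|lebesgue.
           u t x * (Dt (Dt (\<psi> R)) t x - Dx (Dx (\<psi> R)) t x - Dt (\<lambda>s y. a s y * \<psi> R s y) t x))
       = (LINT z|lebesgue. indicator ({0..} \<times> UNIV) z * (u (fst z) (snd z) * G R (fst z) (snd z)))"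
      unfolding set_lebesgue_integral_def slab_infty
      by (rule Bochner_Integration.integral_cong[OF refl]) (auto simp: indicator_def \<psi>_op[OF R])
    moreover have "(LINT (t, x):slab \<infinity>|lebesgue. \<bar>u t x\<bar> powr p * \<psi> R t x)
       = (LINT z|lebesgue. indicator ({0..} \<times> UNIV) z *
              (\<bar>u (fst z) (snd z)\<bar> powr p * (g (fst z) (snd z) * cutoff n R (fst z) (snd z))))"
      unfolding set_lebesgue_integral_def slab_infty
      by (simp add: case_prod_unfold \<psi>_def)
    ultimately show "(LINT z|lebesgue. indicator ({0..} \<times> UNIV) z * (u (fst z) (snd z) * G R (fst z) (snd z)))
        = D R + (LINT z|lebesgue. indicator ({0..} \<times> UNIV) z *
              (\<bar>u (fst z) (snd z)\<bar> powr p * (g (fst z) (snd z) * cutoff n R (fst z) (snd z))))"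
      using eq by simp
  qed (use p q_def n \<mu> mq \<theta> L0 c D_ge in auto)
qed

text \<open>The local theory provides blow-up for some maximal solution \<open>v\<close>. Maximality
  on both sides forces equal existence times, and uniqueness makes \<open>u\<close> and
  \<open>v\<close> agree almost everywhere at each time, which suffices to transfer the
  blow-up.\<close>

lemma local_solution_norm_blowup:
  assumes ex: "local_existence a p" and u0: "u0 \<in> H1" and u1: "u1 \<in> L2"
    and ls: "local_solution a p u0 u1 T u" and T: "T < \<infinity>"
  shows "norm_blowup_at (real_of_ereal T) u"
proof -
  obtain T' v where v: "local_solution a p u0 u1 T' v"
    and uniq: "\<And>w t. solution a p u0 u1 T' w \<Longrightarrow> 0 \<le> t \<Longrightarrow> ereal t < T' \<Longrightarrow> AE x in lebesgue. w t x = v t x"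
    and nb: "T' < \<infinity> \<Longrightarrow> norm_blowup_at (real_of_ereal T') v"
    using ex u0 u1 unfolding local_existence_def by blast
  have "T' = T"
    using v ls unfolding local_solution_def by (meson linorder_neqE)
  obtain r where r: "T = ereal r" using T ls by (cases T) (auto simp: local_solution_def)
  have "0 < r" using ls r by (simp add: local_solution_def)
  moreover have "u \<in> X (ereal r)" "v \<in> X (ereal r)" "solution a p u0 u1 T u"
    using ls v r \<open>T' = T\<close> by (auto simp: local_solution_def solution_def)
  ultimately show ?thesis
    using norm_blowup_at_cong_AE[of u r v] uniq[of u] nb \<open>T' = T\<close> r by simp
qed

theorem theorem1p7:
  fixes \<mu> p \<theta> k \<delta>0 \<delta> :: real
    and a b g h u :: "real \<Rightarrow> real \<Rightarrow> real"
    and u0 u1 :: "real \<Rightarrow> real"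
    and Tstar :: ereal
  assumes "\<mu> > 0" and "1 < p" and "p \<le> 1 + 2 / \<mu>"
    and "0 < \<theta>" and "\<theta> < 1" and "k > max 1 \<mu>"
    and "\<delta>0 > 0"
    and "\<forall>\<delta>'\<in>{0<..<\<delta>0}. \<forall>b'. C2_on (slab \<infinity>) b' \<and> cond_A k \<delta>' b' \<longrightarrow>
           (\<exists>h'. C2_on (slab \<infinity>) h' \<and> eq_H \<mu> b' h' \<and> cond_B \<theta> k h')"
    and "\<delta> \<in> {0<..<\<delta>0}"
    and "C2_on (slab \<infinity>) b" and "cond_A k \<delta> b"
    and "a = (\<lambda>t x. \<mu> / (1 + t) + b t x)"
    and "C2_on (slab \<infinity>) h" and "eq_H \<mu> b h" and "cond_B \<theta> k h"
    and "g = (\<lambda>t x. (1 + t) powr \<mu> * (1 + h t x))"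
    and "u0 \<in> H1" and "u1 \<in> L2"
    and "Liminf at_top (\<lambda>R::real. ereal (LINT x:{-R..R}|lebesgue.
           (- Dt g 0 x + g 0 x * a 0 x) * u0 x + g 0 x * u1 x)) > 0"
    and "local_existence a p"
    and "local_solution a p u0 u1 Tstar u"
  shows "Tstar < \<infinity> \<and> norm_blowup_at (real_of_ereal Tstar) u"
proof -
  have "Tstar < \<infinity>"
  proof (rule ccontr)
    assume "\<not> Tstar < \<infinity>"
    then have sol: "solution a p u0 u1 \<infinity> u"
      using assms(21) by (simp add: local_solution_def)
    have "1 < k" "0 < \<delta>" using assms(6,9) by auto
    from maximal_time_finite[OF assms(1-5) this assms(10-19) sol] show False .
  qed
  moreover have "norm_blowup_at (real_of_ereal Tstar) u"
    by (rule local_solution_norm_blowup[OF assms(20,17,18,21) calculation])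
  ultimately show ?thesis by blast
qed

end
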